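(* Let $\beta>0$ and let $B^e$ be the elastic Brownian motion on $\mathbb{R}_+=[0,+\infty)$ with parameter $\beta$ (reflecting Brownian motion killed at the first time its local time at the origin exceeds an independent exponential random variable of rate $\beta$; precise definition in the context). Let $A^e$ be the generator of its semigroup on $C_0(\mathbb{R}_+)$. Then the domain $\mathcal{D}(A^e)$ is equal to the space of functions $f\in C_0^2(\mathbb{R}_+)$ such that $$f'(0+)=\beta f(0).$$
   Context: Setting. $(\Omega,\mathcal{A})$ is a measurable space with probability measures $(P_x,\,x\in\mathbb{R})$ and a right continuous filtration $\mathcal{F}=(\mathcal{F}_t,\,t\ge0)$, complete with respect to $(P_x)$; $B=(B_t,\,t\ge0)$ is a standard one-dimensional Brownian motion relative to $\mathcal{F}$ with $P_x(B_0=x)=1$, equipped with shift operators $\theta_t:\Omega\to\Omega$ with $B_s\circ\theta_t=B_{s+t}$. $L=(L_t,\,t\ge0)$ is the local time of $B$ at $0$, normalized so that Tanaka's formula reads $d|B_t|=\operatorname{sign}(B_t)\,dB_t+dL_t$. All paths of $B$ and $L$ are continuous. Elastic Brownian motion. Let $P_\beta$ be the exponential law of rate $\beta$ on $\mathbb{R}_+$, $S(s)=s$ the identity random variable on $\mathbb{R}_+$, and $\hat\Omega=\Omega\times\mathbb{R}_+$ with product $\sigma$-algebra and measures $\hat P_x=P_x\otimes P_\beta$. All random variables are extended trivially to $\hat\Omega$. Put $\zeta_\beta=\inf\{t\ge0:\,L_t>S\}$, and $B^e_t=|B_t|$ for $t<\zeta_\beta$, $B^e_t=\Delta$ for $t\ge\zeta_\beta$,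 where $\Delta$ is a cemetery point. Every function $f$ on $\mathbb{R}_+$ is extended by $f(\Delta)=0$. The semigroup is $U^e_tf(x)=\hat E_x(f(B^e_t))$, $x\in\mathbb{R}_+$, and $A^e$ is its infinitesimal generator on $C_0(\mathbb{R}_+)$. $C_0(\mathbb{R}_+)$ is the space of real continuous functions on $[0,+\infty)$ vanishing at infinity. $C_0^2(\mathbb{R}_+)$ is the subspace of those $f\in C_0(\mathbb{R}_+)$ that are twice continuously differentiable on $(0,+\infty)$ and such that $f''$ extends to a continuous function on $[0,+\infty)$; for such $f$ the finite right limit $f'(0+)$ of $f'$ at $0$ exists.
   Formalization: The space C_0^2 is taken with f'' extending to a function in C_0(R_+) (continuous and vanishing at infinity), not merely continuous; otherwise f = sin(x^2)/x for large x, zero near 0, would be a counterexample. *)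

theory Defs
  imports "HOL-Probability.Probability"
begin

text \<open>
  Time runs through \<open>{0..}\<close>. Processes are functions \<open>real \<Rightarrow> 'a \<Rightarrow> real\<close>, and nothing is assumed
  about their values at negative times.
\<close>

section \<open>The Brownian family\<close>

locale complete_filtration =
  fixes M :: "'a measure" and P :: "real \<Rightarrow> 'a measure" and F :: "real \<Rightarrow> 'a measure"
  assumes prob: "\<And>x. prob_space (P x)"
    and sets_P: "\<And>x. sets (P x) = sets M"
    and subalgebra_F: "\<And>t. 0 \<le> t \<Longrightarrow> subalgebra M (F t)"
    and mono_F: "\<And>s t. 0 \<le> s \<Longrightarrow> s \<le> t \<Longrightarrow> sets (F s) \<subseteq> sets (F t)"
    and right_continuous_F: "\<And>t. 0 \<le> t \<Longrightarrow> sets (F t) = (\<Inter>s\<in>{t<..}. sets (F s))"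
    and complete_F:
      "\<And>N N'. N \<subseteq> N' \<Longrightarrow> (\<And>x. N' \<in> null_sets (P x)) \<Longrightarrow> N \<in> sets (F 0)"

locale brownian_family = complete_filtration M P F
  for M :: "'a measure" and P :: "real \<Rightarrow> 'a measure" and F :: "real \<Rightarrow> 'a measure" +
  fixes B :: "real \<Rightarrow> 'a \<Rightarrow> real" and \<theta> :: "real \<Rightarrow> 'a \<Rightarrow> 'a"
  assumes adapted_B: "\<And>t. 0 \<le> t \<Longrightarrow> B t \<in> borel_measurable (F t)"
    and start_B: "\<And>x. AE \<omega> in P x. B 0 \<omega> = x"
    and increment_B: "\<And>x s t. 0 \<le> s \<Longrightarrow> s < t \<Longrightarrow>
      distributed (P x) lborel (\<lambda>\<omega>. B t \<omega> - B s \<omega>)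
        (\<lambda>y. ennreal (normal_density 0 (sqrt (t - s)) y))"
    and indep_increment_B: "\<And>x s t. 0 \<le> s \<Longrightarrow> s < t \<Longrightarrow>
      prob_space.indep_set (P x) (sets (F s))
        {(\<lambda>\<omega>. B t \<omega> - B s \<omega>) -` A \<inter> space M |A. A \<in> sets borel}"
    and paths_B: "\<And>\<omega>. \<omega> \<in> space M \<Longrightarrow> continuous_on {0..} (\<lambda>t. B t \<omega>)"
    and shift_space: "\<And>t \<omega>. 0 \<le> t \<Longrightarrow> \<omega> \<in> space M \<Longrightarrow> \<theta> t \<omega> \<in> space M"
    and shift_B: "\<And>s t \<omega>. 0 \<le> s \<Longrightarrow> 0 \<le> t \<Longrightarrow> \<omega> \<in> space M \<Longrightarrow> B s (\<theta> t \<omega>) = B (s + t) \<omega>"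

section \<open>Stochastic integral and local time\<close>

text \<open>
  The triple \<open>n, \<tau>, \<xi>\<close> stands for the elementary predictable process
  \<open>\<Sum>i<n. \<xi> i * 1{\<tau> i < s \<le> \<tau> (i + 1)}\<close>.
\<close>

definition elementary_process ::
  "'a measure \<Rightarrow> (real \<Rightarrow> 'a measure) \<Rightarrow> nat \<Rightarrow> (nat \<Rightarrow> real) \<Rightarrow> (nat \<Rightarrow> 'a \<Rightarrow> real) \<Rightarrow> bool" where
  "elementary_process M F n \<tau> \<xi> \<longleftrightarrow>
     0 \<le> \<tau> 0 \<and> (\<forall>i<n. \<tau> i \<le> \<tau> (Suc i)) \<and>
     (\<forall>i<n. \<xi> i \<in> borel_measurable (F (\<tau> i)) \<and> bounded (\<xi> i ` space M))"

definition elementary_value ::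
  "nat \<Rightarrow> (nat \<Rightarrow> real) \<Rightarrow> (nat \<Rightarrow> 'a \<Rightarrow> real) \<Rightarrow> real \<Rightarrow> 'a \<Rightarrow> real" where
  "elementary_value n \<tau> \<xi> s \<omega> = (\<Sum>i<n. \<xi> i \<omega> * indicator {\<tau> i<..\<tau> (Suc i)} s)"

definition elementary_integral ::
  "(real \<Rightarrow> 'a \<Rightarrow> real) \<Rightarrow> nat \<Rightarrow> (nat \<Rightarrow> real) \<Rightarrow> (nat \<Rightarrow> 'a \<Rightarrow> real) \<Rightarrow> real \<Rightarrow> 'a \<Rightarrow> real" where
  "elementary_integral B n \<tau> \<xi> t \<omega> =
     (\<Sum>i<n. \<xi> i \<omega> * (B (min t (\<tau> (Suc i))) \<omega> - B (min t (\<tau> i)) \<omega>))"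

text \<open>
  \<open>I\<close> is a version of the Ito integral of \<open>H\<close> against \<open>B\<close> over \<open>[0, t]\<close> under \<open>Q\<close>: elementary
  processes converge to \<open>H\<close> in \<open>L\<^sup>2(Q \<otimes> ds)\<close> on \<open>[0, t]\<close>, and their integrals to \<open>I\<close> in \<open>L\<^sup>2(Q)\<close>.
\<close>

definition has_ito_integral ::
  "'a measure \<Rightarrow> (real \<Rightarrow> 'a measure) \<Rightarrow> (real \<Rightarrow> 'a \<Rightarrow> real) \<Rightarrow> real \<Rightarrow>
   (real \<Rightarrow> 'a \<Rightarrow> real) \<Rightarrow> ('a \<Rightarrow> real) \<Rightarrow> bool" where
  "has_ito_integral Q F B t H I \<longleftrightarrow>
     I \<in> borel_measurable Q \<and>
     (\<exists>n \<tau> \<xi>. (\<forall>k::nat. elementary_process Q F (n k) (\<tau> k) (\<xi> k)) \<and>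
        (\<lambda>k. \<integral>\<^sup>+\<omega>. (\<integral>\<^sup>+s\<in>{0..t}. ennreal ((elementary_value (n k) (\<tau> k) (\<xi> k) s \<omega> - H s \<omega>)\<^sup>2)
                \<partial>lborel) \<partial>Q) \<longlonglongrightarrow> 0 \<and>
        (\<lambda>k. \<integral>\<^sup>+\<omega>. ennreal ((elementary_integral B (n k) (\<tau> k) (\<xi> k) t \<omega> - I \<omega>)\<^sup>2) \<partial>Q) \<longlonglongrightarrow> 0)"

text \<open>
  Local time at 0 is the continuous adapted increasing process in Tanaka's formula
  \<open>|B\<^sub>t| = |B\<^sub>0| + \<integral>\<^sub>0\<^sup>t sign(B\<^sub>s) dB\<^sub>s + L\<^sub>t\<close>, which fixes both the process (up to null sets) and its
  normalization. The value of the sign at 0 is immaterial, as the zero set of \<open>B\<close> is Lebesgue null.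
\<close>

definition local_time_at_0 ::
  "'a measure \<Rightarrow> (real \<Rightarrow> 'a measure) \<Rightarrow> (real \<Rightarrow> 'a measure) \<Rightarrow>
   (real \<Rightarrow> 'a \<Rightarrow> real) \<Rightarrow> (real \<Rightarrow> 'a \<Rightarrow> real) \<Rightarrow> bool" where
  "local_time_at_0 M P F B L \<longleftrightarrow>
     (\<forall>t\<ge>0. L t \<in> borel_measurable (F t)) \<and>
     (\<forall>\<omega>\<in>space M. continuous_on {0..} (\<lambda>t. L t \<omega>)) \<and>
     (\<forall>x. AE \<omega> in P x. mono_on {0..} (\<lambda>t. L t \<omega>)) \<and>
     (\<forall>x. \<forall>t\<ge>0. \<exists>I. has_ito_integral (P x) F B t (\<lambda>s \<omega>. sgn (B s \<omega>)) I \<and>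
        (AE \<omega> in P x. \<bar>B t \<omega>\<bar> = \<bar>B 0 \<omega>\<bar> + I \<omega> + L t \<omega>))"

section \<open>Elastic Brownian motion\<close>

definition exponential_law :: "real \<Rightarrow> real measure" where
  "exponential_law \<beta> =
     restrict_space (density lborel (\<lambda>s. ennreal (exponential_density \<beta> s))) {0..}"

definition elastic_measure ::
  "(real \<Rightarrow> 'a measure) \<Rightarrow> real \<Rightarrow> real \<Rightarrow> ('a \<times> real) measure" where
  "elastic_measure P \<beta> x = P x \<Otimes>\<^sub>M exponential_law \<beta>"

text \<open>Extended-real valued, so that the infimum of the empty set is \<open>\<infinity>\<close>.\<close>

definition elastic_lifetime :: "(real \<Rightarrow> 'a \<Rightarrow> real) \<Rightarrow> 'a \<times> real \<Rightarrow> ereal" where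
  "elastic_lifetime L = (\<lambda>(\<omega>, s). Inf (ereal ` {t. 0 \<le> t \<and> L t \<omega> > s}))"

text \<open>The cemetery point is \<^const>\<open>None\<close>.\<close>

definition elastic_bm ::
  "(real \<Rightarrow> 'a \<Rightarrow> real) \<Rightarrow> (real \<Rightarrow> 'a \<Rightarrow> real) \<Rightarrow> real \<Rightarrow> 'a \<times> real \<Rightarrow> real option" where
  "elastic_bm B L t \<omega> =
     (if ereal t < elastic_lifetime L \<omega> then Some \<bar>B t (fst \<omega>)\<bar> else None)"

definition extend_cemetery :: "(real \<Rightarrow> real) \<Rightarrow> real option \<Rightarrow> real" where
  "extend_cemetery f y = (case y of None \<Rightarrow> 0 | Some r \<Rightarrow> f r)"

definition elastic_semigroup ::
  "(real \<Rightarrow> 'a measure) \<Rightarrow> (real \<Rightarrow> 'a \<Rightarrow> real) \<Rightarrow> (real \<Rightarrow> 'a \<Rightarrow> real) \<Rightarrow> real \<Rightarrow>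
   real \<Rightarrow> (real \<Rightarrow> real) \<Rightarrow> real \<Rightarrow> real" where
  "elastic_semigroup P B L \<beta> t f x =
     (\<integral>\<omega>. extend_cemetery f (elastic_bm B L t \<omega>) \<partial>(elastic_measure P \<beta> x))"

section \<open>Function spaces and generators on the half-line\<close>

text \<open>
  A function on \<open>[0, \<infinity>)\<close> is represented by any function \<open>real \<Rightarrow> real\<close> that agrees with it there.
  Membership in the sets below does not depend on the values at negative arguments.
\<close>

definition C0_halfline :: "(real \<Rightarrow> real) set" where
  "C0_halfline = {f. continuous_on {0..} f \<and> (f \<longlongrightarrow> 0) at_top}"

text \<open>
  The continuous extension of \<open>f''\<close> is required to belong to \<open>C\<^sub>0\<close>, as the subscript 0 indicates. Mere
  continuity of the extension would not do: a smooth function that equals \<open>sin (x\<^sup>2) / x\<close> for large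
  \<open>x\<close> and vanishes near 0 is in \<open>C\<^sub>0\<close>, satisfies every linear boundary condition at 0, and has
  unbounded second derivative, so it is in the domain of no operator \<open>f \<mapsto> f'' / 2\<close> into \<open>C\<^sub>0\<close>.
\<close>

definition C02_halfline :: "(real \<Rightarrow> real) set" where
  "C02_halfline = {f \<in> C0_halfline.
     (\<forall>x>0. f differentiable at x \<and> deriv f differentiable at x) \<and>
     continuous_on {0<..} (deriv (deriv f)) \<and>
     (\<exists>h\<in>C0_halfline. \<forall>x>0. h x = deriv (deriv f) x)}"

text \<open>
  The generator as a graph; the limit as \<open>t \<down> 0\<close> is taken in the supremum norm on \<open>[0, \<infinity>)\<close>.
\<close>

definition C0_generator :: "(real \<Rightarrow> (real \<Rightarrow> real) \<Rightarrow> real \<Rightarrow> real) \<Rightarrow>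
   ((real \<Rightarrow> real) \<times> (real \<Rightarrow> real)) set" where
  "C0_generator U = {(f, g). f \<in> C0_halfline \<and> g \<in> C0_halfline \<and>
     uniform_limit {0..} (\<lambda>t x. (U t f x - f x) / t) g (at_right 0)}"

end

theory Submission
  imports Defs
begin

text \<open>
  Everything reduces to the Ito integral \<open>I\<close> in Tanaka's formula \<open>|B\<^sub>t| = x + I + L\<^sub>t\<close>, through
  \<open>E I = 0\<close>, the isometry \<open>E I\<^sup>2 = t\<close> and \<open>E I\<^sup>4 \<le> 3 t\<^sup>2\<close>; neither Ito's formula nor the Markov property
  is used. Expanding \<open>E I\<^sup>2 = t\<close> gives the mixed moment of \<open>|B\<^sub>t| - x\<close> and \<open>L\<^sub>t\<close> in terms of the first
  two moments of \<open>L\<^sub>t\<close>. Integrating out the exponential variable, the semigroup is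
  \<open>E\<^sub>x (exp (- \<beta> L\<^sub>t) f |B\<^sub>t|)\<close>. Expand this to second order around \<open>(x, 0)\<close>: apart from
  \<open>f x + t f'' x / 2\<close> only multiples of \<open>c = f' - \<beta> f\<close> remain, and if \<open>c 0 = 0\<close> they are \<open>o t\<close>
  uniformly in \<open>x\<close>, because \<open>x E L\<^sub>t\<close> is of order \<open>t\<close> near 0 and of order \<open>t\<^sup>2\<close> away from 0.

  Conversely, the generator satisfies the positive maximum principle, so \<open>1/2 - A\<close> is injective on
  its domain, whereas \<open>f - f'' = q\<close> with \<open>f' 0 = \<beta> f 0\<close> is solved explicitly for every \<open>q\<close> in \<open>C\<^sub>0\<close>. Hence
  the domain contains no further functions.
\<close>

section \<open>Moments of elementary integrals\<close>

text \<open>The obstacle is uniformity in x. At x = 0 the mean of \<open>L t\<close> is of order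
  sqrt t, far above the permitted error o(t), so its coefficient must be small and not merely
  bounded. The second-order terms provide this: through the moments of |B_t| - x the factor of E L_t
  becomes c(x) - x c'(x), which up to sign is the Taylor remainder of c expanded at x and evaluated
  at 0, where c vanishes. Its size x (\<epsilon> + C x^2) is paid for by x E L_t = O(t) and x^3 E
  L_t = O(t^2).

  All errors are kept in the form \<epsilon> r^2 + C r^4 with C independent of x. Since f'' is only
  uniformly continuous, no rate better than \<epsilon> is available near x, and distant points are
  charged to fourth moments, which are O(t^2). This is why a second-order result calls for fourth
  moments of the integral.

  The value 1/2 in the resolvent makes (1/2 - A) f = (f - f'') / 2, with homogeneous solutions exp x
  and exp (- x).\<close>

lemma abs_power_le_power4:
  fixes z :: real
  assumes "k \<le> 4"
  shows "\<bar>z\<bar> ^ k \<le> 1 + z ^ 4"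
proof (cases "\<bar>z\<bar> \<le> 1")
  case True
  then have "\<bar>z\<bar> ^ k \<le> 1"
    by (simp add: power_le_one)
  then show ?thesis
    by (simp add: add_increasing2)
next
  case False
  then have "\<bar>z\<bar> ^ k \<le> \<bar>z\<bar> ^ 4"
    using assms by (intro power_increasing) auto
  then show ?thesis
    by (simp add: power_even_abs)
qed

lemma add_power4_le: "((a::real) + b) ^ 4 \<le> 8 * (a ^ 4 + b ^ 4)"
proof -
  have sq: "(u + v)\<^sup>2 \<le> 2 * (u\<^sup>2 + v\<^sup>2)" for u v :: real
    using sum_squares_bound[of u v] by (simp add: power2_sum)
  have "((a + b)\<^sup>2)\<^sup>2 \<le> (2 * (a\<^sup>2 + b\<^sup>2))\<^sup>2"
    by (intro power_mono sq) auto
  also have "\<dots> \<le> 8 * ((a\<^sup>2)\<^sup>2 + (b\<^sup>2)\<^sup>2)"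
    unfolding power_mult_distrib using sq[of "a\<^sup>2" "b\<^sup>2"] by simp
  finally show ?thesis
    by simp
qed

text \<open>Young's inequality for the cross term. The factor of \<open>a\<^sup>2\<close> can be
  brought as close to 1 as desired, so second moments pass to L2 limits exactly and not only up to a
  constant; \<open>e = 1\<close> gives the crude factor 2.\<close>

lemma add_square_le_weighted:
  fixes a b e :: real
  assumes "0 < e"
  shows "(a + b)\<^sup>2 \<le> (1 + e) * a\<^sup>2 + (1 + 1 / e) * b\<^sup>2"
proof -
  have "0 \<le> (e * a - b)\<^sup>2 / e"
    using assms by simp
  also have "(e * a - b)\<^sup>2 / e = e * a\<^sup>2 - 2 * a * b + b\<^sup>2 / e"
    using assms by (simp add: power2_eq_square field_simps)
  finally show ?thesis
    by (simp add: power2_eq_square algebra_simps)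
qed

lemma square_le_weighted_diff:
  fixes a b e :: real
  assumes "0 < e"
  shows "b\<^sup>2 \<le> (1 + e) * a\<^sup>2 + (1 + 1 / e) * (a - b)\<^sup>2"
  using add_square_le_weighted[OF assms, of a "b - a"] by (simp add: power2_commute)

lemma integrable_power_of_power4:
  fixes X :: "'a \<Rightarrow> real"
  assumes "prob_space Q" and [measurable]: "X \<in> borel_measurable Q"
    and "integrable Q (\<lambda>\<omega>. X \<omega> ^ 4)" and "k \<le> 4"
  shows "integrable Q (\<lambda>\<omega>. X \<omega> ^ k)"
proof -
  interpret prob_space Q by fact
  have "integrable Q (\<lambda>\<omega>. 1 + X \<omega> ^ 4)"
    using assms(3) by simp
  then show ?thesis
    by (rule Bochner_Integration.integrable_bound)
       (use abs_power_le_power4[OF assms(4)] in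
        \<open>auto simp: power_abs intro!: AE_I2 intro: order_trans[OF _ abs_ge_self]\<close>)
qed

lemma integrable_mult_bounded:
  fixes X Y :: "'a \<Rightarrow> real"
  assumes X: "integrable Q X" and [measurable]: "Y \<in> borel_measurable Q"
    and Y: "\<And>\<omega>. \<omega> \<in> space Q \<Longrightarrow> \<bar>Y \<omega>\<bar> \<le> K"
  shows "integrable Q (\<lambda>\<omega>. X \<omega> * Y \<omega>)"
proof -
  have "integrable Q (\<lambda>\<omega>. K * X \<omega>)"
    using X by simp
  then show ?thesis
  proof (rule Bochner_Integration.integrable_bound)
    show "AE \<omega> in Q. norm (X \<omega> * Y \<omega>) \<le> norm (K * X \<omega>)"
    proof (rule AE_I2)
      fix \<omega> assume "\<omega> \<in> space Q"
      then have "\<bar>Y \<omega>\<bar> \<le> \<bar>K\<bar>" using Y by fastforce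
      then show "norm (X \<omega> * Y \<omega>) \<le> norm (K * X \<omega>)"
        using mult_left_mono[of "\<bar>Y \<omega>\<bar>" "\<bar>K\<bar>" "\<bar>X \<omega>\<bar>"]
        by (simp add: abs_mult mult.commute[of "\<bar>K\<bar>"])
    qed
  qed (use X in measurable)
qed

lemma (in prob_space) indep_set_subset:
  assumes "indep_set A C" and "A' \<subseteq> A" and "C' \<subseteq> C"
  shows "indep_set A' C'"
  using assms unfolding indep_sets2_eq by blast

section \<open>Gaussian increments and moments of martingale sums\<close>

context brownian_family
begin

lemma space_P: "space (P x) = space M"
  using sets_P by (rule sets_eq_imp_space_eq)

lemma space_F: "0 \<le> t \<Longrightarrow> space (F t) = space M"
  using subalgebra_F by (simp add: subalgebra_def)

lemma sets_F: "0 \<le> t \<Longrightarrow> sets (F t) \<subseteq> sets M"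
  using subalgebra_F by (simp add: subalgebra_def)

lemma measurable_F_P:
  "0 \<le> t \<Longrightarrow> X \<in> measurable (F t) N \<Longrightarrow> X \<in> measurable (P x) N"
  using sets_F[of t] space_F[of t] by (auto simp: measurable_def space_P sets_P)

lemma measurable_F_mono:
  "0 \<le> s \<Longrightarrow> s \<le> t \<Longrightarrow> X \<in> measurable (F s) N \<Longrightarrow> X \<in> measurable (F t) N"
  using mono_F[of s t] space_F[of s] space_F[of t] by (auto simp: measurable_def)

lemma measurable_B [measurable]: "0 \<le> t \<Longrightarrow> B t \<in> borel_measurable (P x)"
  using adapted_B measurable_F_P by blast

text \<open>The locale states independence for families of sets, whereas product formulas for
  expectations need it for random variables. \<open>indep_var_eq\<close> speaks of generated
  sigma-algebras, hence the detour through intersection-stable families of preimages.\<close>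

lemma indep_past_increment:
  fixes X :: "'a \<Rightarrow> real"
  assumes st: "0 \<le> s" "s < t" and X: "X \<in> borel_measurable (F s)"
  shows "prob_space.indep_var (P x) borel X borel (\<lambda>\<omega>. B t \<omega> - B s \<omega>)"
proof -
  interpret prob_space "P x" by (rule prob)
  have N: "(\<lambda>\<omega>. B t \<omega> - B s \<omega>) \<in> borel_measurable (P x)"
    using st by (intro borel_measurable_diff measurable_B) auto
  have X': "X \<in> borel_measurable (P x)"
    using measurable_F_P[OF st(1) X] .
  have "indep_set (sets (F s)) {(\<lambda>\<omega>. B t \<omega> - B s \<omega>) -` A \<inter> space M |A. A \<in> sets borel}"
    by (rule indep_increment_B[OF st])
  then have indep: "indep_set {X -` A \<inter> space (P x) |A. A \<in> sets borel}
     {(\<lambda>\<omega>. B t \<omega> - B s \<omega>) -` A \<inter> space (P x) |A. A \<in> sets borel}"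
    by (rule indep_set_subset)
       (use X st in \<open>auto simp: space_P space_F[OF st(1), symmetric] dest: measurable_sets\<close>)
  have stable: "Int_stable {Y -` A \<inter> space (P x) |A. A \<in> sets borel}" for Y :: "'a \<Rightarrow> real"
  proof (rule Int_stableI, clarify)
    fix A A' :: "real set" assume "A \<in> sets borel" "A' \<in> sets borel"
    then show "\<exists>C. Y -` A \<inter> space (P x) \<inter> (Y -` A' \<inter> space (P x)) = Y -` C \<inter> space (P x)
        \<and> C \<in> sets borel"
      by (intro exI[of _ "A \<inter> A'"]) auto
  qed
  show ?thesis
    unfolding indep_var_eq
    by (intro conjI X' N indep_set_sigma_sets[OF indep stable stable])
qed

lemma increment_moments:
  assumes st: "0 \<le> s" "s \<le> t"
  shows "integrable (P x) (\<lambda>\<omega>. (B t \<omega> - B s \<omega>) ^ k)"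
    and "integral\<^sup>L (P x) (\<lambda>\<omega>. B t \<omega> - B s \<omega>) = 0"
    and "integral\<^sup>L (P x) (\<lambda>\<omega>. (B t \<omega> - B s \<omega>)\<^sup>2) = t - s"
    and "integral\<^sup>L (P x) (\<lambda>\<omega>. (B t \<omega> - B s \<omega>) ^ 3) = 0"
    and "integral\<^sup>L (P x) (\<lambda>\<omega>. (B t \<omega> - B s \<omega>) ^ 4) = 3 * (t - s)\<^sup>2"
proof -
  interpret prob_space "P x" by (rule prob)
  let ?N = "\<lambda>\<omega>. B t \<omega> - B s \<omega>"
  let ?g = "normal_density 0 (sqrt (t - s))"
  have "integrable (P x) (\<lambda>\<omega>. ?N \<omega> ^ k) \<and> integral\<^sup>L (P x) ?N = 0
    \<and> integral\<^sup>L (P x) (\<lambda>\<omega>. ?N \<omega> ^ 2) = t - s \<and> integral\<^sup>L (P x) (\<lambda>\<omega>. ?N \<omega> ^ 3) = 0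
    \<and> integral\<^sup>L (P x) (\<lambda>\<omega>. ?N \<omega> ^ 4) = 3 * (t - s)\<^sup>2"
  \<comment> \<open>A density is given only for s < t; for s = t the increment is identically
    0.\<close>
  proof (cases "s = t")
    case False
    then have "s < t" using st by simp
    note D = increment_B[OF st(1) this, of x]
    have even: "has_bochner_integral lborel (\<lambda>y. ?g y * y ^ (2 * j))
        (fact (2 * j) / ((2 / (t - s)) ^ j * fact j))" for j
    proof -
      have "(sqrt (t - s))\<^sup>2 = t - s" using \<open>s < t\<close> by simp
      then show ?thesis using normal_moment_even[of "sqrt (t - s)" 0 j] \<open>s < t\<close> by (simp only: diff_zero) simp
    qed
    have odd: "has_bochner_integral lborel (\<lambda>y. ?g y * y ^ (2 * j + 1)) 0" for j
      using normal_moment_odd[of "sqrt (t - s)" 0 j] \<open>s < t\<close> by simp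
    have "integrable lborel (\<lambda>y. ?g y * y ^ k)"
    proof (cases "even k")
      case True
      then obtain j where "k = 2 * j" by (elim evenE)
      with even[of j] show ?thesis by (simp add: has_bochner_integral_iff)
    next
      case False
      then obtain j where "k = 2 * j + 1" by (elim oddE)
      with odd[of j] show ?thesis by (simp add: has_bochner_integral_iff)
    qed
    then have "integrable (P x) (\<lambda>\<omega>. ?N \<omega> ^ k)"
      by (subst (asm) distributed_integrable[OF D]) auto
    moreover have I: "integral\<^sup>L (P x) (\<lambda>\<omega>. ?N \<omega> ^ j) = integral\<^sup>L lborel (\<lambda>y. ?g y * y ^ j)" for j
      by (subst distributed_integral[OF D]) auto
    moreover have "integral\<^sup>L (P x) (\<lambda>\<omega>. ?N \<omega>) = 0"
      using I[of 1] odd[of 0] by (simp add: has_bochner_integral_iff)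
    moreover have "integral\<^sup>L (P x) (\<lambda>\<omega>. ?N \<omega> ^ 2) = t - s"
      using I[of 2] even[of 1] \<open>s < t\<close> by (simp add: has_bochner_integral_iff)
    moreover have "integral\<^sup>L (P x) (\<lambda>\<omega>. ?N \<omega> ^ 3) = 0"
      using I[of 3] odd[of 1] by (simp add: has_bochner_integral_iff)
    moreover have "integral\<^sup>L (P x) (\<lambda>\<omega>. ?N \<omega> ^ 4) = 3 * (t - s)\<^sup>2"
      using I[of 4] even[of 2] \<open>s < t\<close>
      by (simp add: has_bochner_integral_iff fact_numeral power2_eq_square field_simps)
    ultimately show ?thesis by auto
  qed (auto simp: power_0_left)
  then show "integrable (P x) (\<lambda>\<omega>. ?N \<omega> ^ k)" "integral\<^sup>L (P x) ?N = 0"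
    "integral\<^sup>L (P x) (\<lambda>\<omega>. ?N \<omega> ^ 2) = t - s" "integral\<^sup>L (P x) (\<lambda>\<omega>. ?N \<omega> ^ 3) = 0"
    "integral\<^sup>L (P x) (\<lambda>\<omega>. ?N \<omega> ^ 4) = 3 * (t - s)\<^sup>2"
    by auto
qed

lemma integral_past_times_increment:
  fixes X :: "'a \<Rightarrow> real"
  assumes st: "0 \<le> s" "s \<le> t" and X: "X \<in> borel_measurable (F s)"
    and iX: "integrable (P x) X" and k: "k \<noteq> 0"
  shows "integrable (P x) (\<lambda>\<omega>. X \<omega> * (B t \<omega> - B s \<omega>) ^ k)"
    and "integral\<^sup>L (P x) (\<lambda>\<omega>. X \<omega> * (B t \<omega> - B s \<omega>) ^ k)
       = integral\<^sup>L (P x) X * integral\<^sup>L (P x) (\<lambda>\<omega>. (B t \<omega> - B s \<omega>) ^ k)"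
proof -
  interpret prob_space "P x" by (rule prob)
  let ?N = "\<lambda>\<omega>. B t \<omega> - B s \<omega>"
  have "integrable (P x) (\<lambda>\<omega>. X \<omega> * ?N \<omega> ^ k) \<and>
    integral\<^sup>L (P x) (\<lambda>\<omega>. X \<omega> * ?N \<omega> ^ k) = integral\<^sup>L (P x) X * integral\<^sup>L (P x) (\<lambda>\<omega>. ?N \<omega> ^ k)"
  proof (cases "s = t")
    case False
    then have "s < t" using st by simp
    have "indep_var borel ((\<lambda>y. y) \<circ> X) borel ((\<lambda>y. y ^ k) \<circ> ?N)"
      by (rule indep_var_compose[OF indep_past_increment[OF st(1) \<open>s < t\<close> X]]) auto
    then have ind: "indep_var borel X borel (\<lambda>\<omega>. ?N \<omega> ^ k)"
      by (simp add: comp_def)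
    show ?thesis
      using indep_var_integrable[OF ind iX increment_moments(1)[OF st]]
        indep_var_lebesgue_integral[OF ind iX increment_moments(1)[OF st]] by simp
  qed (use k in \<open>simp add: power_0_left\<close>)
  then show "integrable (P x) (\<lambda>\<omega>. X \<omega> * ?N \<omega> ^ k)"
    "integral\<^sup>L (P x) (\<lambda>\<omega>. X \<omega> * ?N \<omega> ^ k) = integral\<^sup>L (P x) X * integral\<^sup>L (P x) (\<lambda>\<omega>. ?N \<omega> ^ k)"
    by auto
qed

text \<open>In the binomial expansion of the powers of \<open>X'\<close> each term is a past
  variable times a power of the increment. The two factors are independent, and odd powers of the
  increment have mean 0. The 6 is a binomial coefficient, the 3 belongs to the Gaussian fourth
  moment.\<close>

lemma martingale_step:
  fixes X \<xi> :: "'a \<Rightarrow> real"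
  assumes st: "0 \<le> s" "s \<le> t" and X: "X \<in> borel_measurable (F s)"
    and \<xi>: "\<xi> \<in> borel_measurable (F s)" and b: "\<And>\<omega>. \<omega> \<in> space M \<Longrightarrow> \<bar>\<xi> \<omega>\<bar> \<le> K"
    and iX: "integrable (P x) (\<lambda>\<omega>. X \<omega> ^ 4)"
  defines "X' \<equiv> \<lambda>\<omega>. X \<omega> + \<xi> \<omega> * (B t \<omega> - B s \<omega>)"
  shows "X' \<in> borel_measurable (F t)"
    and "integrable (P x) (\<lambda>\<omega>. X' \<omega> ^ 4)"
    and "integral\<^sup>L (P x) X' = integral\<^sup>L (P x) X"
    and "integral\<^sup>L (P x) (\<lambda>\<omega>. (X' \<omega>)\<^sup>2)
       = integral\<^sup>L (P x) (\<lambda>\<omega>. (X \<omega>)\<^sup>2) + integral\<^sup>L (P x) (\<lambda>\<omega>. (\<xi> \<omega>)\<^sup>2) * (t - s)"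
    and "K \<le> 1 \<Longrightarrow> integral\<^sup>L (P x) (\<lambda>\<omega>. X' \<omega> ^ 4)
       \<le> integral\<^sup>L (P x) (\<lambda>\<omega>. X \<omega> ^ 4) + 6 * integral\<^sup>L (P x) (\<lambda>\<omega>. (X \<omega>)\<^sup>2) * (t - s)
         + 3 * (t - s)\<^sup>2"
proof -
  interpret prob_space "P x" by (rule prob)
  let ?N = "\<lambda>\<omega>. B t \<omega> - B s \<omega>"
  have t: "0 \<le> t" using st by simp
  have XP[measurable]: "X \<in> borel_measurable (P x)" and \<xi>P[measurable]: "\<xi> \<in> borel_measurable (P x)"
    using measurable_F_P[OF st(1)] X \<xi> by auto
  have "X \<in> borel_measurable (F t)" "\<xi> \<in> borel_measurable (F t)"
    "B t \<in> borel_measurable (F t)" "B s \<in> borel_measurable (F t)"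
    using measurable_F_mono[OF st] X \<xi> adapted_B st t by auto
  then show "X' \<in> borel_measurable (F t)"
    unfolding X'_def by simp
  have iXj: "integrable (P x) (\<lambda>\<omega>. X \<omega> ^ j)" if "j \<le> 4" for j
    using integrable_power_of_power4[OF prob XP iX that] .
  have bj: "\<bar>\<xi> \<omega> ^ i\<bar> \<le> K ^ i" if "\<omega> \<in> space (P x)" for \<omega> i
    using b[of \<omega>] that by (simp add: space_P power_abs power_mono)
  have iXxi: "integrable (P x) (\<lambda>\<omega>. X \<omega> ^ j * \<xi> \<omega> ^ i)" if "j \<le> 4" for j i
    by (rule integrable_mult_bounded[OF iXj[OF that] _ bj]) auto
  have mXxi: "(\<lambda>\<omega>. X \<omega> ^ j * \<xi> \<omega> ^ i) \<in> borel_measurable (F s)" for i j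
    using X \<xi> by simp
  note I = integral_past_times_increment[OF st mXxi iXxi]
  \<comment> \<open>The exponents 0 and 1 are written out here and below so that every mixed term
    matches the pattern of \<open>I\<close>.\<close>
  have e1: "X' \<omega> = X \<omega> + X \<omega> ^ 0 * \<xi> \<omega> ^ 1 * ?N \<omega> ^ 1" for \<omega>
    by (simp add: X'_def)
  have "integral\<^sup>L (P x) X' = integral\<^sup>L (P x) X + integral\<^sup>L (P x) (\<lambda>\<omega>. X \<omega> ^ 0 * \<xi> \<omega> ^ 1 * ?N \<omega> ^ 1)"
    unfolding e1 using iXj[of 1] I(1)[of 0 1 1] by (subst Bochner_Integration.integral_add) auto
  also have "integral\<^sup>L (P x) (\<lambda>\<omega>. X \<omega> ^ 0 * \<xi> \<omega> ^ 1 * ?N \<omega> ^ 1) = 0"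
    by (subst I(2)) (use increment_moments(2)[OF st] in auto)
  finally show "integral\<^sup>L (P x) X' = integral\<^sup>L (P x) X" by simp
  have e2: "(X' \<omega>)\<^sup>2 = (X \<omega>)\<^sup>2 + (2 * (X \<omega> ^ 1 * \<xi> \<omega> ^ 1 * ?N \<omega> ^ 1) + X \<omega> ^ 0 * \<xi> \<omega> ^ 2 * ?N \<omega> ^ 2)" for \<omega>
    by (simp add: X'_def power2_eq_square algebra_simps)
  have "integral\<^sup>L (P x) (\<lambda>\<omega>. (X' \<omega>)\<^sup>2) = integral\<^sup>L (P x) (\<lambda>\<omega>. (X \<omega>)\<^sup>2) +
     (2 * integral\<^sup>L (P x) (\<lambda>\<omega>. X \<omega> ^ 1 * \<xi> \<omega> ^ 1 * ?N \<omega> ^ 1)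
        + integral\<^sup>L (P x) (\<lambda>\<omega>. X \<omega> ^ 0 * \<xi> \<omega> ^ 2 * ?N \<omega> ^ 2))"
    unfolding e2 using iXj[of 2] I(1)[of 1 1 1] I(1)[of 0 2 2]
    by (subst Bochner_Integration.integral_add, simp, simp, 
        subst Bochner_Integration.integral_add) auto
  also have "integral\<^sup>L (P x) (\<lambda>\<omega>. X \<omega> ^ 1 * \<xi> \<omega> ^ 1 * ?N \<omega> ^ 1) = 0"
    by (subst I(2)) (use increment_moments(2)[OF st] in auto)
  also have "integral\<^sup>L (P x) (\<lambda>\<omega>. X \<omega> ^ 0 * \<xi> \<omega> ^ 2 * ?N \<omega> ^ 2) = integral\<^sup>L (P x) (\<lambda>\<omega>. (\<xi> \<omega>)\<^sup>2) * (t - s)"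
    by (subst I(2)) (use increment_moments(3)[OF st] in auto)
  finally show "integral\<^sup>L (P x) (\<lambda>\<omega>. (X' \<omega>)\<^sup>2)
       = integral\<^sup>L (P x) (\<lambda>\<omega>. (X \<omega>)\<^sup>2) + integral\<^sup>L (P x) (\<lambda>\<omega>. (\<xi> \<omega>)\<^sup>2) * (t - s)"
    by simp
  have e4: "X' \<omega> ^ 4 = X \<omega> ^ 4 + (4 * (X \<omega> ^ 3 * \<xi> \<omega> ^ 1 * ?N \<omega> ^ 1) +
      (6 * (X \<omega> ^ 2 * \<xi> \<omega> ^ 2 * ?N \<omega> ^ 2) + (4 * (X \<omega> ^ 1 * \<xi> \<omega> ^ 3 * ?N \<omega> ^ 3) +
       X \<omega> ^ 0 * \<xi> \<omega> ^ 4 * ?N \<omega> ^ 4)))" for \<omega>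
    unfolding X'_def by algebra
  note J = I(1)[of 3 1 1] I(1)[of 2 2 2] I(1)[of 1 3 3] I(1)[of 0 4 4]
  show i4: "integrable (P x) (\<lambda>\<omega>. X' \<omega> ^ 4)"
    unfolding e4 using iX J
    by (intro Bochner_Integration.integrable_add integrable_mult_right) auto
  assume "K \<le> 1"
  have le1: "\<xi> \<omega> ^ (2 * i) \<le> 1" if "\<omega> \<in> space (P x)" for \<omega> i
  proof -
    have "\<bar>\<xi> \<omega>\<bar> ^ (2 * i) \<le> 1"
      using b[of \<omega>] \<open>K \<le> 1\<close> that by (intro power_le_one) (auto simp: space_P)
    then show ?thesis by (simp add: power_even_abs)
  qed
  have "integral\<^sup>L (P x) (\<lambda>\<omega>. X' \<omega> ^ 4) = integral\<^sup>L (P x) (\<lambda>\<omega>. X \<omega> ^ 4) +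
     (4 * integral\<^sup>L (P x) (\<lambda>\<omega>. X \<omega> ^ 3 * \<xi> \<omega> ^ 1 * ?N \<omega> ^ 1) +
     (6 * integral\<^sup>L (P x) (\<lambda>\<omega>. X \<omega> ^ 2 * \<xi> \<omega> ^ 2 * ?N \<omega> ^ 2) +
     (4 * integral\<^sup>L (P x) (\<lambda>\<omega>. X \<omega> ^ 1 * \<xi> \<omega> ^ 3 * ?N \<omega> ^ 3) +
      integral\<^sup>L (P x) (\<lambda>\<omega>. X \<omega> ^ 0 * \<xi> \<omega> ^ 4 * ?N \<omega> ^ 4))))"
    unfolding e4 using iX J
    by (simp only: Bochner_Integration.integral_add Bochner_Integration.integrable_add
        integrable_mult_right integral_mult_right_zero)
  also have "integral\<^sup>L (P x) (\<lambda>\<omega>. X \<omega> ^ 3 * \<xi> \<omega> ^ 1 * ?N \<omega> ^ 1) = 0"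
    by (subst I(2)) (use increment_moments(2)[OF st] in auto)
  also have "integral\<^sup>L (P x) (\<lambda>\<omega>. X \<omega> ^ 1 * \<xi> \<omega> ^ 3 * ?N \<omega> ^ 3) = 0"
    by (subst I(2)) (use increment_moments(4)[OF st] in auto)
  also have "integral\<^sup>L (P x) (\<lambda>\<omega>. X \<omega> ^ 2 * \<xi> \<omega> ^ 2 * ?N \<omega> ^ 2)
      = integral\<^sup>L (P x) (\<lambda>\<omega>. X \<omega> ^ 2 * \<xi> \<omega> ^ 2) * (t - s)"
    by (subst I(2)) (use increment_moments(3)[OF st] in auto)
  also have "integral\<^sup>L (P x) (\<lambda>\<omega>. X \<omega> ^ 0 * \<xi> \<omega> ^ 4 * ?N \<omega> ^ 4)
      = integral\<^sup>L (P x) (\<lambda>\<omega>. X \<omega> ^ 0 * \<xi> \<omega> ^ 4) * (3 * (t - s)\<^sup>2)"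
    by (subst I(2)) (use increment_moments(5)[OF st] in auto)
  also have "integral\<^sup>L (P x) (\<lambda>\<omega>. X \<omega> ^ 2 * \<xi> \<omega> ^ 2) * (t - s) \<le> integral\<^sup>L (P x) (\<lambda>\<omega>. X \<omega> ^ 2) * (t - s)"
    using st le1[of _ 1] iXxi[of 2 2] iXj[of 2]
    by (intro mult_right_mono integral_mono) (auto intro!: mult_left_le)
  also have "integral\<^sup>L (P x) (\<lambda>\<omega>. X \<omega> ^ 0 * \<xi> \<omega> ^ 4) * (3 * (t - s)\<^sup>2)
      \<le> integral\<^sup>L (P x) (\<lambda>\<omega>. 1) * (3 * (t - s)\<^sup>2)"
    using le1[of _ 2] iXxi[of 0 4] by (intro mult_right_mono integral_mono) auto
  finally show "integral\<^sup>L (P x) (\<lambda>\<omega>. X' \<omega> ^ 4)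
       \<le> integral\<^sup>L (P x) (\<lambda>\<omega>. X \<omega> ^ 4) + 6 * integral\<^sup>L (P x) (\<lambda>\<omega>. (X \<omega>)\<^sup>2) * (t - s)
         + 3 * (t - s)\<^sup>2"
    by (simp add: prob_space)
qed

end

section \<open>Elementary processes and the Ito isometry\<close>

lemma elementary_value_beyond:
  assumes "\<And>i. i < n \<Longrightarrow> \<tau> i \<le> \<tau> (Suc i)" and "\<tau> n < s"
  shows "elementary_value n \<tau> \<xi> s \<omega> = 0"
  using assms
proof (induction n)
  case (Suc n)
  then have "\<tau> n < s"
    by (meson lessI order_le_less_trans)
  with Suc show ?case
    by (simp add: elementary_value_def)
qed (simp add: elementary_value_def)

text \<open>At every time at most one summand of an elementary process is nonzero.\<close>

lemma elementary_value_compose: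
  assumes "\<And>i. i < n \<Longrightarrow> \<tau> i \<le> \<tau> (Suc i)" and "\<phi> 0 = 0"
  shows "elementary_value n \<tau> (\<lambda>i \<omega>. \<phi> (\<xi> i \<omega>)) s \<omega> = \<phi> (elementary_value n \<tau> \<xi> s \<omega>)"
  using assms(1)
proof (induction n)
  case (Suc n)
  have split: "elementary_value (Suc n) \<tau> \<eta> s \<omega>
      = elementary_value n \<tau> \<eta> s \<omega> + \<eta> n \<omega> * indicator {\<tau> n<..\<tau> (Suc n)} s" for \<eta>
    by (simp add: elementary_value_def)
  show ?case
  proof (cases "s \<in> {\<tau> n<..\<tau> (Suc n)}")
    case True
    then have "elementary_value n \<tau> \<eta> s \<omega> = 0" for \<eta>
      using Suc.prems by (intro elementary_value_beyond) auto
    with True show ?thesis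
      by (simp add: split assms(2))
  qed (use Suc in \<open>simp add: split\<close>)
qed (simp add: elementary_value_def assms(2))

lemma elementary_process_times:
  assumes "elementary_process Q F n \<tau> \<xi>"
  shows "i \<le> n \<Longrightarrow> 0 \<le> \<tau> i" and "i < n \<Longrightarrow> \<tau> i \<le> \<tau> (Suc i)"
proof -
  show mono: "i < n \<Longrightarrow> \<tau> i \<le> \<tau> (Suc i)" for i
    using assms by (simp add: elementary_process_def)
  show "i \<le> n \<Longrightarrow> 0 \<le> \<tau> i"
  proof (induction i)
    case (Suc i)
    then show ?case using mono[of i] by simp
  qed (use assms in \<open>simp add: elementary_process_def\<close>)
qed

text \<open>The half-open intervals are disjoint, so squaring produces no cross terms; intersecting
  an interval with \<open>{0..t}\<close> truncates both of its endpoints by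
  \<open>min t\<close>.\<close>

lemma nn_integral_elementary_value_square:
  assumes ep: "elementary_process Q F n \<tau> \<xi>"
  shows "(\<integral>\<^sup>+s\<in>{0..t}. ennreal ((elementary_value n \<tau> \<xi> s \<omega>)\<^sup>2) \<partial>lborel)
    = ennreal (\<Sum>i<n. (\<xi> i \<omega>)\<^sup>2 * (min t (\<tau> (Suc i)) - min t (\<tau> i)))"
proof -
  have sq: "(elementary_value n \<tau> \<xi> s \<omega>)\<^sup>2
      = (\<Sum>i<n. (\<xi> i \<omega>)\<^sup>2 * indicator {\<tau> i<..\<tau> (Suc i)} s)" for s
    using elementary_value_compose[of n \<tau> "\<lambda>y. y\<^sup>2" \<xi> s \<omega>] elementary_process_times(2)[OF ep]
    by (simp add: elementary_value_def)
  have "(\<integral>\<^sup>+s\<in>{0..t}. ennreal ((elementary_value n \<tau> \<xi> s \<omega>)\<^sup>2) \<partial>lborel)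
      = (\<integral>\<^sup>+s. (\<Sum>i<n. ennreal ((\<xi> i \<omega>)\<^sup>2) * indicator ({\<tau> i<..\<tau> (Suc i)} \<inter> {0..t}) s) \<partial>lborel)"
  proof (rule nn_integral_cong)
    fix s :: real
    have "ennreal ((\<xi> i \<omega>)\<^sup>2 * indicator {\<tau> i<..\<tau> (Suc i)} s) * indicator {0..t} s
        = ennreal ((\<xi> i \<omega>)\<^sup>2) * indicator ({\<tau> i<..\<tau> (Suc i)} \<inter> {0..t}) s" for i
      by (cases "s \<in> {\<tau> i<..\<tau> (Suc i)}"; cases "s \<in> {0..t}") (simp_all add: indicator_def)
    moreover have "ennreal ((elementary_value n \<tau> \<xi> s \<omega>)\<^sup>2)
        = (\<Sum>i<n. ennreal ((\<xi> i \<omega>)\<^sup>2 * indicator {\<tau> i<..\<tau> (Suc i)} s))"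
      unfolding sq by (rule sum_ennreal[symmetric]) simp
    ultimately show "ennreal ((elementary_value n \<tau> \<xi> s \<omega>)\<^sup>2) * indicator {0..t} s
        = (\<Sum>i<n. ennreal ((\<xi> i \<omega>)\<^sup>2) * indicator ({\<tau> i<..\<tau> (Suc i)} \<inter> {0..t}) s)"
      by (simp only: sum_distrib_right)
  qed
  also have "\<dots> = (\<Sum>i<n. ennreal ((\<xi> i \<omega>)\<^sup>2) * emeasure lborel ({\<tau> i<..\<tau> (Suc i)} \<inter> {0..t}))"
    by (subst nn_integral_sum) (auto simp: nn_integral_cmult_indicator)
  also have "\<dots> = (\<Sum>i<n. ennreal ((\<xi> i \<omega>)\<^sup>2 * (min t (\<tau> (Suc i)) - min t (\<tau> i))))"
  proof (rule sum.cong)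
    fix i assume "i \<in> {..<n}"
    then have "0 \<le> \<tau> i" "\<tau> i \<le> \<tau> (Suc i)"
      using elementary_process_times[OF ep] by auto
    then have "{\<tau> i<..\<tau> (Suc i)} \<inter> {0..t} = {min t (\<tau> i)<..min t (\<tau> (Suc i))}"
      and "min t (\<tau> i) \<le> min t (\<tau> (Suc i))"
      by auto
    then show "ennreal ((\<xi> i \<omega>)\<^sup>2) * emeasure lborel ({\<tau> i<..\<tau> (Suc i)} \<inter> {0..t})
        = ennreal ((\<xi> i \<omega>)\<^sup>2 * (min t (\<tau> (Suc i)) - min t (\<tau> i)))"
      by (simp add: ennreal_mult)
  qed simp
  also have "\<dots> = ennreal (\<Sum>i<n. (\<xi> i \<omega>)\<^sup>2 * (min t (\<tau> (Suc i)) - min t (\<tau> i)))"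
  proof (rule sum_ennreal)
    fix i assume "i \<in> {..<n}"
    then have "\<tau> i \<le> \<tau> (Suc i)"
      using elementary_process_times[OF ep] by auto
    then show "0 \<le> (\<xi> i \<omega>)\<^sup>2 * (min t (\<tau> (Suc i)) - min t (\<tau> i))"
      by (intro mult_nonneg_nonneg) auto
  qed
  finally show ?thesis .
qed

context brownian_family
begin

text \<open>One induction on n for all claims, since each step of the martingale consumes several of
  them. Measurability and bounds are stated at time \<open>min t (\<tau> n)\<close> and not at t,
  because the next step starts there.\<close>

lemma elementary_integral_moments:
  assumes ep: "elementary_process (P x) F n \<tau> \<xi>" and t: "0 \<le> t"
  defines "J \<equiv> elementary_integral B n \<tau> \<xi> t"
  shows "J \<in> borel_measurable (F (min t (\<tau> n)))"
    and "integrable (P x) (\<lambda>\<omega>. J \<omega> ^ 4)"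
    and "integral\<^sup>L (P x) J = 0"
    and "integral\<^sup>L (P x) (\<lambda>\<omega>. (J \<omega>)\<^sup>2)
      = (\<Sum>i<n. integral\<^sup>L (P x) (\<lambda>\<omega>. (\<xi> i \<omega>)\<^sup>2) * (min t (\<tau> (Suc i)) - min t (\<tau> i)))"
    and "(\<And>i \<omega>. i < n \<Longrightarrow> \<omega> \<in> space M \<Longrightarrow> \<bar>\<xi> i \<omega>\<bar> \<le> 1) \<Longrightarrow>
      integral\<^sup>L (P x) (\<lambda>\<omega>. (J \<omega>)\<^sup>2) \<le> min t (\<tau> n)"
    and "(\<And>i \<omega>. i < n \<Longrightarrow> \<omega> \<in> space M \<Longrightarrow> \<bar>\<xi> i \<omega>\<bar> \<le> 1) \<Longrightarrow>
      integral\<^sup>L (P x) (\<lambda>\<omega>. (J \<omega>) ^ 4) \<le> 3 * (min t (\<tau> n))\<^sup>2"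
proof -
  interpret prob_space "P x" by (rule prob)
  have "J \<in> borel_measurable (F (min t (\<tau> n))) \<and>
    integrable (P x) (\<lambda>\<omega>. J \<omega> ^ 4) \<and> integral\<^sup>L (P x) J = 0 \<and>
    integral\<^sup>L (P x) (\<lambda>\<omega>. (J \<omega>)\<^sup>2)
      = (\<Sum>i<n. integral\<^sup>L (P x) (\<lambda>\<omega>. (\<xi> i \<omega>)\<^sup>2) * (min t (\<tau> (Suc i)) - min t (\<tau> i))) \<and>
    ((\<forall>i<n. \<forall>\<omega>\<in>space M. \<bar>\<xi> i \<omega>\<bar> \<le> 1) \<longrightarrow>
      integral\<^sup>L (P x) (\<lambda>\<omega>. (J \<omega>)\<^sup>2) \<le> min t (\<tau> n) \<and>
      integral\<^sup>L (P x) (\<lambda>\<omega>. (J \<omega>) ^ 4) \<le> 3 * (min t (\<tau> n))\<^sup>2)"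
    using ep unfolding J_def
  proof (induction n)
    case 0
    then have "0 \<le> \<tau> 0" by (simp add: elementary_process_def)
    then show ?case
      using t by (simp add: elementary_integral_def)
  next
    case (Suc n)
    let ?J = "elementary_integral B n \<tau> \<xi> t" and ?J' = "elementary_integral B (Suc n) \<tau> \<xi> t"
    let ?s = "min t (\<tau> n)" and ?u = "min t (\<tau> (Suc n))"
    have tau: "0 \<le> \<tau> n" "\<tau> n \<le> \<tau> (Suc n)"
      using elementary_process_times[OF Suc.prems] by auto
    then have su: "0 \<le> ?s" "?s \<le> ?u" using t by auto
    have "elementary_process (P x) F n \<tau> \<xi>"
      using Suc.prems by (simp add: elementary_process_def)
    note IH = Suc.IH[OF this]
    have xi: "\<xi> n \<in> borel_measurable (F (\<tau> n))" and "bounded (\<xi> n ` space M)"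
      using Suc.prems by (auto simp: elementary_process_def space_P)
    then obtain K where K: "\<And>\<omega>. \<omega> \<in> space M \<Longrightarrow> \<bar>\<xi> n \<omega>\<bar> \<le> K"
      by (auto simp: bounded_iff)
    then have K0: "\<And>\<omega>. \<omega> \<in> space M \<Longrightarrow> 0 \<le> K"
      by (meson abs_ge_zero order_trans)
    \<comment> \<open>The coefficient must be measurable at time \<open>min t (\<tau> n)\<close>,
      but \<open>\<xi> n\<close> is so only at \<open>\<tau> n\<close>. If t does not exceed
      \<open>\<tau> n\<close> the increment is 0, and the coefficient may be replaced by 0.\<close>
    define \<eta> where "\<eta> = (if \<tau> n < t then \<xi> n else (\<lambda>_. 0))"
    have eta: "\<eta> \<in> borel_measurable (F ?s)" "\<And>\<omega>. \<omega> \<in> space M \<Longrightarrow> \<bar>\<eta> \<omega>\<bar> \<le> K"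
      using xi K K0 by (auto simp: \<eta>_def min_def)
    have J': "?J' = (\<lambda>\<omega>. ?J \<omega> + \<eta> \<omega> * (B ?u \<omega> - B ?s \<omega>))"
      using tau by (auto simp: elementary_integral_def \<eta>_def fun_eq_iff min_def)
    have eta2: "integral\<^sup>L (P x) (\<lambda>\<omega>. (\<eta> \<omega>)\<^sup>2) * (?u - ?s) = integral\<^sup>L (P x) (\<lambda>\<omega>. (\<xi> n \<omega>)\<^sup>2) * (?u - ?s)"
      using tau by (auto simp: \<eta>_def min_def)
    note step = martingale_step[OF su _ eta(1), of ?J]
    have m: "?J \<in> borel_measurable (F ?s)" and i4: "integrable (P x) (\<lambda>\<omega>. ?J \<omega> ^ 4)"
      using IH by auto
    have bd: "integral\<^sup>L (P x) (\<lambda>\<omega>. (?J' \<omega>)\<^sup>2) \<le> ?u \<and> integral\<^sup>L (P x) (\<lambda>\<omega>. ?J' \<omega> ^ 4) \<le> 3 * ?u\<^sup>2"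
      if "\<forall>i<Suc n. \<forall>\<omega>\<in>space M. \<bar>\<xi> i \<omega>\<bar> \<le> 1"
    proof -
      have eta1: "\<And>\<omega>. \<omega> \<in> space M \<Longrightarrow> \<bar>\<eta> \<omega>\<bar> \<le> 1"
        using that by (auto simp: \<eta>_def)
      have IH': "integral\<^sup>L (P x) (\<lambda>\<omega>. (?J \<omega>)\<^sup>2) \<le> ?s" "integral\<^sup>L (P x) (\<lambda>\<omega>. ?J \<omega> ^ 4) \<le> 3 * ?s\<^sup>2"
        using IH that by auto
      have "integral\<^sup>L (P x) (\<lambda>\<omega>. (\<eta> \<omega>)\<^sup>2) \<le> integral\<^sup>L (P x) (\<lambda>\<omega>. 1)"
      proof (rule integral_mono')
        show "integrable (P x) (\<lambda>\<omega>. 1::real)" by simp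
      qed (use eta1 in \<open>auto simp: space_P abs_square_le_1\<close>)
      then have *: "integral\<^sup>L (P x) (\<lambda>\<omega>. (\<eta> \<omega>)\<^sup>2) * (?u - ?s) \<le> 1 * (?u - ?s)"
        using diff_ge_0_iff_ge[THEN iffD2, OF su(2)] by (intro mult_right_mono) (auto simp: prob_space)
      have "integral\<^sup>L (P x) (\<lambda>\<omega>. (?J' \<omega>)\<^sup>2) \<le> ?s + 1 * (?u - ?s)"
        unfolding J' by (intro ord_eq_le_trans[OF step(4)[OF m eta1 i4]] add_mono IH'(1) *)
      \<comment> \<open>With s = \<open>?s\<close> and u = \<open>?u\<close> the right-hand side is
        exactly 3 u^2, so the bound, which is the fourth moment of a Gaussian variable of variance
        u, reproduces itself.\<close>
      moreover have "integral\<^sup>L (P x) (\<lambda>\<omega>. ?J' \<omega> ^ 4)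
          \<le> 3 * ?s\<^sup>2 + 6 * ?s * (?u - ?s) + 3 * (?u - ?s)\<^sup>2"
        unfolding J' using diff_ge_0_iff_ge[THEN iffD2, OF su(2)]
        by (intro order_trans[OF step(5)[OF m eta1 i4]] add_mono mult_right_mono mult_left_mono IH')
          simp_all
      then have "integral\<^sup>L (P x) (\<lambda>\<omega>. ?J' \<omega> ^ 4) \<le> 3 * ?u\<^sup>2"
        by (simp add: power2_eq_square algebra_simps)
      ultimately show ?thesis by simp
    qed
    have "integral\<^sup>L (P x) (\<lambda>\<omega>. (?J' \<omega>)\<^sup>2)
      = (\<Sum>i<Suc n. integral\<^sup>L (P x) (\<lambda>\<omega>. (\<xi> i \<omega>)\<^sup>2) * (min t (\<tau> (Suc i)) - min t (\<tau> i)))"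
    proof -
      have IH2: "integral\<^sup>L (P x) (\<lambda>\<omega>. (?J \<omega>)\<^sup>2)
          = (\<Sum>i<n. integral\<^sup>L (P x) (\<lambda>\<omega>. (\<xi> i \<omega>)\<^sup>2) * (min t (\<tau> (Suc i)) - min t (\<tau> i)))"
        using IH by blast
      have "integral\<^sup>L (P x) (\<lambda>\<omega>. (?J' \<omega>)\<^sup>2) = integral\<^sup>L (P x) (\<lambda>\<omega>. (?J \<omega>)\<^sup>2)
          + integral\<^sup>L (P x) (\<lambda>\<omega>. (\<eta> \<omega>)\<^sup>2) * (?u - ?s)"
        unfolding J' by (rule step(4)[OF m eta(2) i4])
      then show ?thesis
        unfolding IH2 eta2 sum.lessThan_Suc .
    qed
    moreover have "?J' \<in> borel_measurable (F ?u)"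
      unfolding J' by (rule step(1)[OF m eta(2) i4])
    moreover have "integrable (P x) (\<lambda>\<omega>. ?J' \<omega> ^ 4)"
      unfolding J' by (rule step(2)[OF m eta(2) i4])
    moreover have "integral\<^sup>L (P x) ?J' = 0"
    proof -
      have "integral\<^sup>L (P x) ?J = 0"
        using IH by blast
      moreover have "integral\<^sup>L (P x) ?J' = integral\<^sup>L (P x) ?J"
        unfolding J' by (rule step(3)[OF m eta(2) i4])
      ultimately show ?thesis by simp
    qed
    ultimately show ?case
      using bd by blast
  qed
  then show "J \<in> borel_measurable (F (min t (\<tau> n)))"
    "integrable (P x) (\<lambda>\<omega>. J \<omega> ^ 4)" "integral\<^sup>L (P x) J = 0"
    "integral\<^sup>L (P x) (\<lambda>\<omega>. (J \<omega>)\<^sup>2)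
      = (\<Sum>i<n. integral\<^sup>L (P x) (\<lambda>\<omega>. (\<xi> i \<omega>)\<^sup>2) * (min t (\<tau> (Suc i)) - min t (\<tau> i)))"
    "(\<And>i \<omega>. i < n \<Longrightarrow> \<omega> \<in> space M \<Longrightarrow> \<bar>\<xi> i \<omega>\<bar> \<le> 1) \<Longrightarrow>
      integral\<^sup>L (P x) (\<lambda>\<omega>. (J \<omega>)\<^sup>2) \<le> min t (\<tau> n)"
    "(\<And>i \<omega>. i < n \<Longrightarrow> \<omega> \<in> space M \<Longrightarrow> \<bar>\<xi> i \<omega>\<bar> \<le> 1) \<Longrightarrow>
      integral\<^sup>L (P x) (\<lambda>\<omega>. (J \<omega>) ^ 4) \<le> 3 * (min t (\<tau> n))\<^sup>2"
    by blast+
qed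

lemma measurable_elementary_integral:
  assumes ep: "elementary_process (P x) F n \<tau> \<xi>" and t: "0 \<le> t"
  shows "elementary_integral B n \<tau> \<xi> t \<in> borel_measurable (P x)"
  using elementary_integral_moments(1)[OF assms] elementary_process_times(1)[OF ep, of n] t
  by (intro measurable_F_P[of "min t (\<tau> n)"]) auto

text \<open>The left side is a nonnegative integral because \<open>has_ito_integral\<close> measures
  the distance between integrands in this form.\<close>

lemma elementary_isometry:
  assumes ep: "elementary_process (P x) F n \<tau> \<xi>" and t: "0 \<le> t"
  shows "(\<integral>\<^sup>+\<omega>. (\<integral>\<^sup>+s\<in>{0..t}. ennreal ((elementary_value n \<tau> \<xi> s \<omega>)\<^sup>2) \<partial>lborel) \<partial>P x)
    = ennreal (integral\<^sup>L (P x) (\<lambda>\<omega>. (elementary_integral B n \<tau> \<xi> t \<omega>)\<^sup>2))"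
proof -
  interpret prob_space "P x" by (rule prob)
  have xi: "integrable (P x) (\<lambda>\<omega>. (\<xi> i \<omega>)\<^sup>2)" if "i < n" for i
  proof -
    have "\<xi> i \<in> borel_measurable (P x)"
      using ep that elementary_process_times(1)[OF ep, of i]
      by (auto simp: elementary_process_def intro: measurable_F_P)
    moreover have "bounded (\<xi> i ` space (P x))"
      using ep that by (simp add: elementary_process_def)
    then obtain K where "\<And>\<omega>. \<omega> \<in> space (P x) \<Longrightarrow> \<bar>\<xi> i \<omega>\<bar> \<le> K"
      by (auto simp: bounded_iff)
    then have "\<And>\<omega>. \<omega> \<in> space (P x) \<Longrightarrow> (\<xi> i \<omega>)\<^sup>2 \<le> K\<^sup>2"
      using power_mono[of "\<bar>\<xi> i _\<bar>" K 2] by auto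
    ultimately show ?thesis
      by (intro integrable_const_bound[where B="K\<^sup>2"]) auto
  qed
  have nn: "0 \<le> (\<Sum>i<n. (\<xi> i \<omega>)\<^sup>2 * (min t (\<tau> (Suc i)) - min t (\<tau> i)))" for \<omega>
  proof (intro sum_nonneg mult_nonneg_nonneg)
    fix i assume "i \<in> {..<n}"
    then have "\<tau> i \<le> \<tau> (Suc i)" using elementary_process_times(2)[OF ep] by simp
    then show "0 \<le> min t (\<tau> (Suc i)) - min t (\<tau> i)" by simp
  qed simp
  show ?thesis
    unfolding nn_integral_elementary_value_square[OF ep] elementary_integral_moments(4)[OF ep t]
    using xi nn
    by (subst nn_integral_eq_integral)
       (auto intro!: Bochner_Integration.integrable_sum)
qed

end

section \<open>The Ito integral of the sign\<close>

context brownian_family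
begin

text \<open>By path continuity the value at time s is the limit of the values at the grid times of
  mesh 1 / (n + 1), of which there are countably many. The \<open>max 0 s\<close> avoids negative
  times, about which nothing is known.\<close>

lemma jointly_measurable_B [measurable]:
  "(\<lambda>(\<omega>, s :: real). B (max 0 s) \<omega>) \<in> borel_measurable (P x \<Otimes>\<^sub>M lborel)"
proof -
  have step: "(\<lambda>p. B (max 0 (real_of_int \<lfloor>snd p * Suc n\<rfloor> / Suc n)) (fst p))
      \<in> borel_measurable (P x \<Otimes>\<^sub>M (lborel :: real measure))" for n
  proof (rule measurable_compose_countable[where f="\<lambda>i (p :: 'a \<times> real). B (max 0 (real_of_int i / Suc n)) (fst p)"
        and g="\<lambda>p :: 'a \<times> real. \<lfloor>snd p * Suc n\<rfloor>"])
    show "(\<lambda>p. B (max 0 (real_of_int i / Suc n)) (fst p))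
        \<in> borel_measurable (P x \<Otimes>\<^sub>M (lborel :: real measure))" for i
      by (rule measurable_compose[OF measurable_fst measurable_B]) simp
    show "(\<lambda>p. \<lfloor>snd p * Suc n\<rfloor>) \<in> measurable (P x \<Otimes>\<^sub>M (lborel :: real measure)) (count_space UNIV)"
      by measurable
  qed
  show ?thesis
  proof (rule borel_measurable_LIMSEQ_real[OF _ step])
    fix p :: "'a \<times> real" assume "p \<in> space (P x \<Otimes>\<^sub>M lborel)"
    then obtain \<omega> and s :: real where p: "p = (\<omega>, s)" and \<omega>: "\<omega> \<in> space M"
      by (auto simp: space_pair_measure space_P)
    have "(\<lambda>n. real_of_int \<lfloor>s * Suc n\<rfloor> / Suc n) \<longlonglongrightarrow> s"
    proof (rule tendsto_sandwich[where f="\<lambda>n. s - 1 / Suc n" and h="\<lambda>n. s"])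
      show "\<forall>\<^sub>F n in sequentially. s - 1 / Suc n \<le> real_of_int \<lfloor>s * Suc n\<rfloor> / Suc n"
      proof (rule always_eventually, rule allI)
        fix n
        have "s * Suc n - 1 \<le> real_of_int \<lfloor>s * Suc n\<rfloor>" by linarith
        then have "(s * Suc n - 1) / Suc n \<le> real_of_int \<lfloor>s * Suc n\<rfloor> / Suc n"
          by (rule divide_right_mono) simp
        then show "s - 1 / Suc n \<le> real_of_int \<lfloor>s * Suc n\<rfloor> / Suc n"
          by (simp add: diff_divide_distrib)
      qed
      show "\<forall>\<^sub>F n in sequentially. real_of_int \<lfloor>s * Suc n\<rfloor> / Suc n \<le> s"
      proof (rule always_eventually, rule allI)
        fix n
        have "real_of_int \<lfloor>s * Suc n\<rfloor> \<le> s * Suc n" by linarith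
        then show "real_of_int \<lfloor>s * Suc n\<rfloor> / Suc n \<le> s"
          by (simp add: pos_divide_le_eq)
      qed
      show "(\<lambda>n. s - 1 / Suc n) \<longlonglongrightarrow> s"
        using tendsto_diff[OF tendsto_const[of s] LIMSEQ_inverse_real_of_nat]
        by (simp add: inverse_eq_divide)
    qed simp
    then have "(\<lambda>n. max 0 (real_of_int \<lfloor>s * Suc n\<rfloor> / Suc n)) \<longlonglongrightarrow> max 0 s"
      by (intro tendsto_max tendsto_const)
    then have "(\<lambda>n. B (max 0 (real_of_int \<lfloor>s * Suc n\<rfloor> / Suc n)) \<omega>) \<longlonglongrightarrow> B (max 0 s) \<omega>"
      by (rule continuous_on_tendsto_compose[OF paths_B[OF \<omega>]]) auto
    then show "(\<lambda>n. B (max 0 (real_of_int \<lfloor>snd p * Suc n\<rfloor> / Suc n)) (fst p))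
        \<longlonglongrightarrow> (case p of (\<omega>, s) \<Rightarrow> B (max 0 s) \<omega>)"
      by (simp add: p)
  qed
qed

lemma AE_B_neq_0:
  assumes "0 < s"
  shows "AE \<omega> in P x. B s \<omega> \<noteq> 0"
proof -
  note D = increment_B[OF order_refl assms, of x]
  have "AE y in distr (P x) lborel (\<lambda>\<omega>. B s \<omega> - B 0 \<omega>). y \<noteq> - x"
    unfolding distributed_distr_eq_density[OF D]
    using AE_lborel_singleton[of "- x"] by (subst AE_density) auto
  then have "AE \<omega> in P x. B s \<omega> - B 0 \<omega> \<noteq> - x"
    by (subst (asm) AE_distr_iff) (use distributed_measurable[OF D] in auto)
  then show ?thesis
    using start_B[of x] by eventually_elim auto
qed

text \<open>Here the convention sgn 0 = 0 is seen to cost nothing: for each s > 0 the event B_s = 0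
  is null, and Fubini's theorem carries this over to the inner time integral.\<close>

lemma nn_integral_sgn_B_square:
  assumes t: "0 \<le> t"
  shows "(\<integral>\<^sup>+\<omega>. (\<integral>\<^sup>+s\<in>{0..t}. ennreal ((sgn (B s \<omega>))\<^sup>2) \<partial>lborel) \<partial>P x) = ennreal t"
proof -
  interpret prob_space "P x" by (rule prob)
  interpret pair_sigma_finite "P x" lborel ..
  have "(\<integral>\<^sup>+\<omega>. (\<integral>\<^sup>+s\<in>{0..t}. ennreal ((sgn (B s \<omega>))\<^sup>2) \<partial>lborel) \<partial>P x)
      = (\<integral>\<^sup>+\<omega>. (\<integral>\<^sup>+s. (case (\<omega>, s) of (\<omega>, s) \<Rightarrow>
          ennreal ((sgn (B (max 0 s) \<omega>))\<^sup>2) * indicator {0..t} s) \<partial>lborel) \<partial>P x)"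
    by (intro nn_integral_cong) (auto split: split_indicator)
  also have "\<dots> = (\<integral>\<^sup>+s. (\<integral>\<^sup>+\<omega>. ennreal ((sgn (B (max 0 s) \<omega>))\<^sup>2) * indicator {0..t} s \<partial>P x) \<partial>lborel)"
    by (subst Fubini'[symmetric]) auto
  also have "\<dots> = (\<integral>\<^sup>+s. indicator {0..t} s \<partial>lborel)"
  proof (rule nn_integral_cong_AE)
    show "AE s in lborel. (\<integral>\<^sup>+\<omega>. ennreal ((sgn (B (max 0 s) \<omega>))\<^sup>2) * indicator {0..t} s \<partial>P x)
        = indicator {0..t} s"
      using AE_lborel_singleton[of "0::real"]
    proof eventually_elim
      fix s :: real assume "s \<noteq> 0"
      show "(\<integral>\<^sup>+\<omega>. ennreal ((sgn (B (max 0 s) \<omega>))\<^sup>2) * indicator {0..t} s \<partial>P x) = indicator {0..t} s"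
      proof (cases "s \<in> {0..t}")
        case True
        with \<open>s \<noteq> 0\<close> have "0 < s" by simp
        have "(\<integral>\<^sup>+\<omega>. ennreal ((sgn (B s \<omega>))\<^sup>2) \<partial>P x) = (\<integral>\<^sup>+\<omega>. 1 \<partial>P x)"
          using AE_B_neq_0[OF \<open>0 < s\<close>, of x]
          by (intro nn_integral_cong_AE, eventually_elim) (simp add: sgn_if)
        then show ?thesis
          using True \<open>0 < s\<close> by (simp add: emeasure_space_1)
      qed simp
    qed
  qed
  also have "\<dots> = ennreal t"
    using t by simp
  finally show ?thesis .
qed

end

section \<open>Uniformly bounded approximations and the moments of the limit\<close>

lemma has_ito_integralE:
  assumes "has_ito_integral Q F B t H I"
  obtains n \<tau> \<xi> where "\<And>k::nat. elementary_process Q F (n k) (\<tau> k) (\<xi> k)"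
    and "(\<lambda>k. \<integral>\<^sup>+\<omega>. (\<integral>\<^sup>+s\<in>{0..t}. ennreal ((elementary_value (n k) (\<tau> k) (\<xi> k) s \<omega> - H s \<omega>)\<^sup>2)
                \<partial>lborel) \<partial>Q) \<longlonglongrightarrow> 0"
    and "(\<lambda>k. \<integral>\<^sup>+\<omega>. ennreal ((elementary_integral B (n k) (\<tau> k) (\<xi> k) t \<omega> - I \<omega>)\<^sup>2) \<partial>Q) \<longlonglongrightarrow> 0"
proof -
  obtain n \<tau> \<xi> where *: "(\<forall>k::nat. elementary_process Q F (n k) (\<tau> k) (\<xi> k)) \<and>
    (\<lambda>k. \<integral>\<^sup>+\<omega>. (\<integral>\<^sup>+s\<in>{0..t}. ennreal ((elementary_value (n k) (\<tau> k) (\<xi> k) s \<omega> - H s \<omega>)\<^sup>2)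
                \<partial>lborel) \<partial>Q) \<longlonglongrightarrow> 0 \<and>
    (\<lambda>k. \<integral>\<^sup>+\<omega>. ennreal ((elementary_integral B (n k) (\<tau> k) (\<xi> k) t \<omega> - I \<omega>)\<^sup>2) \<partial>Q) \<longlonglongrightarrow> 0"
    using assms unfolding has_ito_integral_def
    by (elim conjE exE) (rule that, intro conjI, assumption+)
  show ?thesis
    by (rule that[of n \<tau> \<xi>]) (use * in simp_all)
qed

definition clip :: "real \<Rightarrow> real" where
  "clip y = max (- 1) (min 1 y)"

lemma clip_0 [simp]: "clip 0 = 0" and abs_clip_le: "\<bar>clip y\<bar> \<le> 1"
  by (auto simp: clip_def)

text \<open>\<open>clip\<close> is the projection onto [-1, 1]: it moves y closer to every point z
  of the interval, and what it cuts off is the distance of y to the interval, hence at most the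
  distance to z.\<close>

lemma clip_closer:
  assumes "\<bar>z\<bar> \<le> 1"
  shows "(clip y - z)\<^sup>2 \<le> (y - z)\<^sup>2" and "(y - clip y)\<^sup>2 \<le> (y - z)\<^sup>2"
  using assms by (auto simp: clip_def abs_le_square_iff[symmetric] max_def min_def)

lemma measurable_clip [measurable]: "clip \<in> borel_measurable borel"
  unfolding clip_def by measurable

text \<open>The growth condition keeps the coefficients bounded and holds for both functions that
  will be applied, \<open>clip\<close> and \<open>y - clip y\<close>.\<close>

lemma elementary_process_compose:
  assumes "elementary_process Q F n \<tau> \<xi>" and "\<phi> \<in> borel_measurable borel"
    and "\<And>y. \<bar>\<phi> y\<bar> \<le> \<bar>y\<bar> + 1"
  shows "elementary_process Q F n \<tau> (\<lambda>i \<omega>. \<phi> (\<xi> i \<omega>))"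
proof -
  have "bounded ((\<lambda>\<omega>. \<phi> (\<xi> i \<omega>)) ` space Q)" if "i < n" for i
  proof -
    have "bounded (\<xi> i ` space Q)"
      using assms(1) that by (simp add: elementary_process_def)
    then obtain K where "\<And>\<omega>. \<omega> \<in> space Q \<Longrightarrow> \<bar>\<xi> i \<omega>\<bar> \<le> K"
      by (auto simp: bounded_iff)
    then have "\<And>\<omega>. \<omega> \<in> space Q \<Longrightarrow> \<bar>\<phi> (\<xi> i \<omega>)\<bar> \<le> K + 1"
      using assms(3) by (meson add_right_mono order_trans)
    then show ?thesis
      by (auto simp: bounded_iff)
  qed
  with assms(1,2) show ?thesis
    by (auto simp: elementary_process_def)
qed

context brownian_family
begin

text \<open>
  The elementary processes in the definition of the integral are not uniformly bounded. Clipping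
  them to \<open>[-1, 1]\<close> moves them closer to the sign and makes their fourth moments available.
\<close>

lemma ito_sgn_bounded_approximation:
  assumes ito: "has_ito_integral (P x) F B t (\<lambda>s \<omega>. sgn (B s \<omega>)) I" and t: "0 \<le> t"
  obtains n \<tau> \<xi> where "\<And>k::nat. elementary_process (P x) F (n k) (\<tau> k) (\<xi> k)"
    and "\<And>k i \<omega>. \<bar>\<xi> k i \<omega>\<bar> \<le> 1"
    and "(\<lambda>k. \<integral>\<^sup>+\<omega>. (\<integral>\<^sup>+s\<in>{0..t}. ennreal ((elementary_value (n k) (\<tau> k) (\<xi> k) s \<omega> - sgn (B s \<omega>))\<^sup>2)
                \<partial>lborel) \<partial>P x) \<longlonglongrightarrow> 0"
    and "(\<lambda>k. \<integral>\<^sup>+\<omega>. ennreal ((elementary_integral B (n k) (\<tau> k) (\<xi> k) t \<omega> - I \<omega>)\<^sup>2) \<partial>P x) \<longlonglongrightarrow> 0"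
proof -
  interpret prob_space "P x" by (rule prob)
  obtain n \<tau> \<xi> where ep: "\<And>k::nat. elementary_process (P x) F (n k) (\<tau> k) (\<xi> k)"
    and d: "(\<lambda>k. \<integral>\<^sup>+\<omega>. (\<integral>\<^sup>+s\<in>{0..t}. ennreal ((elementary_value (n k) (\<tau> k) (\<xi> k) s \<omega> - sgn (B s \<omega>))\<^sup>2)
                \<partial>lborel) \<partial>P x) \<longlonglongrightarrow> 0" (is "?d \<longlonglongrightarrow> 0")
    and e: "(\<lambda>k. \<integral>\<^sup>+\<omega>. ennreal ((elementary_integral B (n k) (\<tau> k) (\<xi> k) t \<omega> - I \<omega>)\<^sup>2) \<partial>P x) \<longlonglongrightarrow> 0"
      (is "?e \<longlonglongrightarrow> 0")
    by (rule has_ito_integralE[OF ito]) (rule that; assumption)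
  have [measurable]: "I \<in> borel_measurable (P x)"
    using ito by (simp add: has_ito_integral_def)
  define \<eta> where "\<eta> k i \<omega> = clip (\<xi> k i \<omega>)" for k i \<omega>
  define \<rho> where "\<rho> k i \<omega> = \<xi> k i \<omega> - clip (\<xi> k i \<omega>)" for k i \<omega>
  have ep\<eta>: "elementary_process (P x) F (n k) (\<tau> k) (\<eta> k)" for k
    using elementary_process_compose[OF ep, of clip k] abs_clip_le
    by (simp add: \<eta>_def[abs_def] add_increasing)
  have ep\<rho>: "elementary_process (P x) F (n k) (\<tau> k) (\<rho> k)" for k
    unfolding \<rho>_def[abs_def]
  proof (rule elementary_process_compose[OF ep, of "\<lambda>y. y - clip y"])
    show "\<bar>y - clip y\<bar> \<le> \<bar>y\<bar> + 1" for y
      using abs_clip_le[of y] abs_triangle_ineq4[of y "clip y"] by linarith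
  qed measurable
  have v\<eta>: "elementary_value (n k) (\<tau> k) (\<eta> k) s \<omega> = clip (elementary_value (n k) (\<tau> k) (\<xi> k) s \<omega>)"
    for k s \<omega>
    unfolding \<eta>_def[abs_def]
    by (rule elementary_value_compose[of "n k" "\<tau> k", OF elementary_process_times(2)[OF ep[of k]]]) auto
  have v\<rho>: "elementary_value (n k) (\<tau> k) (\<rho> k) s \<omega>
      = elementary_value (n k) (\<tau> k) (\<xi> k) s \<omega> - clip (elementary_value (n k) (\<tau> k) (\<xi> k) s \<omega>)"
    for k s \<omega>
    unfolding \<rho>_def[abs_def]
    by (rule elementary_value_compose[of "n k" "\<tau> k" "\<lambda>y. y - clip y", OF elementary_process_times(2)[OF ep[of k]]]) auto
  let ?J = "\<lambda>k \<xi>. elementary_integral B (n k) (\<tau> k) \<xi> t"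
  have J\<rho>: "?J k (\<rho> k) \<omega> = ?J k (\<xi> k) \<omega> - ?J k (\<eta> k) \<omega>" for k \<omega>
    by (simp add: elementary_integral_def \<rho>_def \<eta>_def sum_subtractf[symmetric] left_diff_distrib)
  note J_m [measurable] = measurable_elementary_integral[OF ep t] measurable_elementary_integral[OF ep\<eta> t]
    measurable_elementary_integral[OF ep\<rho> t]
  have sgn1: "\<bar>sgn (B s \<omega>)\<bar> \<le> 1" for s \<omega>
    by (simp add: sgn_if)
  \<comment> \<open>By the isometry, the integral of the part cut off has second moment at most the
    distance of the original process to the sign. Clipping thus disturbs the integrals by something
    that tends to 0.\<close>
  have d\<rho>: "(\<integral>\<^sup>+\<omega>. ennreal ((?J k (\<rho> k) \<omega>)\<^sup>2) \<partial>P x) \<le> ?d k" for k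
  proof -
    have "integrable (P x) (\<lambda>\<omega>. (?J k (\<rho> k) \<omega>)\<^sup>2)"
      by (rule integrable_power_of_power4[OF prob _ elementary_integral_moments(2)[OF ep\<rho> t]]) auto
    then have "(\<integral>\<^sup>+\<omega>. ennreal ((?J k (\<rho> k) \<omega>)\<^sup>2) \<partial>P x)
        = ennreal (integral\<^sup>L (P x) (\<lambda>\<omega>. (?J k (\<rho> k) \<omega>)\<^sup>2))"
      by (intro nn_integral_eq_integral) auto
    also have "\<dots> \<le> ?d k"
      unfolding elementary_isometry[OF ep\<rho> t, symmetric] v\<rho>
      by (intro nn_integral_mono mult_right_mono ennreal_leI clip_closer sgn1) auto
    finally show ?thesis .
  qed
  show ?thesis
  proof
    show "elementary_process (P x) F (n k) (\<tau> k) (\<eta> k)" for k by (rule ep\<eta>)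
    show "\<bar>\<eta> k i \<omega>\<bar> \<le> 1" for k i \<omega> by (simp add: \<eta>_def abs_clip_le)
    show "(\<lambda>k. \<integral>\<^sup>+\<omega>. (\<integral>\<^sup>+s\<in>{0..t}. ennreal ((elementary_value (n k) (\<tau> k) (\<eta> k) s \<omega> - sgn (B s \<omega>))\<^sup>2)
                \<partial>lborel) \<partial>P x) \<longlonglongrightarrow> 0"
    proof (rule tendsto_sandwich[OF _ _ tendsto_const d])
      show "\<forall>\<^sub>F k in sequentially. (\<integral>\<^sup>+\<omega>. (\<integral>\<^sup>+s\<in>{0..t}.
          ennreal ((elementary_value (n k) (\<tau> k) (\<eta> k) s \<omega> - sgn (B s \<omega>))\<^sup>2) \<partial>lborel) \<partial>P x) \<le> ?d k"
        unfolding v\<eta>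
        by (intro always_eventually allI nn_integral_mono mult_right_mono ennreal_leI clip_closer sgn1) auto
    qed auto
    have le: "(\<integral>\<^sup>+\<omega>. ennreal ((?J k (\<eta> k) \<omega> - I \<omega>)\<^sup>2) \<partial>P x) \<le> 2 * ?e k + 2 * ?d k" for k
    proof -
      have "(\<integral>\<^sup>+\<omega>. ennreal ((?J k (\<eta> k) \<omega> - I \<omega>)\<^sup>2) \<partial>P x)
          \<le> (\<integral>\<^sup>+\<omega>. 2 * ennreal ((?J k (\<xi> k) \<omega> - I \<omega>)\<^sup>2) + 2 * ennreal ((?J k (\<rho> k) \<omega>)\<^sup>2) \<partial>P x)"
      proof (rule nn_integral_mono)
        fix \<omega>
        have "(?J k (\<eta> k) \<omega> - I \<omega>)\<^sup>2 \<le> 2 * (?J k (\<xi> k) \<omega> - I \<omega>)\<^sup>2 + 2 * (?J k (\<rho> k) \<omega>)\<^sup>2"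
          using add_square_le_weighted[of 1 "?J k (\<xi> k) \<omega> - I \<omega>" "- ?J k (\<rho> k) \<omega>"]
          unfolding power2_minus by (simp add: J\<rho>)
        then have "ennreal ((?J k (\<eta> k) \<omega> - I \<omega>)\<^sup>2)
            \<le> ennreal (2 * (?J k (\<xi> k) \<omega> - I \<omega>)\<^sup>2 + 2 * (?J k (\<rho> k) \<omega>)\<^sup>2)"
          by (rule ennreal_leI)
        then show "ennreal ((?J k (\<eta> k) \<omega> - I \<omega>)\<^sup>2)
            \<le> 2 * ennreal ((?J k (\<xi> k) \<omega> - I \<omega>)\<^sup>2) + 2 * ennreal ((?J k (\<rho> k) \<omega>)\<^sup>2)"
          by (simp add: ennreal_mult)
      qed
      also have "\<dots> = 2 * ?e k + 2 * (\<integral>\<^sup>+\<omega>. ennreal ((?J k (\<rho> k) \<omega>)\<^sup>2) \<partial>P x)"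
        by (subst nn_integral_add) (auto simp: nn_integral_cmult)
      also have "\<dots> \<le> 2 * ?e k + 2 * ?d k"
        by (intro add_left_mono mult_left_mono d\<rho>) simp
      finally show ?thesis .
    qed
    have lim: "(\<lambda>k. 2 * ?e k + 2 * ?d k) \<longlonglongrightarrow> 2 * 0 + 2 * 0"
      by (intro tendsto_add ennreal_tendsto_cmult d e) (auto simp: ennreal_numeral[symmetric] simp del: ennreal_numeral)
    show "(\<lambda>k. \<integral>\<^sup>+\<omega>. ennreal ((?J k (\<eta> k) \<omega> - I \<omega>)\<^sup>2) \<partial>P x) \<longlonglongrightarrow> 0"
      by (rule tendsto_sandwich[OF _ _ tendsto_const lim[simplified]]) (use le in auto)
  qed
qed

text \<open>Each moment passes from the bounded approximations to I in its own way: the mean by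
  Jensen's inequality, the second moment by weighted comparison with \<epsilon> tending to 0, the
  fourth by Fatou's lemma, which is why only an inequality results there.\<close>

lemma ito_sgn_moments:
  assumes ito: "has_ito_integral (P x) F B t (\<lambda>s \<omega>. sgn (B s \<omega>)) I" and t: "0 \<le> t"
  shows "integrable (P x) (\<lambda>\<omega>. I \<omega> ^ 4)"
    and "integral\<^sup>L (P x) I = 0"
    and "integral\<^sup>L (P x) (\<lambda>\<omega>. (I \<omega>)\<^sup>2) = t"
    and "integral\<^sup>L (P x) (\<lambda>\<omega>. I \<omega> ^ 4) \<le> 3 * t\<^sup>2"
proof -
  interpret prob_space "P x" by (rule prob)
  interpret pair_sigma_finite "P x" lborel ..
  have [measurable]: "I \<in> borel_measurable (P x)"
    using ito by (simp add: has_ito_integral_def)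
  obtain n \<tau> \<xi> where ep: "\<And>k::nat. elementary_process (P x) F (n k) (\<tau> k) (\<xi> k)"
    and \<xi>1: "\<And>k i \<omega>. \<bar>\<xi> k i \<omega>\<bar> \<le> 1"
    and d: "(\<lambda>k. \<integral>\<^sup>+\<omega>. (\<integral>\<^sup>+s\<in>{0..t}. ennreal ((elementary_value (n k) (\<tau> k) (\<xi> k) s \<omega> - sgn (B s \<omega>))\<^sup>2)
                \<partial>lborel) \<partial>P x) \<longlonglongrightarrow> 0" (is "?d \<longlonglongrightarrow> 0")
    and e: "(\<lambda>k. \<integral>\<^sup>+\<omega>. ennreal ((elementary_integral B (n k) (\<tau> k) (\<xi> k) t \<omega> - I \<omega>)\<^sup>2) \<partial>P x) \<longlonglongrightarrow> 0"
      (is "?e \<longlonglongrightarrow> 0")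
    by (rule ito_sgn_bounded_approximation[OF ito t]) (rule that; assumption)
  define J where "J k = elementary_integral B (n k) (\<tau> k) (\<xi> k) t" for k
  have J_m [measurable]: "J k \<in> borel_measurable (P x)" for k
    unfolding J_def by (rule measurable_elementary_integral[OF ep t])
  have J4: "integrable (P x) (\<lambda>\<omega>. J k \<omega> ^ 4)" and J1: "integral\<^sup>L (P x) (J k) = 0" for k
    unfolding J_def by (rule elementary_integral_moments[OF ep t])+
  have Ji: "integrable (P x) (\<lambda>\<omega>. J k \<omega> ^ j)" if "j \<le> 4" for k j
    by (rule integrable_power_of_power4[OF prob J_m J4 that])
  have tau0: "0 \<le> min t (\<tau> k (n k))" for k
    using t elementary_process_times(1)[OF ep, of "n k"] by simp
  have J2_le: "integral\<^sup>L (P x) (\<lambda>\<omega>. (J k \<omega>)\<^sup>2) \<le> t" for k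
    using elementary_integral_moments(5)[OF ep t \<xi>1, of k] by (simp add: J_def)
  have J4_le: "integral\<^sup>L (P x) (\<lambda>\<omega>. J k \<omega> ^ 4) \<le> 3 * t\<^sup>2" for k
    using elementary_integral_moments(6)[OF ep t \<xi>1, of k] power_mono[OF min.cobounded1 tau0[of k], of 2]
    by (simp add: J_def)

  \<comment> \<open>Before real integrals of \<open>I\<close> make sense, \<open>I\<close> has to be
    square integrable; one index at finite distance suffices for this.\<close>
  have "\<forall>\<^sub>F k in sequentially. ?e k < 1"
    using e by (rule order_tendstoD) simp
  then obtain k0 where k0: "?e k0 < 1"
    by (auto simp: eventually_sequentially)
  have "integrable (P x) (\<lambda>\<omega>. (J k0 \<omega> - I \<omega>)\<^sup>2)"
    using k0 unfolding J_def[symmetric]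
    by (intro integrableI_bounded) (auto intro: less_trans)
  then have "integrable (P x) (\<lambda>\<omega>. 2 * (J k0 \<omega>)\<^sup>2 + 2 * (J k0 \<omega> - I \<omega>)\<^sup>2)"
    using Ji[of 2 k0] by simp
  then have I2: "integrable (P x) (\<lambda>\<omega>. (I \<omega>)\<^sup>2)"
  proof (rule Bochner_Integration.integrable_bound)
    have "(I \<omega>)\<^sup>2 \<le> 2 * (J k0 \<omega>)\<^sup>2 + 2 * (J k0 \<omega> - I \<omega>)\<^sup>2" for \<omega>
      using square_le_weighted_diff[of 1 "I \<omega>" "J k0 \<omega>"] by simp
    then show "AE \<omega> in P x. norm ((I \<omega>)\<^sup>2) \<le> norm (2 * (J k0 \<omega>)\<^sup>2 + 2 * (J k0 \<omega> - I \<omega>)\<^sup>2)"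
      by (intro AE_I2) simp
  qed simp
  have I1: "integrable (P x) I"
    using square_integrable_imp_integrable[OF _ I2] by simp
  define r where "r k = integral\<^sup>L (P x) (\<lambda>\<omega>. (J k \<omega> - I \<omega>)\<^sup>2)" for k
  have D2: "integrable (P x) (\<lambda>\<omega>. (J k \<omega> - I \<omega>)\<^sup>2)" for k
  proof -
    have "integrable (P x) (\<lambda>\<omega>. 2 * (J k \<omega>)\<^sup>2 + 2 * (I \<omega>)\<^sup>2)"
      using Ji[of 2 k] I2 by simp
    then show ?thesis
    proof (rule Bochner_Integration.integrable_bound)
      have "(J k \<omega> - I \<omega>)\<^sup>2 \<le> 2 * (J k \<omega>)\<^sup>2 + 2 * (I \<omega>)\<^sup>2" for \<omega>
        using add_square_le_weighted[of 1 "J k \<omega>" "- I \<omega>"] by simp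
      then show "AE \<omega> in P x. norm ((J k \<omega> - I \<omega>)\<^sup>2) \<le> norm (2 * (J k \<omega>)\<^sup>2 + 2 * (I \<omega>)\<^sup>2)"
        by (intro AE_I2) simp
    qed simp
  qed
  have r0: "0 \<le> r k" for k
    unfolding r_def by (rule integral_nonneg_AE) simp
  have er: "?e = (\<lambda>k. ennreal (r k))"
    unfolding r_def J_def[symmetric] by (intro ext nn_integral_eq_integral D2) simp
  have r: "r \<longlonglongrightarrow> 0"
    using e r0 unfolding er by (simp add: ennreal_0[symmetric] del: ennreal_0)
  have J1i: "integrable (P x) (J k)" for k
    using Ji[of 1 k] by simp

  \<comment> \<open>Jensen's inequality, read off from the variance of \<open>J k - I\<close>, whose
    mean is minus that of \<open>I\<close>.\<close>
  have "(integral\<^sup>L (P x) I)\<^sup>2 \<le> r k" for k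
  proof -
    have "0 \<le> variance (\<lambda>\<omega>. J k \<omega> - I \<omega>)"
      by (rule variance_positive)
    also have "\<dots> = r k - (integral\<^sup>L (P x) (\<lambda>\<omega>. J k \<omega> - I \<omega>))\<^sup>2"
      unfolding r_def using J1i I1 D2 by (intro variance_eq) auto
    also have "integral\<^sup>L (P x) (\<lambda>\<omega>. J k \<omega> - I \<omega>) = - integral\<^sup>L (P x) I"
      using J1i I1 J1 by simp
    finally show ?thesis by simp
  qed
  then have "(integral\<^sup>L (P x) I)\<^sup>2 \<le> 0"
    by (intro LIMSEQ_le_const[OF r]) auto
  then show "integral\<^sup>L (P x) I = 0" by simp

  have IJ: "integral\<^sup>L (P x) (\<lambda>\<omega>. (I \<omega>)\<^sup>2)
      \<le> (1 + \<epsilon>) * integral\<^sup>L (P x) (\<lambda>\<omega>. (J k \<omega>)\<^sup>2) + (1 + 1 / \<epsilon>) * r k"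
    and JI: "integral\<^sup>L (P x) (\<lambda>\<omega>. (J k \<omega>)\<^sup>2)
      \<le> (1 + \<epsilon>) * integral\<^sup>L (P x) (\<lambda>\<omega>. (I \<omega>)\<^sup>2) + (1 + 1 / \<epsilon>) * r k" if "0 < \<epsilon>" for \<epsilon> k
  proof -
    have "integral\<^sup>L (P x) (\<lambda>\<omega>. (I \<omega>)\<^sup>2)
      \<le> integral\<^sup>L (P x) (\<lambda>\<omega>. (1 + \<epsilon>) * (J k \<omega>)\<^sup>2 + (1 + 1 / \<epsilon>) * (J k \<omega> - I \<omega>)\<^sup>2)"
      using I2 D2[of k] Ji[of 2 k] by (intro integral_mono square_le_weighted_diff that) auto
    then show "integral\<^sup>L (P x) (\<lambda>\<omega>. (I \<omega>)\<^sup>2)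
      \<le> (1 + \<epsilon>) * integral\<^sup>L (P x) (\<lambda>\<omega>. (J k \<omega>)\<^sup>2) + (1 + 1 / \<epsilon>) * r k"
      using D2[of k] Ji[of 2 k] by (simp add: r_def)
    have "integral\<^sup>L (P x) (\<lambda>\<omega>. (J k \<omega>)\<^sup>2)
      \<le> integral\<^sup>L (P x) (\<lambda>\<omega>. (1 + \<epsilon>) * (I \<omega>)\<^sup>2 + (1 + 1 / \<epsilon>) * (J k \<omega> - I \<omega>)\<^sup>2)"
      using I2 D2[of k] Ji[of 2 k] unfolding power2_commute[of "J k _" "I _"]
      by (intro integral_mono square_le_weighted_diff that) auto
    then show "integral\<^sup>L (P x) (\<lambda>\<omega>. (J k \<omega>)\<^sup>2)
      \<le> (1 + \<epsilon>) * integral\<^sup>L (P x) (\<lambda>\<omega>. (I \<omega>)\<^sup>2) + (1 + 1 / \<epsilon>) * r k"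
      using D2[of k] I2 by (simp add: r_def)
  qed
  have at0: "\<forall>\<^sub>F \<epsilon> in at_right 0. 0 < (\<epsilon>::real)"
    by (auto simp: eventually_at_filter)

  show "integral\<^sup>L (P x) (\<lambda>\<omega>. (I \<omega>)\<^sup>2) = t"
  proof (rule antisym)
    have up: "integral\<^sup>L (P x) (\<lambda>\<omega>. (I \<omega>)\<^sup>2) \<le> (1 + \<epsilon>) * t" if "0 < \<epsilon>" for \<epsilon>
    proof -
      have "(\<lambda>k. (1 + \<epsilon>) * t + (1 + 1 / \<epsilon>) * r k) \<longlonglongrightarrow> (1 + \<epsilon>) * t + (1 + 1 / \<epsilon>) * 0"
        by (intro tendsto_intros r)
      moreover have "integral\<^sup>L (P x) (\<lambda>\<omega>. (I \<omega>)\<^sup>2) \<le> (1 + \<epsilon>) * t + (1 + 1 / \<epsilon>) * r k" for k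
        using that by (intro order_trans[OF IJ[OF that, of k]] add_right_mono mult_left_mono J2_le) simp
      ultimately show ?thesis
        using LIMSEQ_le_const by fastforce
    qed
    have "((\<lambda>\<epsilon>. (1 + \<epsilon>) * t) \<longlongrightarrow> (1 + 0) * t) (at_right 0)"
      by (intro tendsto_intros)
    then have "integral\<^sup>L (P x) (\<lambda>\<omega>. (I \<omega>)\<^sup>2) \<le> (1 + 0) * t"
      by (rule tendsto_lowerbound) (use up in \<open>auto intro: eventually_mono[OF at0]\<close>)
    then show "integral\<^sup>L (P x) (\<lambda>\<omega>. (I \<omega>)\<^sup>2) \<le> t" by simp
    have I20: "0 \<le> integral\<^sup>L (P x) (\<lambda>\<omega>. (I \<omega>)\<^sup>2)"
      by (rule integral_nonneg_AE) simp
    let ?v = "\<lambda>k. elementary_value (n k) (\<tau> k) (\<xi> k)"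
    have \<xi>_m: "\<xi> k i \<in> borel_measurable (P x)" if "i < n k" for k i
      using ep[of k] that elementary_process_times(1)[OF ep, of i k]
      by (auto simp: elementary_process_def intro: measurable_F_P)
    have v_m [measurable]: "(\<lambda>(\<omega>, s). ?v k s \<omega>) \<in> borel_measurable (P x \<Otimes>\<^sub>M lborel)" for k
      unfolding elementary_value_def split_beta'
      by (intro borel_measurable_sum borel_measurable_times measurable_compose[OF measurable_fst \<xi>_m]
          measurable_compose[OF measurable_snd borel_measurable_indicator]) auto
    have v_s [measurable]: "(\<lambda>s. ?v k s \<omega>) \<in> borel_measurable lborel" for k \<omega>
      unfolding elementary_value_def by measurable
    \<comment> \<open>Two comparisons, each at the price of a factor 1 + \<epsilon>: the sign with
      its elementary approximation on the product space, and \<open>J k\<close> with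
      \<open>I\<close>. The isometry links them.\<close>
    have low: "t \<le> (1 + \<epsilon>) * ((1 + \<epsilon>) * integral\<^sup>L (P x) (\<lambda>\<omega>. (I \<omega>)\<^sup>2))" if "0 < \<epsilon>" for \<epsilon>
    proof -
      have k: "ennreal t \<le> ennreal ((1 + \<epsilon>) * ((1 + \<epsilon>) * integral\<^sup>L (P x) (\<lambda>\<omega>. (I \<omega>)\<^sup>2) + (1 + 1 / \<epsilon>) * r k))
          + ennreal (1 + 1 / \<epsilon>) * ?d k" for k
      proof -
        let ?b = "\<lambda>\<omega> s. B (max 0 s) \<omega>"
        have "ennreal t = (\<integral>\<^sup>+\<omega>. (\<integral>\<^sup>+s\<in>{0..t}. ennreal ((sgn (B s \<omega>))\<^sup>2) \<partial>lborel) \<partial>P x)"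
          by (rule nn_integral_sgn_B_square[OF t, symmetric])
        also have "\<dots> \<le> (\<integral>\<^sup>+\<omega>. (\<integral>\<^sup>+s. ennreal (1 + \<epsilon>) * (ennreal ((?v k s \<omega>)\<^sup>2) * indicator {0..t} s)
            + ennreal (1 + 1 / \<epsilon>) * (ennreal ((?v k s \<omega> - sgn (?b \<omega> s))\<^sup>2) * indicator {0..t} s) \<partial>lborel) \<partial>P x)"
        proof (intro nn_integral_mono)
          fix \<omega> s
          have "(sgn (B s \<omega>))\<^sup>2 \<le> (1 + \<epsilon>) * (?v k s \<omega>)\<^sup>2 + (1 + 1 / \<epsilon>) * (?v k s \<omega> - sgn (B s \<omega>))\<^sup>2"
            by (rule square_le_weighted_diff[OF that])
          then have "ennreal ((sgn (B s \<omega>))\<^sup>2)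
              \<le> ennreal ((1 + \<epsilon>) * (?v k s \<omega>)\<^sup>2 + (1 + 1 / \<epsilon>) * (?v k s \<omega> - sgn (B s \<omega>))\<^sup>2)"
            by (rule ennreal_leI)
          also have "\<dots> = ennreal (1 + \<epsilon>) * ennreal ((?v k s \<omega>)\<^sup>2)
              + ennreal (1 + 1 / \<epsilon>) * ennreal ((?v k s \<omega> - sgn (B s \<omega>))\<^sup>2)"
            using that by (simp add: ennreal_mult ennreal_plus del: ennreal_plus[symmetric])
          finally show "ennreal ((sgn (B s \<omega>))\<^sup>2) * indicator {0..t} s
              \<le> ennreal (1 + \<epsilon>) * (ennreal ((?v k s \<omega>)\<^sup>2) * indicator {0..t} s)
            + ennreal (1 + 1 / \<epsilon>) * (ennreal ((?v k s \<omega> - sgn (?b \<omega> s))\<^sup>2) * indicator {0..t} s)"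
            by (cases "s \<in> {0..t}") auto
        qed
        also have "\<dots> = ennreal (1 + \<epsilon>) * (\<integral>\<^sup>+\<omega>. (\<integral>\<^sup>+s\<in>{0..t}. ennreal ((?v k s \<omega>)\<^sup>2) \<partial>lborel) \<partial>P x)
            + ennreal (1 + 1 / \<epsilon>) *
              (\<integral>\<^sup>+\<omega>. (\<integral>\<^sup>+s\<in>{0..t}. ennreal ((?v k s \<omega> - sgn (?b \<omega> s))\<^sup>2) \<partial>lborel) \<partial>P x)"
        proof -
          have bs: "(\<lambda>s. ?b \<omega> s) \<in> borel_measurable lborel" if "\<omega> \<in> space (P x)" for \<omega>
            using measurable_compose[OF measurable_Pair1'[OF that] jointly_measurable_B] by simp
          have m1: "(\<lambda>(\<omega>, s). ennreal ((?v k s \<omega>)\<^sup>2) * indicator {0..t} s)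
              \<in> borel_measurable (P x \<Otimes>\<^sub>M lborel)"
            and m2: "(\<lambda>(\<omega>, s). ennreal ((?v k s \<omega> - sgn (?b \<omega> s))\<^sup>2) * indicator {0..t} s)
              \<in> borel_measurable (P x \<Otimes>\<^sub>M lborel)"
            using v_m[of k] jointly_measurable_B[of x] unfolding split_beta' by measurable
          have "(\<integral>\<^sup>+s. ennreal (1 + \<epsilon>) * (ennreal ((?v k s \<omega>)\<^sup>2) * indicator {0..t} s)
              + ennreal (1 + 1 / \<epsilon>) * (ennreal ((?v k s \<omega> - sgn (?b \<omega> s))\<^sup>2) * indicator {0..t} s) \<partial>lborel)
            = ennreal (1 + \<epsilon>) * (\<integral>\<^sup>+s\<in>{0..t}. ennreal ((?v k s \<omega>)\<^sup>2) \<partial>lborel)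
              + ennreal (1 + 1 / \<epsilon>) * (\<integral>\<^sup>+s\<in>{0..t}. ennreal ((?v k s \<omega> - sgn (?b \<omega> s))\<^sup>2) \<partial>lborel)"
            if "\<omega> \<in> space (P x)" for \<omega>
            using bs[OF that] by (subst nn_integral_add) (auto simp: nn_integral_cmult)
          then show ?thesis
            using lborel.borel_measurable_nn_integral[OF m1] lborel.borel_measurable_nn_integral[OF m2]
            by (subst nn_integral_cong[where v="\<lambda>\<omega>. ennreal (1 + \<epsilon>) * (\<integral>\<^sup>+s\<in>{0..t}. ennreal ((?v k s \<omega>)\<^sup>2) \<partial>lborel)
              + ennreal (1 + 1 / \<epsilon>) * (\<integral>\<^sup>+s\<in>{0..t}. ennreal ((?v k s \<omega> - sgn (?b \<omega> s))\<^sup>2) \<partial>lborel)"])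
               (auto simp: nn_integral_add nn_integral_cmult)
        qed
        also have "(\<integral>\<^sup>+\<omega>. (\<integral>\<^sup>+s\<in>{0..t}. ennreal ((?v k s \<omega> - sgn (?b \<omega> s))\<^sup>2) \<partial>lborel) \<partial>P x) = ?d k"
          by (intro nn_integral_cong) (auto split: split_indicator)
        also have "(\<integral>\<^sup>+\<omega>. (\<integral>\<^sup>+s\<in>{0..t}. ennreal ((?v k s \<omega>)\<^sup>2) \<partial>lborel) \<partial>P x)
            = ennreal (integral\<^sup>L (P x) (\<lambda>\<omega>. (J k \<omega>)\<^sup>2))"
          unfolding J_def by (rule elementary_isometry[OF ep t])
        also have "ennreal (1 + \<epsilon>) * ennreal (integral\<^sup>L (P x) (\<lambda>\<omega>. (J k \<omega>)\<^sup>2))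
            = ennreal ((1 + \<epsilon>) * integral\<^sup>L (P x) (\<lambda>\<omega>. (J k \<omega>)\<^sup>2))"
          using that by (simp add: ennreal_mult' add_nonneg_nonneg)
        also have "\<dots> \<le> ennreal ((1 + \<epsilon>) * ((1 + \<epsilon>) * integral\<^sup>L (P x) (\<lambda>\<omega>. (I \<omega>)\<^sup>2) + (1 + 1 / \<epsilon>) * r k))"
          using that by (intro ennreal_leI mult_left_mono JI) auto
        finally show ?thesis
          by (simp add: add_right_mono)
      qed
      have "(\<lambda>k. (1 + \<epsilon>) * ((1 + \<epsilon>) * integral\<^sup>L (P x) (\<lambda>\<omega>. (I \<omega>)\<^sup>2) + (1 + 1 / \<epsilon>) * r k))
          \<longlonglongrightarrow> (1 + \<epsilon>) * ((1 + \<epsilon>) * integral\<^sup>L (P x) (\<lambda>\<omega>. (I \<omega>)\<^sup>2) + (1 + 1 / \<epsilon>) * 0)"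
        by (intro tendsto_intros r)
      then have "(\<lambda>k. ennreal ((1 + \<epsilon>) * ((1 + \<epsilon>) * integral\<^sup>L (P x) (\<lambda>\<omega>. (I \<omega>)\<^sup>2) + (1 + 1 / \<epsilon>) * r k))
          + ennreal (1 + 1 / \<epsilon>) * ?d k)
          \<longlonglongrightarrow> ennreal ((1 + \<epsilon>) * ((1 + \<epsilon>) * integral\<^sup>L (P x) (\<lambda>\<omega>. (I \<omega>)\<^sup>2) + (1 + 1 / \<epsilon>) * 0))
            + ennreal (1 + 1 / \<epsilon>) * 0"
        by (intro tendsto_add tendsto_ennrealI ennreal_tendsto_cmult d) auto
      then have "ennreal t \<le> ennreal ((1 + \<epsilon>) * ((1 + \<epsilon>) * integral\<^sup>L (P x) (\<lambda>\<omega>. (I \<omega>)\<^sup>2) + (1 + 1 / \<epsilon>) * 0))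
            + ennreal (1 + 1 / \<epsilon>) * 0"
        by (rule LIMSEQ_le_const) (use k in auto)
      then show ?thesis
        using that I20 by (simp add: ennreal_le_iff)
    qed
    have "((\<lambda>\<epsilon>. (1 + \<epsilon>) * ((1 + \<epsilon>) * integral\<^sup>L (P x) (\<lambda>\<omega>. (I \<omega>)\<^sup>2)))
        \<longlongrightarrow> (1 + 0) * ((1 + 0) * integral\<^sup>L (P x) (\<lambda>\<omega>. (I \<omega>)\<^sup>2))) (at_right 0)"
      by (intro tendsto_intros)
    then have "t \<le> (1 + 0) * ((1 + 0) * integral\<^sup>L (P x) (\<lambda>\<omega>. (I \<omega>)\<^sup>2))"
      by (rule tendsto_lowerbound) (use low in \<open>auto intro: eventually_mono[OF at0]\<close>)
    then show "t \<le> integral\<^sup>L (P x) (\<lambda>\<omega>. (I \<omega>)\<^sup>2)" by simp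
  qed

  \<comment> \<open>Mean-square convergence is L1 convergence of the squared differences, so a
    subsequence converges almost surely, as Fatou's lemma requires.\<close>
  have "(\<lambda>k. integral\<^sup>L (P x) (\<lambda>\<omega>. norm ((J k \<omega> - I \<omega>)\<^sup>2))) \<longlonglongrightarrow> 0"
    using r by (simp add: r_def[abs_def])
  then obtain q where "strict_mono q" and q: "AE \<omega> in P x. (\<lambda>k. (J (q k) \<omega> - I \<omega>)\<^sup>2) \<longlonglongrightarrow> 0"
    using tendsto_L1_AE_subseq[of "P x" "\<lambda>k \<omega>. (J k \<omega> - I \<omega>)\<^sup>2"] D2 by auto
  have "(\<integral>\<^sup>+\<omega>. ennreal (I \<omega> ^ 4) \<partial>P x) = (\<integral>\<^sup>+\<omega>. liminf (\<lambda>k. ennreal (J (q k) \<omega> ^ 4)) \<partial>P x)"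
  proof (rule nn_integral_cong_AE)
    show "AE \<omega> in P x. ennreal (I \<omega> ^ 4) = liminf (\<lambda>k. ennreal (J (q k) \<omega> ^ 4))"
      using q
    proof eventually_elim
      fix \<omega> assume "(\<lambda>k. (J (q k) \<omega> - I \<omega>)\<^sup>2) \<longlonglongrightarrow> 0"
      then have "(\<lambda>k. sqrt ((J (q k) \<omega> - I \<omega>)\<^sup>2)) \<longlonglongrightarrow> sqrt 0"
        by (rule tendsto_real_sqrt)
      then have "(\<lambda>k. J (q k) \<omega> - I \<omega>) \<longlonglongrightarrow> 0"
        by (subst (asm) real_sqrt_abs) (simp add: tendsto_rabs_zero_iff)
      then have "(\<lambda>k. J (q k) \<omega>) \<longlonglongrightarrow> I \<omega>"
        by (simp add: LIM_zero_iff)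
      then have "(\<lambda>k. ennreal (J (q k) \<omega> ^ 4)) \<longlonglongrightarrow> ennreal (I \<omega> ^ 4)"
        by (intro tendsto_ennrealI tendsto_power)
      then show "ennreal (I \<omega> ^ 4) = liminf (\<lambda>k. ennreal (J (q k) \<omega> ^ 4))"
        by (rule lim_imp_Liminf[OF trivial_limit_sequentially, symmetric])
    qed
  qed
  also have "\<dots> \<le> liminf (\<lambda>k. \<integral>\<^sup>+\<omega>. ennreal (J (q k) \<omega> ^ 4) \<partial>P x)"
    by (rule nn_integral_liminf) measurable
  also have "\<dots> \<le> liminf (\<lambda>k. ennreal (3 * t\<^sup>2))"
  proof (intro Liminf_mono always_eventually allI)
    fix k
    have "(\<integral>\<^sup>+\<omega>. ennreal (J (q k) \<omega> ^ 4) \<partial>P x) = ennreal (integral\<^sup>L (P x) (\<lambda>\<omega>. J (q k) \<omega> ^ 4))"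
      using J4 by (intro nn_integral_eq_integral) auto
    then show "(\<integral>\<^sup>+\<omega>. ennreal (J (q k) \<omega> ^ 4) \<partial>P x) \<le> ennreal (3 * t\<^sup>2)"
      using J4_le[of "q k"] by (simp add: ennreal_leI)
  qed
  also have "\<dots> = ennreal (3 * t\<^sup>2)"
    by (simp add: Liminf_const)
  finally have fin: "(\<integral>\<^sup>+\<omega>. ennreal (I \<omega> ^ 4) \<partial>P x) \<le> ennreal (3 * t\<^sup>2)" .
  show I4: "integrable (P x) (\<lambda>\<omega>. I \<omega> ^ 4)"
    using fin by (intro integrableI_bounded) (auto intro: le_less_trans)
  have "(\<integral>\<^sup>+\<omega>. ennreal (I \<omega> ^ 4) \<partial>P x) = ennreal (integral\<^sup>L (P x) (\<lambda>\<omega>. I \<omega> ^ 4))"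
    using I4 by (intro nn_integral_eq_integral) auto
  with fin show "integral\<^sup>L (P x) (\<lambda>\<omega>. I \<omega> ^ 4) \<le> 3 * t\<^sup>2"
    by (simp add: ennreal_le_iff)
qed

end

section \<open>Local time and the elastic semigroup\<close>

lemma C0_halfline_bounded:
  assumes "f \<in> C0_halfline"
  obtains K where "0 \<le> K" and "\<And>x. 0 \<le> x \<Longrightarrow> \<bar>f x\<bar> \<le> K"
proof -
  have cont: "continuous_on {0..} f" and lim: "(f \<longlongrightarrow> 0) at_top"
    using assms by (auto simp: C0_halfline_def)
  have "\<forall>\<^sub>F x in at_top. \<bar>f x\<bar> < 1"
    using tendstoD[OF lim, of 1] by simp
  then obtain X where X: "\<And>x. X \<le> x \<Longrightarrow> \<bar>f x\<bar> < 1"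
    by (auto simp: eventually_at_top_linorder)
  have "bounded (f ` {0..X})"
    by (intro compact_imp_bounded compact_continuous_image continuous_on_subset[OF cont]) auto
  then obtain K where "\<forall>y\<in>f ` {0..X}. \<bar>y\<bar> \<le> K"
    unfolding bounded_iff real_norm_def by blast
  then have K: "\<And>x. x \<in> {0..X} \<Longrightarrow> \<bar>f x\<bar> \<le> K"
    by blast
  show ?thesis
  proof (rule that[of "max K 1"])
    show "\<bar>f x\<bar> \<le> max K 1" if "0 \<le> x" for x
      using K[of x] X[of x] that by (cases "x \<le> X") auto
  qed simp
qed

lemma measurable_C0_halfline_abs:
  assumes "f \<in> C0_halfline"
  shows "(\<lambda>y. f \<bar>y\<bar>) \<in> borel_measurable borel"
proof (rule borel_measurable_continuous_onI)
  have "continuous_on {0..} f"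
    using assms by (simp add: C0_halfline_def)
  moreover have "continuous_on UNIV (\<lambda>y :: real. \<bar>y\<bar>)"
    by (intro continuous_intros)
  ultimately show "continuous_on UNIV (\<lambda>y. f \<bar>y\<bar>)"
    by (rule continuous_on_compose2) auto
qed

section \<open>The exponential law and the lifetime\<close>

context
  fixes \<beta> :: real
  assumes \<beta>: "0 < \<beta>"
begin

lemma space_exponential_law [simp]: "space (exponential_law \<beta>) = {0..}"
  by (simp add: exponential_law_def space_restrict_space)

lemma sets_exponential_law: "sets (exponential_law \<beta>) = sets (restrict_space borel {0..})"
  unfolding exponential_law_def by (intro sets_restrict_space_cong) simp

lemma emeasure_exponential_law_Ioi:
  assumes "0 \<le> l"
  shows "emeasure (exponential_law \<beta>) {l<..} = ennreal (exp (- \<beta> * l))"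
proof -
  let ?Q = "density lborel (\<lambda>s. ennreal (exponential_density \<beta> s))"
  interpret prob_space ?Q by (rule prob_space_exponential_density[OF \<beta>])
  have "distributed ?Q lborel (\<lambda>s. s) (exponential_density \<beta>)"
    by (simp add: distributed_def distr_id2)
  then have "\<P>(s in ?Q. l < s) = exp (- l * \<beta>)"
    by (rule exponential_distributedD_gt[OF _ assms \<beta>])
  moreover have "{s \<in> space ?Q. l < s} = {l<..}" by auto
  ultimately have "emeasure ?Q {l<..} = ennreal (exp (- l * \<beta>))"
    unfolding emeasure_eq_measure by simp
  moreover have "emeasure (exponential_law \<beta>) {l<..} = emeasure ?Q {l<..}"
    unfolding exponential_law_def using assms by (intro emeasure_restrict_space) auto
  ultimately show ?thesis
    by (simp add: mult.commute)
qed

text \<open>Serves twice: to add the endpoint 0 to the tail of total mass 1, and to discard the tie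
  between the exponential variable and the local time.\<close>

lemma AE_exponential_law_neq: "AE s in exponential_law \<beta>. s \<noteq> l"
proof -
  let ?Q = "density lborel (\<lambda>s. ennreal (exponential_density \<beta> s))"
  have "AE s in ?Q. s \<noteq> l"
    using AE_lborel_singleton[of l] by (subst AE_density) auto
  then show ?thesis
    unfolding exponential_law_def by (subst AE_restrict_space_iff) auto
qed

lemma prob_space_exponential_law: "prob_space (exponential_law \<beta>)"
proof
  have "emeasure (exponential_law \<beta>) {0..} = emeasure (exponential_law \<beta>) {0<..}"
  proof (rule emeasure_eq_AE)
    show "AE s in exponential_law \<beta>. s \<in> {0..} \<longleftrightarrow> s \<in> {0<..}"
      using AE_exponential_law_neq[of 0] by eventually_elim auto
  qed (auto simp: sets_exponential_law sets_restrict_space)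
  then show "emeasure (exponential_law \<beta>) (space (exponential_law \<beta>)) = 1"
    using emeasure_exponential_law_Ioi[of 0] by simp
qed

lemma measurable_ident_exponential_law: "(\<lambda>s. s) \<in> borel_measurable (exponential_law \<beta>)"
  unfolding exponential_law_def by (intro measurable_restrict_space1) simp

end

text \<open>Survival past t is expressed through countably many rational times and is thereby
  measurable; the margin \<open>1 / Suc n\<close> accounts for the strict inequality. As
  \<open>L\<close> is monotone only almost surely, a description valid on every path has to inspect
  all times up to slightly beyond t.\<close>

lemma less_elastic_lifetime_iff:
  assumes cont: "continuous_on {0..} (\<lambda>t. L t \<omega>)"
  shows "ereal t < elastic_lifetime L (\<omega>, s) \<longleftrightarrow>
    (\<exists>n. \<forall>q::rat. 0 \<le> q \<and> of_rat q < t + 1 / Suc n \<longrightarrow> L (of_rat q) \<omega> \<le> s)" (is "?l \<longleftrightarrow> ?r")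
proof
  assume ?l
  then obtain r where r: "ereal t < ereal r" "ereal r < elastic_lifetime L (\<omega>, s)"
    using ereal_dense2 by blast
  then have "0 < r - t" by simp
  then obtain n where n: "1 / Suc n < r - t"
    using nat_approx_posE by blast
  show ?r
  proof (intro exI[of _ n] allI impI, rule ccontr)
    fix q :: rat assume q: "0 \<le> q \<and> of_rat q < t + 1 / Suc n" "\<not> L (of_rat q) \<omega> \<le> s"
    then have "elastic_lifetime L (\<omega>, s) \<le> ereal (of_rat q)"
      unfolding elastic_lifetime_def by (auto intro!: Inf_lower)
    also have "\<dots> < ereal r"
      using q n by simp
    finally show False using r by simp
  qed
next
  assume ?r
  then obtain n where n: "\<And>q::rat. 0 \<le> q \<Longrightarrow> of_rat q < t + 1 / Suc n \<Longrightarrow> L (of_rat q) \<omega> \<le> s"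
    by auto
  have "ereal (t + 1 / Suc n) \<le> elastic_lifetime L (\<omega>, s)"
    unfolding elastic_lifetime_def prod.case
  proof (rule Inf_greatest, clarify, rule ccontr)
    fix u assume u: "0 \<le> u" "s < L u \<omega>" "\<not> ereal (t + 1 / Suc n) \<le> ereal u"
    have "((\<lambda>t. L t \<omega>) \<longlongrightarrow> L u \<omega>) (at u within {0..})"
      using cont u by (auto simp: continuous_on_def)
    then have "\<forall>\<^sub>F v in at u within {0..}. s < L v \<omega>"
      using u by (auto dest: order_tendstoD)
    then obtain d where d: "d > 0" "\<And>v. 0 \<le> v \<Longrightarrow> v \<noteq> u \<Longrightarrow> dist v u < d \<Longrightarrow> s < L v \<omega>"
      by (auto simp: eventually_at)
    \<comment> \<open>By continuity \<open>L\<close> still exceeds s shortly after u, so a violation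
      at a real time yields one at a rational time; choosing it to the right of u keeps it
      nonnegative.\<close>
    have "u < min (u + d) (t + 1 / Suc n)"
      using u d by simp
    then obtain q where q: "u < of_rat q" "of_rat q < min (u + d) (t + 1 / Suc n)"
      using of_rat_dense by blast
    have "0 \<le> q"
      using le_less_trans[OF u(1) q(1)] by simp
    moreover have "s < L (of_rat q) \<omega>"
      using u q \<open>0 \<le> q\<close> by (intro d) (auto simp: dist_real_def)
    ultimately show False
      using n[of q] q by simp
  qed
  moreover have "ereal t < ereal (t + 1 / Suc n)" by simp
  ultimately show ?l by (rule less_le_trans[rotated])
qed

section \<open>Local time and its joint moments with the reflected path\<close>

locale elastic_brownian_family = brownian_family M P F B \<theta>
  for M :: "'a measure" and P :: "real \<Rightarrow> 'a measure" and F :: "real \<Rightarrow> 'a measure"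
    and B :: "real \<Rightarrow> 'a \<Rightarrow> real" and \<theta> :: "real \<Rightarrow> 'a \<Rightarrow> 'a" +
  fixes L :: "real \<Rightarrow> 'a \<Rightarrow> real" and \<beta> :: real
  assumes local_time: "local_time_at_0 M P F B L" and rate_pos: "0 < \<beta>"
begin

lemma measurable_L [measurable]: "0 \<le> t \<Longrightarrow> L t \<in> borel_measurable (P x)"
  using local_time measurable_F_P unfolding local_time_at_0_def by blast

lemma AE_tanaka:
  assumes "0 \<le> x" and "0 \<le> t"
  obtains I where "has_ito_integral (P x) F B t (\<lambda>s \<omega>. sgn (B s \<omega>)) I"
    and "AE \<omega> in P x. \<bar>B t \<omega>\<bar> - x = I \<omega> + L t \<omega>"
proof -
  obtain I where I: "has_ito_integral (P x) F B t (\<lambda>s \<omega>. sgn (B s \<omega>)) I"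
    and tanaka: "AE \<omega> in P x. \<bar>B t \<omega>\<bar> = \<bar>B 0 \<omega>\<bar> + I \<omega> + L t \<omega>"
    using local_time assms(2) unfolding local_time_at_0_def by blast
  show ?thesis
  proof (rule that[OF I])
    show "AE \<omega> in P x. \<bar>B t \<omega>\<bar> - x = I \<omega> + L t \<omega>"
      using tanaka start_B[of x] by eventually_elim (use assms in simp)
  qed
qed

text \<open>The definition of local time does not state that it starts at 0. This follows from
  Tanaka's formula at time 0, where the integral has second moment 0; monotonicity does the
  rest.\<close>

lemma AE_L_nonneg:
  assumes "0 \<le> t"
  shows "AE \<omega> in P x. 0 \<le> L t \<omega>"
proof -
  interpret prob_space "P x" by (rule prob)
  obtain I where I: "has_ito_integral (P x) F B 0 (\<lambda>s \<omega>. sgn (B s \<omega>)) I"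
    and tanaka: "AE \<omega> in P x. \<bar>B 0 \<omega>\<bar> = \<bar>B 0 \<omega>\<bar> + I \<omega> + L 0 \<omega>"
    using local_time unfolding local_time_at_0_def by blast
  have [measurable]: "I \<in> borel_measurable (P x)"
    using I by (simp add: has_ito_integral_def)
  have "integrable (P x) (\<lambda>\<omega>. (I \<omega>)\<^sup>2)"
    by (rule integrable_power_of_power4[OF prob _ ito_sgn_moments(1)[OF I order_refl]]) auto
  then have "AE \<omega> in P x. (I \<omega>)\<^sup>2 = 0"
    using ito_sgn_moments(3)[OF I order_refl] by (subst (asm) integral_nonneg_eq_0_iff_AE) auto
  moreover have "AE \<omega> in P x. mono_on {0..} (\<lambda>t. L t \<omega>)"
    using local_time unfolding local_time_at_0_def by blast
  ultimately show ?thesis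
    using tanaka
  proof eventually_elim
    case (elim \<omega>)
    then have "L 0 \<omega> = 0" by simp
    then show ?case
      using mono_onD[OF elim(2), of 0 t] assms by simp
  qed
qed

text \<open>Three variables are compared: \<open>D\<close>, the Ito integral
  \<open>I = D - L t\<close>, and the increment \<open>N\<close> of B, which dominates
  \<open>D\<close> in absolute value. The moments of \<open>N\<close> are explicit and those of
  \<open>I\<close> are known, so all claims about \<open>L t\<close> follow. The powers of x before
  l and m are those that the boundary defect will later supply.\<close>

lemma local_time_moments:
  assumes x: "0 \<le> x" and t: "0 \<le> t"
  defines "D \<equiv> \<lambda>\<omega>. \<bar>B t \<omega>\<bar> - x"
    and "l \<equiv> integral\<^sup>L (P x) (L t)" and "m \<equiv> integral\<^sup>L (P x) (\<lambda>\<omega>. (L t \<omega>)\<^sup>2)"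
  shows "integrable (P x) (\<lambda>\<omega>. L t \<omega> ^ 4)" "integral\<^sup>L (P x) (\<lambda>\<omega>. L t \<omega> ^ 4) \<le> 48 * t\<^sup>2"
    and "integrable (P x) (\<lambda>\<omega>. D \<omega> ^ 4)" "integral\<^sup>L (P x) (\<lambda>\<omega>. D \<omega> ^ 4) \<le> 3 * t\<^sup>2"
    and "integrable (P x) (\<lambda>\<omega>. L t \<omega> * D \<omega>)"
    and "integral\<^sup>L (P x) D = l"
    and "integral\<^sup>L (P x) (\<lambda>\<omega>. (D \<omega>)\<^sup>2) = t - 2 * x * l"
    and "integral\<^sup>L (P x) (\<lambda>\<omega>. L t \<omega> * D \<omega>) = m / 2 - x * l"
    and "0 \<le> l" "x * l \<le> t / 2" "x ^ 3 * l \<le> 6 * t\<^sup>2"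
    and "0 \<le> m" "m \<le> 4 * t" "x\<^sup>2 * m \<le> 60 * t\<^sup>2"
proof -
  interpret prob_space "P x" by (rule prob)
  obtain I where ito: "has_ito_integral (P x) F B t (\<lambda>s \<omega>. sgn (B s \<omega>)) I"
    and tanaka: "AE \<omega> in P x. D \<omega> = I \<omega> + L t \<omega>"
    using AE_tanaka[OF x t] unfolding D_def .
  have [measurable]: "I \<in> borel_measurable (P x)"
    using ito by (simp add: has_ito_integral_def)
  note I = ito_sgn_moments[OF ito t]
  define N where "N \<omega> = B t \<omega> - B 0 \<omega>" for \<omega>
  have [measurable]: "B t \<in> borel_measurable (P x)" "B 0 \<in> borel_measurable (P x)"
    "L t \<in> borel_measurable (P x)"
    using t by auto
  have N_m [measurable]: "N \<in> borel_measurable (P x)" and D_m [measurable]: "D \<in> borel_measurable (P x)"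
    unfolding N_def D_def by measurable
  note N = increment_moments[OF order_refl t, of x, folded N_def]
  have BN: "AE \<omega> in P x. B t \<omega> = x + N \<omega>"
    using start_B[of x] by eventually_elim (simp add: N_def)
  have L0: "AE \<omega> in P x. 0 \<le> L t \<omega>"
    by (rule AE_L_nonneg[OF t])
  have DN: "AE \<omega> in P x. \<bar>D \<omega>\<bar> \<le> \<bar>N \<omega>\<bar>"
    using BN by eventually_elim (use x in \<open>simp add: D_def\<close>)
  have D4N: "AE \<omega> in P x. D \<omega> ^ 4 \<le> N \<omega> ^ 4"
    using DN by eventually_elim (metis power_mono abs_ge_zero power_even_abs even_numeral)
  show D4: "integrable (P x) (\<lambda>\<omega>. D \<omega> ^ 4)"
    by (rule Bochner_Integration.integrable_bound[OF N(1)[of 4]]) (use D4N in auto)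
  have D4': "integral\<^sup>L (P x) (\<lambda>\<omega>. D \<omega> ^ 4) \<le> integral\<^sup>L (P x) (\<lambda>\<omega>. N \<omega> ^ 4)"
    by (intro integral_mono_AE D4 N D4N)
  then show D4_le: "integral\<^sup>L (P x) (\<lambda>\<omega>. D \<omega> ^ 4) \<le> 3 * t\<^sup>2"
    using N(5) by simp
  \<comment> \<open>\<open>L t\<close> is \<open>D - I\<close>, hence 48 = 8 * (3 + 3).\<close>
  have L4_le: "AE \<omega> in P x. L t \<omega> ^ 4 \<le> 8 * (D \<omega> ^ 4 + I \<omega> ^ 4)"
    using tanaka
  proof eventually_elim
    case (elim \<omega>)
    then show ?case using add_power4_le[of "D \<omega>" "- I \<omega>"] by simp
  qed
  have DI4: "integrable (P x) (\<lambda>\<omega>. 8 * (D \<omega> ^ 4 + I \<omega> ^ 4))"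
    using D4 I(1) by simp
  show L4: "integrable (P x) (\<lambda>\<omega>. L t \<omega> ^ 4)"
    by (rule Bochner_Integration.integrable_bound[OF DI4]) (use L4_le in auto)
  have "integral\<^sup>L (P x) (\<lambda>\<omega>. L t \<omega> ^ 4) \<le> integral\<^sup>L (P x) (\<lambda>\<omega>. 8 * (D \<omega> ^ 4 + I \<omega> ^ 4))"
    by (intro integral_mono_AE L4 DI4 L4_le)
  also have "\<dots> = 8 * (integral\<^sup>L (P x) (\<lambda>\<omega>. D \<omega> ^ 4) + integral\<^sup>L (P x) (\<lambda>\<omega>. I \<omega> ^ 4))"
    using D4 I(1) by simp
  finally show "integral\<^sup>L (P x) (\<lambda>\<omega>. L t \<omega> ^ 4) \<le> 48 * t\<^sup>2"
    using D4_le I(4) by simp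
  have Dj: "integrable (P x) (\<lambda>\<omega>. D \<omega> ^ j)" and Lj: "integrable (P x) (\<lambda>\<omega>. L t \<omega> ^ j)"
    and Ij: "integrable (P x) (\<lambda>\<omega>. I \<omega> ^ j)" if "j \<le> 4" for j
    using that D4 L4 I(1) by (auto intro!: integrable_power_of_power4 prob)
  have D1: "integrable (P x) D" and L1: "integrable (P x) (L t)" and I1: "integrable (P x) I"
    using Dj[of 1] Lj[of 1] Ij[of 1] by simp_all
  have D2: "integrable (P x) (\<lambda>\<omega>. (D \<omega>)\<^sup>2)" and L2: "integrable (P x) (\<lambda>\<omega>. (L t \<omega>)\<^sup>2)"
    using Dj[of 2] Lj[of 2] by simp_all
  have N1: "integrable (P x) N" and N2: "integrable (P x) (\<lambda>\<omega>. (N \<omega>)\<^sup>2)"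
    using N(1)[of 1] N(1)[of 2] by simp_all
  show LD: "integrable (P x) (\<lambda>\<omega>. L t \<omega> * D \<omega>)"
  proof (rule Bochner_Integration.integrable_bound)
    show "integrable (P x) (\<lambda>\<omega>. (L t \<omega>)\<^sup>2 + (D \<omega>)\<^sup>2)"
      using L2 D2 by simp
    have "\<bar>a * b\<bar> \<le> a\<^sup>2 + b\<^sup>2" for a b :: real
    proof -
      have "\<bar>a * b\<bar> \<le> 2 * \<bar>a\<bar> * \<bar>b\<bar>"
        by (simp add: abs_mult)
      also have "\<dots> \<le> a\<^sup>2 + b\<^sup>2"
        using sum_squares_bound[of "\<bar>a\<bar>" "\<bar>b\<bar>"] by simp
      finally show ?thesis .
    qed
    then show "AE \<omega> in P x. norm (L t \<omega> * D \<omega>) \<le> norm ((L t \<omega>)\<^sup>2 + (D \<omega>)\<^sup>2)"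
      by (intro AE_I2) simp
  qed measurable
  have "integral\<^sup>L (P x) D = integral\<^sup>L (P x) (\<lambda>\<omega>. I \<omega> + L t \<omega>)"
    using tanaka by (intro integral_cong_AE) auto
  then show ED: "integral\<^sup>L (P x) D = l"
    using I1 L1 I(2) by (simp add: l_def)
  \<comment> \<open>Squaring removes the absolute value: D^2 = B_t^2 - 2 x D - x^2, and B_t = x + N
    almost surely.\<close>
  have "integral\<^sup>L (P x) (\<lambda>\<omega>. (D \<omega>)\<^sup>2) = integral\<^sup>L (P x) (\<lambda>\<omega>. 2 * x * N \<omega> + (N \<omega>)\<^sup>2 - 2 * x * D \<omega>)"
  proof (intro integral_cong_AE)
    show "AE \<omega> in P x. (D \<omega>)\<^sup>2 = 2 * x * N \<omega> + (N \<omega>)\<^sup>2 - 2 * x * D \<omega>"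
      using BN
    proof eventually_elim
      case (elim \<omega>)
      have "(D \<omega>)\<^sup>2 = (B t \<omega>)\<^sup>2 - 2 * x * D \<omega> - x\<^sup>2"
        by (simp add: D_def power2_eq_square algebra_simps)
      then show ?case
        by (simp add: elim power2_eq_square algebra_simps)
    qed
  qed measurable
  also have "\<dots> = 2 * x * integral\<^sup>L (P x) N + integral\<^sup>L (P x) (\<lambda>\<omega>. (N \<omega>)\<^sup>2) - 2 * x * integral\<^sup>L (P x) D"
    using N1 N2 D1 by simp
  finally show ED2: "integral\<^sup>L (P x) (\<lambda>\<omega>. (D \<omega>)\<^sup>2) = t - 2 * x * l"
    using N(2,3) ED by simp
  have "integral\<^sup>L (P x) (\<lambda>\<omega>. (I \<omega>)\<^sup>2)
      = integral\<^sup>L (P x) (\<lambda>\<omega>. (D \<omega>)\<^sup>2 + (L t \<omega>)\<^sup>2 - 2 * (L t \<omega> * D \<omega>))"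
  proof (intro integral_cong_AE)
    show "AE \<omega> in P x. (I \<omega>)\<^sup>2 = (D \<omega>)\<^sup>2 + (L t \<omega>)\<^sup>2 - 2 * (L t \<omega> * D \<omega>)"
      using tanaka by eventually_elim (simp add: power2_eq_square algebra_simps)
  qed measurable
  also have "\<dots> = t - 2 * x * l + m - 2 * integral\<^sup>L (P x) (\<lambda>\<omega>. L t \<omega> * D \<omega>)"
    using D2 L2 LD ED2 by (simp add: m_def)
  finally show ELD: "integral\<^sup>L (P x) (\<lambda>\<omega>. L t \<omega> * D \<omega>) = m / 2 - x * l"
    using I(3) by (simp add: field_simps)
  show l0: "0 \<le> l"
    unfolding l_def by (rule integral_nonneg_AE) (rule L0)
  have "0 \<le> integral\<^sup>L (P x) (\<lambda>\<omega>. (D \<omega>)\<^sup>2)"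
    by (rule integral_nonneg_AE) simp
  then show xl: "x * l \<le> t / 2"
    using ED2 by simp
  \<comment> \<open>\<open>D - N\<close> is twice the negative part of x + N: it vanishes unless the
    path ends below 0, and then x is at most \<open>- N\<close>. Its mean is l because
    \<open>N\<close> is centred, and 6 = 2 * 3.\<close>
  have "integral\<^sup>L (P x) (\<lambda>\<omega>. x ^ 3 * (D \<omega> - N \<omega>)) \<le> integral\<^sup>L (P x) (\<lambda>\<omega>. 2 * N \<omega> ^ 4)"
  proof (rule integral_mono_AE)
    show "AE \<omega> in P x. x ^ 3 * (D \<omega> - N \<omega>) \<le> 2 * N \<omega> ^ 4"
      using BN
    proof eventually_elim
      case (elim \<omega>)
      show ?case
      proof (cases "0 \<le> x + N \<omega>")
        case False
        then have "x \<le> - N \<omega>" "D \<omega> - N \<omega> \<le> 2 * - N \<omega>"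
          using x by (auto simp: D_def elim)
        then have "x ^ 3 * (D \<omega> - N \<omega>) \<le> (- N \<omega>) ^ 3 * (2 * - N \<omega>)"
          using x False by (intro mult_mono power_mono) (auto simp: D_def elim)
        then show ?thesis
          by (simp add: power4_eq_xxxx power3_eq_cube algebra_simps)
      qed (simp add: D_def elim)
    qed
  qed (use D1 N1 N(1)[of 4] in auto)
  also have "integral\<^sup>L (P x) (\<lambda>\<omega>. x ^ 3 * (D \<omega> - N \<omega>)) = x ^ 3 * l"
    using D1 N1 N(2) ED by simp
  finally show x3l: "x ^ 3 * l \<le> 6 * t\<^sup>2"
    using N(5) by simp
  show m0: "0 \<le> m"
    unfolding m_def by (rule integral_nonneg_AE) simp
  \<comment> \<open>Young's inequality with weights 1/2 and 2: the expectation on the left contains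
    m in full, so the half of m on the right is absorbed.\<close>
  have "integral\<^sup>L (P x) (\<lambda>\<omega>. 2 * (L t \<omega> * D \<omega>)) \<le> integral\<^sup>L (P x) (\<lambda>\<omega>. 1 / 2 * (L t \<omega>)\<^sup>2 + 2 * (D \<omega>)\<^sup>2)"
  proof (intro integral_mono)
    show "2 * (L t \<omega> * D \<omega>) \<le> 1 / 2 * (L t \<omega>)\<^sup>2 + 2 * (D \<omega>)\<^sup>2" for \<omega>
      using zero_le_power2[of "L t \<omega> - 2 * D \<omega>"] by (simp add: power2_eq_square algebra_simps)
  qed (use LD L2 D2 in auto)
  then have "2 * (m / 2 - x * l) \<le> 1 / 2 * m + 2 * (t - 2 * x * l)"
    using LD L2 D2 ELD ED2 by (simp add: m_def)
  then show "m \<le> 4 * t"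
    using mult_nonneg_nonneg[OF x l0] by (simp only: algebra_simps)
  \<comment> \<open>The same absorption with weight x^2. Where |D| is at most x the product is
    bounded through x^3 L_t, elsewhere x^2 is at most D^2. This gives 60 = 8 * 6 + 4 * 3.\<close>
  have "integral\<^sup>L (P x) (\<lambda>\<omega>. 2 * x\<^sup>2 * (L t \<omega> * D \<omega>))
      \<le> integral\<^sup>L (P x) (\<lambda>\<omega>. 2 * x ^ 3 * L t \<omega> + (1 / 2 * x\<^sup>2 * (L t \<omega>)\<^sup>2 + 2 * D \<omega> ^ 4))"
  proof (rule integral_mono_AE)
    show "AE \<omega> in P x. 2 * x\<^sup>2 * (L t \<omega> * D \<omega>)
        \<le> 2 * x ^ 3 * L t \<omega> + (1 / 2 * x\<^sup>2 * (L t \<omega>)\<^sup>2 + 2 * D \<omega> ^ 4)"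
      using L0
    proof eventually_elim
      case (elim \<omega>)
      show ?case
      proof (cases "\<bar>D \<omega>\<bar> \<le> x")
        case True
        then have "2 * x\<^sup>2 * (L t \<omega> * D \<omega>) \<le> 2 * x\<^sup>2 * (L t \<omega> * x)"
          using elim by (intro mult_left_mono) auto
        also have "\<dots> = 2 * x ^ 3 * L t \<omega>"
          by (simp add: power2_eq_square power3_eq_cube)
        finally show ?thesis by (simp add: add_increasing2)
      next
        case False
        then have "x\<^sup>2 * (2 * (D \<omega>)\<^sup>2) \<le> (D \<omega>)\<^sup>2 * (2 * (D \<omega>)\<^sup>2)"
          using x by (intro mult_right_mono) (auto simp: abs_le_square_iff[symmetric])
        moreover have "x\<^sup>2 * (2 * (L t \<omega> * D \<omega>)) \<le> x\<^sup>2 * (1 / 2 * (L t \<omega>)\<^sup>2 + 2 * (D \<omega>)\<^sup>2)"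
          using zero_le_power2[of "L t \<omega> - 2 * D \<omega>"]
          by (intro mult_left_mono) (auto simp: power2_eq_square algebra_simps)
        ultimately have "2 * x\<^sup>2 * (L t \<omega> * D \<omega>) \<le> 1 / 2 * x\<^sup>2 * (L t \<omega>)\<^sup>2 + 2 * D \<omega> ^ 4"
          by (simp add: power4_eq_xxxx power2_eq_square algebra_simps)
        moreover have "0 \<le> 2 * x ^ 3 * L t \<omega>" using x elim by simp
        ultimately show ?thesis by linarith
      qed
    qed
  qed (use LD L1 L2 D4 in auto)
  then have "2 * x\<^sup>2 * (m / 2 - x * l) \<le> 2 * x ^ 3 * l + (1 / 2 * x\<^sup>2 * m + 2 * integral\<^sup>L (P x) (\<lambda>\<omega>. D \<omega> ^ 4))"
    using LD L1 L2 D4 ELD by (simp add: m_def l_def)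
  then have "x\<^sup>2 * m \<le> 8 * (x ^ 3 * l) + 4 * integral\<^sup>L (P x) (\<lambda>\<omega>. D \<omega> ^ 4)"
    by (simp add: power2_eq_square power3_eq_cube algebra_simps)
  then show "x\<^sup>2 * m \<le> 60 * t\<^sup>2"
    using x3l D4_le by simp
qed

section \<open>The elastic semigroup as an expectation over Brownian paths\<close>

lemma measurable_elastic_bm:
  assumes f: "f \<in> C0_halfline" and t: "0 \<le> t"
  shows "(\<lambda>p. extend_cemetery f (elastic_bm B L t p)) \<in> borel_measurable (elastic_measure P \<beta> x)"
proof -
  let ?Q = "P x \<Otimes>\<^sub>M exponential_law \<beta>"
  define A where "A = (\<lambda>p :: 'a \<times> real. \<exists>n. \<forall>q::rat. 0 \<le> q \<and> of_rat q < t + 1 / Suc n \<longrightarrow> L (of_rat q) (fst p) \<le> snd p)"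
  have snd_m: "(\<lambda>p. snd p) \<in> borel_measurable ?Q"
    by (rule measurable_compose[OF measurable_snd measurable_ident_exponential_law[OF rate_pos]])
  have "Measurable.pred ?Q (\<lambda>p. 0 \<le> q \<and> of_rat q < t + 1 / Suc n \<longrightarrow> L (of_rat q) (fst p) \<le> snd p)"
    for q :: rat and n
  proof (cases "0 \<le> q")
    case True
    then have "(\<lambda>p. L (of_rat q) (fst p)) \<in> borel_measurable ?Q"
      by (intro measurable_compose[OF measurable_fst measurable_L]) simp
    with snd_m show ?thesis by measurable
  qed simp
  then have A_m: "Measurable.pred ?Q A"
    unfolding A_def by measurable
  have f_m: "(\<lambda>p. f \<bar>B t (fst p)\<bar>) \<in> borel_measurable ?Q"
    by (rule measurable_compose[OF measurable_compose[OF measurable_fst measurable_B[OF t]]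
          measurable_C0_halfline_abs[OF f]])
  have "extend_cemetery f (elastic_bm B L t p) = (if A p then f \<bar>B t (fst p)\<bar> else 0)"
    if "p \<in> space ?Q" for p
  proof -
    obtain \<omega> s where p: "p = (\<omega>, s)" by (cases p)
    with that have "\<omega> \<in> space M" by (simp add: space_pair_measure space_P)
    then have "continuous_on {0..} (\<lambda>t. L t \<omega>)"
      using local_time by (simp add: local_time_at_0_def)
    from less_elastic_lifetime_iff[where L=L, OF this, of t s]
    have "ereal t < elastic_lifetime L p \<longleftrightarrow> A p"
      by (simp only: p A_def fst_conv snd_conv)
    then show ?thesis
      by (simp add: elastic_bm_def extend_cemetery_def)
  qed
  moreover have "(\<lambda>p. if A p then f \<bar>B t (fst p)\<bar> else 0) \<in> borel_measurable ?Q"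
    using A_m f_m by measurable
  ultimately show ?thesis
    unfolding elastic_measure_def by (simp cong: measurable_cong)
qed

text \<open>On a fixed path the process is alive at t if S > L_t and dead if S < L_t, and S > L_t
  has probability exp (- \<beta> L_t). In the case S = L_t the outcome depends on whether L grows
  immediately after t, but a single value carries no mass.\<close>

lemma elastic_semigroup_eq:
  assumes f: "f \<in> C0_halfline" and t: "0 \<le> t"
  shows "elastic_semigroup P B L \<beta> t f x = (\<integral>\<omega>. exp (- \<beta> * L t \<omega>) * f \<bar>B t \<omega>\<bar> \<partial>P x)"
    and "integrable (P x) (\<lambda>\<omega>. exp (- \<beta> * L t \<omega>) * f \<bar>B t \<omega>\<bar>)"
proof -
  interpret Q: prob_space "P x" by (rule prob)
  interpret E: prob_space "exponential_law \<beta>" by (rule prob_space_exponential_law[OF rate_pos])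
  interpret QE: pair_prob_space "P x" "exponential_law \<beta>" ..
  let ?X = "\<lambda>p. extend_cemetery f (elastic_bm B L t p)"
  obtain K where "0 \<le> K" and K: "\<And>x. 0 \<le> x \<Longrightarrow> \<bar>f x\<bar> \<le> K"
    using C0_halfline_bounded[OF f] by blast
  have X_m: "?X \<in> borel_measurable (P x \<Otimes>\<^sub>M exponential_law \<beta>)"
    using measurable_elastic_bm[OF f t] by (simp add: elastic_measure_def)
  have "integrable (P x \<Otimes>\<^sub>M exponential_law \<beta>) ?X"
  proof (rule QE.P.integrable_const_bound)
    show "AE p in P x \<Otimes>\<^sub>M exponential_law \<beta>. norm (?X p) \<le> K"
      using K \<open>0 \<le> K\<close> by (intro AE_I2) (simp add: extend_cemetery_def elastic_bm_def)
  qed (rule X_m)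
  then have "elastic_semigroup P B L \<beta> t f x
      = (\<integral>\<omega>. (\<integral>s. ?X (\<omega>, s) \<partial>exponential_law \<beta>) \<partial>P x)"
    unfolding elastic_semigroup_def elastic_measure_def by (rule QE.integral_fst'[symmetric])
  also have "\<dots> = (\<integral>\<omega>. exp (- \<beta> * L t \<omega>) * f \<bar>B t \<omega>\<bar> \<partial>P x)"
  proof (rule integral_cong_AE)
    show "(\<lambda>\<omega>. \<integral>s. ?X (\<omega>, s) \<partial>exponential_law \<beta>) \<in> borel_measurable (P x)"
      using X_m by measurable
    show "(\<lambda>\<omega>. exp (- \<beta> * L t \<omega>) * f \<bar>B t \<omega>\<bar>) \<in> borel_measurable (P x)"
      using measurable_compose[OF measurable_B[OF t] measurable_C0_halfline_abs[OF f]] t by simp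
    have "AE \<omega> in P x. mono_on {0..} (\<lambda>t. L t \<omega>)"
      using local_time by (simp add: local_time_at_0_def)
    with AE_L_nonneg[OF t, of x] AE_space
    show "AE \<omega> in P x. (\<integral>s. ?X (\<omega>, s) \<partial>exponential_law \<beta>) = exp (- \<beta> * L t \<omega>) * f \<bar>B t \<omega>\<bar>"
    proof eventually_elim
      case (elim \<omega>)
      let ?l = "L t \<omega>"
      have cont: "continuous_on {0..} (\<lambda>t. L t \<omega>)"
        using local_time elim by (simp add: local_time_at_0_def space_P)
      have alive: "ereal t < elastic_lifetime L (\<omega>, s)" if "?l < s" for s
      proof -
        have "((\<lambda>t. L t \<omega>) \<longlongrightarrow> ?l) (at t within {0..})"
          using cont t by (auto simp: continuous_on_def)
        then have "\<forall>\<^sub>F v in at t within {0..}. L v \<omega> < s"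
          using that by (rule order_tendstoD)
        then obtain d where d: "d > 0" "\<And>v. 0 \<le> v \<Longrightarrow> v \<noteq> t \<Longrightarrow> dist v t < d \<Longrightarrow> L v \<omega> < s"
          by (auto simp: eventually_at)
        \<comment> \<open>The lifetime has to lie strictly beyond t. Continuity keeps
          \<open>L\<close> below s at time \<open>t + d / 2\<close>, and monotonicity extends this
          to all earlier times.\<close>
        have "ereal (t + d / 2) \<le> elastic_lifetime L (\<omega>, s)"
          unfolding elastic_lifetime_def prod.case
        proof (rule Inf_greatest, clarify, rule ccontr)
          fix u assume u: "0 \<le> u" "s < L u \<omega>" "\<not> ereal (t + d / 2) \<le> ereal u"
          then have "L u \<omega> \<le> L (t + d / 2) \<omega>"
            using mono_onD[OF elim(3), of u "t + d / 2"] t d(1) by simp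
          also have "\<dots> < s"
            using t d(1) by (intro d(2)) (auto simp: dist_real_def)
          finally show False using u by simp
        qed
        moreover have "ereal t < ereal (t + d / 2)" using d(1) by simp
        ultimately show ?thesis by (rule less_le_trans[rotated])
      qed
      have dead: "\<not> ereal t < elastic_lifetime L (\<omega>, s)" if "s < ?l" for s
        unfolding elastic_lifetime_def using that t by (auto simp: not_less intro!: Inf_lower)
      have "(\<integral>s. ?X (\<omega>, s) \<partial>exponential_law \<beta>)
          = (\<integral>s. indicator {?l<..} s * f \<bar>B t \<omega>\<bar> \<partial>exponential_law \<beta>)"
      proof (rule integral_cong_AE)
        show "(\<lambda>s. ?X (\<omega>, s)) \<in> borel_measurable (exponential_law \<beta>)"
          using X_m elim by measurable
        show "(\<lambda>s. indicator {?l<..} s * f \<bar>B t \<omega>\<bar>) \<in> borel_measurable (exponential_law \<beta>)"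
          using measurable_ident_exponential_law[OF rate_pos] by measurable
        show "AE s in exponential_law \<beta>. ?X (\<omega>, s) = indicator {?l<..} s * f \<bar>B t \<omega>\<bar>"
          using AE_exponential_law_neq[OF rate_pos, of ?l]
        proof eventually_elim
          fix s assume "s \<noteq> ?l"
          then show "?X (\<omega>, s) = indicator {?l<..} s * f \<bar>B t \<omega>\<bar>"
            using alive[of s] dead[of s]
            by (cases "s < ?l") (auto simp: elastic_bm_def extend_cemetery_def)
        qed
      qed
      also have "\<dots> = measure (exponential_law \<beta>) {?l<..} * f \<bar>B t \<omega>\<bar>"
      proof -
        have "{?l<..} \<in> sets (exponential_law \<beta>)"
          using elim by (auto simp: sets_exponential_law[OF rate_pos] sets_restrict_space)
        then show ?thesis by simp
      qed
      also have "measure (exponential_law \<beta>) {?l<..} = exp (- \<beta> * ?l)"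
        using emeasure_exponential_law_Ioi[OF rate_pos, of ?l] elim
        by (simp add: measure_def)
      finally show ?case .
    qed
  qed
  finally show "elastic_semigroup P B L \<beta> t f x = (\<integral>\<omega>. exp (- \<beta> * L t \<omega>) * f \<bar>B t \<omega>\<bar> \<partial>P x)" .
  show "integrable (P x) (\<lambda>\<omega>. exp (- \<beta> * L t \<omega>) * f \<bar>B t \<omega>\<bar>)"
  proof (rule Q.integrable_const_bound)
    show "AE \<omega> in P x. norm (exp (- \<beta> * L t \<omega>) * f \<bar>B t \<omega>\<bar>) \<le> K"
      using AE_L_nonneg[OF t]
    proof eventually_elim
      case (elim \<omega>)
      then have "exp (- \<beta> * L t \<omega>) \<le> 1" using rate_pos by simp
      then have "exp (- \<beta> * L t \<omega>) * \<bar>f \<bar>B t \<omega>\<bar>\<bar> \<le> 1 * K"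
        using K[of "\<bar>B t \<omega>\<bar>"] by (intro mult_mono) auto
      then show ?case by (simp add: abs_mult)
    qed
    show "(\<lambda>\<omega>. exp (- \<beta> * L t \<omega>) * f \<bar>B t \<omega>\<bar>) \<in> borel_measurable (P x)"
      using measurable_compose[OF measurable_B[OF t] measurable_C0_halfline_abs[OF f]] t by simp
  qed
qed

text \<open>The sub-Markov property. The sign condition on m enters because the killed part
  contributes 0, which must not exceed m.\<close>

lemma elastic_semigroup_le:
  assumes f: "f \<in> C0_halfline" and t: "0 \<le> t" and "0 \<le> m" and le: "\<And>y. 0 \<le> y \<Longrightarrow> f y \<le> m"
  shows "elastic_semigroup P B L \<beta> t f x \<le> m"
proof -
  interpret Q: prob_space "P x" by (rule prob)
  have "(\<integral>\<omega>. exp (- \<beta> * L t \<omega>) * f \<bar>B t \<omega>\<bar> \<partial>P x) \<le> (\<integral>\<omega>. m \<partial>P x)"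
  proof (rule integral_mono_AE)
    show "AE \<omega> in P x. exp (- \<beta> * L t \<omega>) * f \<bar>B t \<omega>\<bar> \<le> m"
      using AE_L_nonneg[OF t]
    proof eventually_elim
      case (elim \<omega>)
      have "exp (- \<beta> * L t \<omega>) * f \<bar>B t \<omega>\<bar> \<le> exp (- \<beta> * L t \<omega>) * m"
        by (intro mult_left_mono le) auto
      also have "\<dots> \<le> m"
        using elim rate_pos \<open>0 \<le> m\<close> by (intro mult_left_le_one_le) auto
      finally show ?case .
    qed
  qed (use elastic_semigroup_eq(2)[OF f t] in auto)
  then show ?thesis
    using elastic_semigroup_eq(1)[OF f t] by (simp add: Q.prob_space)
qed

end

section \<open>Functions satisfying the Robin boundary condition\<close>

text \<open>The modulus of continuity takes the form \<epsilon> plus a quadratic term because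
  expectations will be taken and only moments are known. Near points are handled by uniform
  continuity; for distant ones the trivial bound 2 K is charged to the quadratic term.\<close>

lemma C0_halfline_modulus:
  assumes h: "h \<in> C0_halfline" and "0 < \<epsilon>"
  obtains C where "0 \<le> C"
    and "\<And>x y. 0 \<le> x \<Longrightarrow> 0 \<le> y \<Longrightarrow> \<bar>h y - h x\<bar> \<le> \<epsilon> + C * (y - x)\<^sup>2"
proof -
  have cont: "continuous_on {0..} h" and lim: "(h \<longlongrightarrow> 0) at_top"
    using h by (auto simp: C0_halfline_def)
  obtain K where K: "0 \<le> K" "\<And>x. 0 \<le> x \<Longrightarrow> \<bar>h x\<bar> \<le> K"
    using C0_halfline_bounded[OF h] by blast
  have "\<forall>\<^sub>F x in at_top. \<bar>h x\<bar> < \<epsilon> / 2"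
    using tendstoD[OF lim, of "\<epsilon> / 2"] \<open>0 < \<epsilon>\<close> by simp
  then obtain X where X: "\<And>x. X \<le> x \<Longrightarrow> \<bar>h x\<bar> < \<epsilon> / 2"
    by (auto simp: eventually_at_top_linorder)
  have "uniformly_continuous_on {0..X + 1} h"
    by (intro compact_uniformly_continuous continuous_on_subset[OF cont]) auto
  then obtain d where d: "0 < d"
    "\<And>x y. x \<in> {0..X + 1} \<Longrightarrow> y \<in> {0..X + 1} \<Longrightarrow> dist y x < d \<Longrightarrow> dist (h y) (h x) < \<epsilon>"
    using \<open>0 < \<epsilon>\<close> unfolding uniformly_continuous_on_def by metis
  \<comment> \<open>Two points closer than 1 lie either both in \<open>{0..X + 1}\<close> or both
    beyond X, where the values of h are below \<epsilon> / 2.\<close>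
  define e where "e = min d 1"
  have e: "0 < e" "e \<le> d" "e \<le> 1" using d by (auto simp: e_def)
  show ?thesis
  proof (rule that[of "2 * K / e\<^sup>2"])
    show "0 \<le> 2 * K / e\<^sup>2" using K by simp
    fix x y :: real assume xy: "0 \<le> x" "0 \<le> y"
    show "\<bar>h y - h x\<bar> \<le> \<epsilon> + 2 * K / e\<^sup>2 * (y - x)\<^sup>2"
    proof (cases "\<bar>y - x\<bar> < e")
      case True
      have "\<bar>h y - h x\<bar> \<le> \<epsilon>"
      proof (cases "x \<le> X + 1 \<and> y \<le> X + 1")
        case in_compact: True
        then have "dist (h y) (h x) < \<epsilon>"
          using xy True e by (intro d(2)) (auto simp: dist_real_def)
        then show ?thesis by (simp add: dist_real_def)
      next
        case False
        then have "X \<le> x" "X \<le> y" using True e by auto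
        then show ?thesis using X[of x] X[of y] by linarith
      qed
      moreover have "0 \<le> 2 * K / e\<^sup>2 * (y - x)\<^sup>2" using K by simp
      ultimately show ?thesis by linarith
    next
      case False
      then have "e\<^sup>2 \<le> (y - x)\<^sup>2"
        using e by (simp add: abs_le_square_iff[symmetric])
      then have "1 \<le> (y - x)\<^sup>2 / e\<^sup>2" using e by simp
      then have "2 * K * 1 \<le> 2 * K * ((y - x)\<^sup>2 / e\<^sup>2)"
        using K by (intro mult_left_mono) auto
      moreover have "\<bar>h y - h x\<bar> \<le> 2 * K"
        using K(2)[OF xy(1)] K(2)[OF xy(2)] by linarith
      ultimately show ?thesis using \<open>0 < \<epsilon>\<close> by simp
    qed
  qed
qed

lemma at_within_halfline: "0 < x \<Longrightarrow> at x within {0..} = at (x :: real)"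
  by (rule at_within_open_subset[of _ "{0<..}"]) auto

text \<open>L'Hospital's rule for the difference quotient at 0. It carries the derivatives, which
  \<open>C02_halfline\<close> provides only on the open half-line, to the endpoint.\<close>

lemma has_derivative_at_0_of_limit:
  fixes f g :: "real \<Rightarrow> real"
  assumes cont: "continuous_on {0..} f"
    and der: "\<And>x. 0 < x \<Longrightarrow> (f has_real_derivative g x) (at x)"
    and lim: "(g \<longlongrightarrow> g0) (at_right 0)"
  shows "(f has_real_derivative g0) (at 0 within {0..})"
proof -
  have pos: "\<forall>\<^sub>F x in at_right 0. 0 < (x :: real)"
    by (auto simp: eventually_at_filter)
  have "((\<lambda>x. (f x - f 0) / x) \<longlongrightarrow> g0) (at_right 0)"
  proof (rule lhopital_right[where f'=g and g'="\<lambda>_. 1"])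
    have "(f \<longlongrightarrow> f 0) (at 0 within {0..})"
      using cont by (auto simp: continuous_on_def)
    then have "(f \<longlongrightarrow> f 0) (at_right 0)"
      by (simp add: at_within_Ici_at_right)
    then show "((\<lambda>x. f x - f 0) \<longlongrightarrow> 0) (at_right 0)"
      by (simp add: LIM_zero)
    show "\<forall>\<^sub>F x in at_right 0. ((\<lambda>x. f x - f 0) has_real_derivative g x) (at x)"
      using pos by eventually_elim (auto intro!: derivative_eq_intros der)
    show "\<forall>\<^sub>F x in at_right 0. (x :: real) \<noteq> 0"
      using pos by eventually_elim simp
  qed (use lim in auto)
  then show ?thesis
    by (simp add: has_field_derivative_iff at_within_Ici_at_right)
qed

text \<open>Taylor's formula on [-z, 0], where all derivatives of exp are at most 1, so the
  constants do not depend on z.\<close>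

lemma exp_minus_expansions:
  fixes z :: real
  assumes "0 \<le> z"
  shows "\<bar>exp (- z) - 1\<bar> \<le> z"
    and "\<bar>exp (- z) - (1 - z)\<bar> \<le> z\<^sup>2"
    and "\<bar>exp (- z) - (1 - z + z\<^sup>2 / 2)\<bar> \<le> z ^ 3"
proof -
  have T: "\<bar>exp (- z) - (\<Sum>i\<le>n. (- z) ^ i / fact i)\<bar> \<le> z ^ Suc n / fact n" for n
  proof -
    have "norm (exp (- z) - (\<Sum>i\<le>n. exp 0 * (- z - 0) ^ i / fact i)) \<le> 1 * norm (- z - 0) ^ Suc n / fact n"
      by (rule field_Taylor[where S="{- z..0}" and f="\<lambda>_. exp"])
        (use assms in \<open>auto intro: DERIV_subset[OF DERIV_exp]\<close>)
    then show ?thesis using assms by simp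
  qed
  show "\<bar>exp (- z) - 1\<bar> \<le> z" "\<bar>exp (- z) - (1 - z)\<bar> \<le> z\<^sup>2"
    using T[of 0] T[of 1] assms by (simp_all add: power2_eq_square)
  have "\<bar>exp (- z) - (1 - z + z\<^sup>2 / 2)\<bar> \<le> z ^ 3 / 2"
    using T[of 2] assms by (simp add: numeral_2_eq_2 power3_eq_cube power2_eq_square algebra_simps)
  also have "\<dots> \<le> z ^ 3" using assms by simp
  finally show "\<bar>exp (- z) - (1 - z + z\<^sup>2 / 2)\<bar> \<le> z ^ 3" .
qed

text \<open>\<open>p\<close> and \<open>h\<close> are f' and f'' with their one-sided values at 0.
  They are explicit functions because \<open>deriv f\<close> at 0 would depend on the arbitrary
  values of f at negative arguments.\<close>

locale robin_function =
  fixes \<beta> :: real and f p h :: "real \<Rightarrow> real"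
  assumes rate: "0 < \<beta>" and f: "f \<in> C0_halfline" and h: "h \<in> C0_halfline"
    and deriv_f: "\<And>x. 0 \<le> x \<Longrightarrow> (f has_real_derivative p x) (at x within {0..})"
    and deriv_p: "\<And>x. 0 \<le> x \<Longrightarrow> (p has_real_derivative h x) (at x within {0..})"
    and boundary: "p 0 = \<beta> * f 0"
begin

text \<open>Subtracting the quadratic polynomial with coefficient \<open>h x\<close> leaves a
  function that vanishes to first order at x and has second derivative \<open>h u - h x\<close>;
  hence only the oscillation of h enters.\<close>

lemma taylor_bound:
  assumes "0 \<le> x" "0 \<le> y"
    and B: "\<And>u. u \<in> closed_segment x y \<Longrightarrow> \<bar>h u - h x\<bar> \<le> K"
  shows "\<bar>f y - (f x + p x * (y - x) + h x * (y - x)\<^sup>2 / 2)\<bar> \<le> K * (y - x)\<^sup>2"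
proof -
  define \<phi> where "\<phi> i u = (if i = (0::nat) then f u - (f x + p x * (u - x) + h x * (u - x)\<^sup>2 / 2)
    else if i = 1 then p u - (p x + h x * (u - x)) else h u - h x)" for i u
  let ?S = "closed_segment x y"
  have S: "?S \<subseteq> {0..}" using assms by (auto simp: closed_segment_eq_real_ivl)
  have fS: "(f has_real_derivative p u) (at u within ?S)" "(p has_real_derivative h u) (at u within ?S)"
    if "u \<in> ?S" for u
    using that S by (auto intro: DERIV_subset[OF deriv_f] DERIV_subset[OF deriv_p])
  have "norm (\<phi> 0 y - (\<Sum>i\<le>1. \<phi> i x * (y - x) ^ i / fact i)) \<le> K * norm (y - x) ^ Suc 1 / fact 1"
  proof (rule field_Taylor[where S="?S"])
    fix i :: nat and u assume u: "u \<in> ?S" "i \<le> 1"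
    then consider "i = 0" | "i = 1" by linarith
    then show "(\<phi> i has_field_derivative \<phi> (Suc i) u) (at u within ?S)"
    proof cases
      case 1
      have "((\<lambda>u. f u - (f x + p x * (u - x) + h x * (u - x)\<^sup>2 / 2))
          has_real_derivative p u - (p x + h x * (u - x))) (at u within ?S)"
        using fS[OF u(1)] by (auto intro!: derivative_eq_intros)
      then show ?thesis by (simp add: 1 \<phi>_def[abs_def])
    next
      case 2
      have "((\<lambda>u. p u - (p x + h x * (u - x))) has_real_derivative h u - h x) (at u within ?S)"
        using fS[OF u(1)] by (auto intro!: derivative_eq_intros)
      then show ?thesis by (simp add: 2 \<phi>_def[abs_def])
    qed
  qed (use B in \<open>auto simp: \<phi>_def\<close>)
  then show ?thesis
    by (simp add: \<phi>_def power2_eq_square)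
qed

lemma taylor:
  assumes "0 < \<epsilon>"
  obtains C where "0 \<le> C" and "\<And>x y. 0 \<le> x \<Longrightarrow> 0 \<le> y \<Longrightarrow>
    \<bar>f y - (f x + p x * (y - x) + h x * (y - x)\<^sup>2 / 2)\<bar> \<le> (\<epsilon> + C * (y - x)\<^sup>2) * (y - x)\<^sup>2"
proof -
  obtain C where C: "0 \<le> C"
    "\<And>x y. 0 \<le> x \<Longrightarrow> 0 \<le> y \<Longrightarrow> \<bar>h y - h x\<bar> \<le> \<epsilon> + C * (y - x)\<^sup>2"
    using C0_halfline_modulus[OF h assms] by blast
  show ?thesis
  proof (rule that[OF C(1)])
    fix x y :: real assume xy: "0 \<le> x" "0 \<le> y"
    show "\<bar>f y - (f x + p x * (y - x) + h x * (y - x)\<^sup>2 / 2)\<bar> \<le> (\<epsilon> + C * (y - x)\<^sup>2) * (y - x)\<^sup>2"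
    proof (rule taylor_bound[OF xy])
      fix u assume u: "u \<in> closed_segment x y"
      then have "0 \<le> u" "\<bar>u - x\<bar> \<le> \<bar>y - x\<bar>"
        using xy by (auto simp: closed_segment_eq_real_ivl split: if_splits)
      then have "\<bar>h u - h x\<bar> \<le> \<epsilon> + C * (u - x)\<^sup>2" "(u - x)\<^sup>2 \<le> (y - x)\<^sup>2"
        using C(2) xy by (auto simp: abs_le_square_iff)
      then show "\<bar>h u - h x\<bar> \<le> \<epsilon> + C * (y - x)\<^sup>2"
        using mult_left_mono[of "(u - x)\<^sup>2" "(y - x)\<^sup>2" C] C(1) by linarith
    qed
  qed
qed

text \<open>An inequality of Landau type: over a step of length 1, the Taylor expansion can be
  solved for \<open>p x\<close> in terms of values of f and h, which are bounded as elements of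
  \<open>C0_halfline\<close>.\<close>

lemma derivative_bounded:
  obtains K where "0 \<le> K" and "\<And>x. 0 \<le> x \<Longrightarrow> \<bar>f x\<bar> \<le> K"
    and "\<And>x. 0 \<le> x \<Longrightarrow> \<bar>p x\<bar> \<le> K" and "\<And>x. 0 \<le> x \<Longrightarrow> \<bar>h x\<bar> \<le> K"
proof -
  obtain K1 where K1: "0 \<le> K1" "\<And>x. 0 \<le> x \<Longrightarrow> \<bar>f x\<bar> \<le> K1"
    using C0_halfline_bounded[OF f] by blast
  obtain K2 where K2: "0 \<le> K2" "\<And>x. 0 \<le> x \<Longrightarrow> \<bar>h x\<bar> \<le> K2"
    using C0_halfline_bounded[OF h] by blast
  show ?thesis
  proof (rule that[of "2 * K1 + 3 * K2"])
    fix x :: real assume x: "0 \<le> x"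
    have "\<bar>f (x + 1) - (f x + p x * (x + 1 - x) + h x * (x + 1 - x)\<^sup>2 / 2)\<bar> \<le> 2 * K2 * (x + 1 - x)\<^sup>2"
    proof (rule taylor_bound)
      fix u assume "u \<in> closed_segment x (x + 1)"
      then have "0 \<le> u" using x by (auto simp: closed_segment_eq_real_ivl)
      then show "\<bar>h u - h x\<bar> \<le> 2 * K2"
        using K2(2)[of u] K2(2)[OF x] by linarith
    qed (use x in auto)
    then have "\<bar>f (x + 1) - (f x + p x + h x / 2)\<bar> \<le> 2 * K2" by simp
    then show "\<bar>p x\<bar> \<le> 2 * K1 + 3 * K2"
      using K1(2)[of x] K1(2)[of "x + 1"] K2(2)[of x] x by linarith
    show "\<bar>f x\<bar> \<le> 2 * K1 + 3 * K2" "\<bar>h x\<bar> \<le> 2 * K1 + 3 * K2"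
      using K1(1) K1(2)[of x] K2(1) K2(2)[of x] x by linarith+
  qed (use K1 K2 in simp)
qed

text \<open>
  Below, \<open>c = f' - \<beta> f\<close> is the defect of the boundary condition; it vanishes at 0 and has
  derivative \<open>f'' - \<beta> f'\<close>.
\<close>

lemma boundary_defect_bounds:
  assumes "0 < \<epsilon>"
  obtains C where "0 \<le> C"
    and "\<And>x. 0 \<le> x \<Longrightarrow> \<bar>p x - \<beta> * f x\<bar> \<le> \<epsilon> + C * x\<^sup>2"
    and "\<And>x. 0 \<le> x \<Longrightarrow> \<bar>(p x - \<beta> * f x) - x * (h x - \<beta> * p x)\<bar> \<le> x * (\<epsilon> + C * x\<^sup>2)"
proof -
  let ?c = "\<lambda>x. p x - \<beta> * f x" and ?k = "\<lambda>x. h x - \<beta> * p x"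
  obtain K where K: "0 \<le> K" "\<And>x. 0 \<le> x \<Longrightarrow> \<bar>p x\<bar> \<le> K" "\<And>x. 0 \<le> x \<Longrightarrow> \<bar>h x\<bar> \<le> K"
    using derivative_bounded by metis
  obtain C where C: "0 \<le> C"
    "\<And>x y. 0 \<le> x \<Longrightarrow> 0 \<le> y \<Longrightarrow> \<bar>h y - h x\<bar> \<le> \<epsilon> / 2 + C * (y - x)\<^sup>2"
    using C0_halfline_modulus[OF h, of "\<epsilon> / 2"] assms by auto
  \<comment> \<open>Turns a linear bound into \<epsilon> plus a quadratic term, the shape to which
    the weighted moment bounds apply.\<close>
  have amgm: "r * a \<le> \<epsilon> / 2 + r\<^sup>2 / (2 * \<epsilon>) * a\<^sup>2" for r a :: real
  proof -
    have "0 \<le> (\<epsilon> - r * a)\<^sup>2 / (2 * \<epsilon>)" using assms by simp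
    also have "\<dots> = \<epsilon> / 2 - r * a + r\<^sup>2 / (2 * \<epsilon>) * a\<^sup>2"
      using assms by (simp add: power2_eq_square field_simps)
    finally show ?thesis by simp
  qed
  have deriv_c: "(?c has_real_derivative ?k x) (at x within {0..})" if "0 \<le> x" for x
    using deriv_f[OF that] deriv_p[OF that] by (auto intro!: derivative_eq_intros)
  define K' where "K' = K + \<beta> * K"
  have k_le: "\<bar>?k x\<bar> \<le> K'" if "0 \<le> x" for x
  proof -
    have "\<bar>\<beta> * p x\<bar> \<le> \<beta> * K"
      using K(2)[OF that] rate by (simp add: abs_mult)
    then show ?thesis
      using K(3)[OF that] unfolding K'_def by linarith
  qed
  have c_le: "\<bar>?c x\<bar> \<le> K' * x" if "0 \<le> x" for x
  proof -
    have "norm (?c x - ?c 0) \<le> K' * norm (x - 0)"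
    proof (rule field_differentiable_bound[of "{0..}" ?c ?k])
      show "\<And>z. z \<in> {0..} \<Longrightarrow> (?c has_real_derivative ?k z) (at z within {0..})"
        using deriv_c by simp
    qed (use that k_le in auto)
    then show ?thesis using that boundary by simp
  qed
  \<comment> \<open>h contributes its modulus of continuity, while p is Lipschitz because h is
    bounded; \<open>amgm\<close> brings the Lipschitz bound into the same shape.\<close>
  have k_mod: "\<bar>?k y - ?k x\<bar> \<le> \<epsilon> + (C + (\<beta> * K)\<^sup>2 / (2 * \<epsilon>)) * (y - x)\<^sup>2" if "0 \<le> x" "0 \<le> y" for x y
  proof -
    have "norm (p y - p x) \<le> K * norm (y - x)"
    proof (rule field_differentiable_bound[of "{0..}" p h])
      show "\<And>z. z \<in> {0..} \<Longrightarrow> (p has_real_derivative h z) (at z within {0..})"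
        using deriv_p by simp
    qed (use that K in auto)
    then have "\<beta> * \<bar>p y - p x\<bar> \<le> \<beta> * (K * \<bar>y - x\<bar>)"
      using rate by simp
    also have "\<dots> \<le> \<epsilon> / 2 + (\<beta> * K)\<^sup>2 / (2 * \<epsilon>) * (y - x)\<^sup>2"
      using amgm[of "\<beta> * K" "\<bar>y - x\<bar>"] by (simp add: mult.assoc)
    finally have 1: "\<beta> * \<bar>p y - p x\<bar> \<le> \<epsilon> / 2 + (\<beta> * K)\<^sup>2 / (2 * \<epsilon>) * (y - x)\<^sup>2" .
    have "?k y - ?k x = (h y - h x) - \<beta> * (p y - p x)"
      by (simp add: algebra_simps)
    then have "\<bar>?k y - ?k x\<bar> \<le> \<bar>h y - h x\<bar> + \<beta> * \<bar>p y - p x\<bar>"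
      using abs_triangle_ineq4[of "h y - h x" "\<beta> * (p y - p x)"] rate by (simp add: abs_mult)
    with 1 C(2)[OF that] show ?thesis by (simp add: algebra_simps)
  qed
  define C' where "C' = C + (\<beta> * K)\<^sup>2 / (2 * \<epsilon>) + K'\<^sup>2 / (2 * \<epsilon>)"
  have C'1: "C + (\<beta> * K)\<^sup>2 / (2 * \<epsilon>) \<le> C'" and C'2: "K'\<^sup>2 / (2 * \<epsilon>) \<le> C'" and "0 \<le> C'"
    using assms C(1) by (auto simp: C'_def)
  show ?thesis
  proof (rule that[OF \<open>0 \<le> C'\<close>])
    fix x :: real assume x: "0 \<le> x"
    have "\<bar>?c x\<bar> \<le> \<epsilon> / 2 + K'\<^sup>2 / (2 * \<epsilon>) * x\<^sup>2"
      using c_le[OF x] amgm[of K' x] by linarith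
    also have "\<dots> \<le> \<epsilon> + C' * x\<^sup>2"
      using assms by (intro add_mono mult_right_mono C'2) auto
    finally show "\<bar>?c x\<bar> \<le> \<epsilon> + C' * x\<^sup>2" .
    \<comment> \<open>The slope is frozen at x: the derivative of \<open>?\<psi>\<close> at u is the
      oscillation \<open>?k u - ?k x\<close>, and \<open>?\<psi>\<close> vanishes at 0 by the
      boundary condition.\<close>
    let ?\<psi> = "\<lambda>u. ?c u - u * ?k x"
    have "norm (?\<psi> x - ?\<psi> 0) \<le> (\<epsilon> + C' * x\<^sup>2) * norm (x - 0)"
    proof (rule field_differentiable_bound[of "{0..x}" ?\<psi> "\<lambda>u. ?k u - ?k x"])
      fix u assume u: "u \<in> {0..x}"
      have "(?c has_real_derivative ?k u) (at u within {0..x})"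
        using u by (intro DERIV_subset[OF deriv_c]) auto
      from DERIV_diff[OF this DERIV_cmult_right[OF DERIV_ident, where c="?k x"]]
      show "(?\<psi> has_real_derivative ?k u - ?k x) (at u within {0..x})"
        by simp
      have "\<bar>?k u - ?k x\<bar> \<le> \<epsilon> + (C + (\<beta> * K)\<^sup>2 / (2 * \<epsilon>)) * (u - x)\<^sup>2"
        using u x by (intro k_mod) auto
      also have "\<dots> \<le> \<epsilon> + C' * x\<^sup>2"
        using u x C'1 \<open>0 \<le> C'\<close>
        by (intro add_left_mono mult_mono) (auto simp: abs_le_square_iff[symmetric])
      finally show "norm (?k u - ?k x) \<le> \<epsilon> + C' * x\<^sup>2" by simp
    qed (use x in auto)
    then show "\<bar>?c x - x * ?k x\<bar> \<le> x * (\<epsilon> + C' * x\<^sup>2)"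
      using x boundary by (simp add: mult.commute)
  qed
qed

text \<open>A second-order Taylor expansion of exp (- \<beta> l) f y in both variables at (x, 0).
  Beyond the modulus of h the remainders are cubic, and a cubic is split between degrees 2 and 4,
  the degrees whose moments are under control.\<close>

lemma expansion:
  assumes "0 < \<epsilon>"
  obtains C where "0 \<le> C" and "\<And>x y l. 0 \<le> x \<Longrightarrow> 0 \<le> y \<Longrightarrow> 0 \<le> l \<Longrightarrow>
    \<bar>exp (- \<beta> * l) * f y - (f x + p x * (y - x) - \<beta> * f x * l + h x / 2 * (y - x)\<^sup>2
        - \<beta> * p x * (l * (y - x)) + \<beta>\<^sup>2 / 2 * f x * l\<^sup>2)\<bar>
      \<le> \<epsilon> * ((y - x)\<^sup>2 + l\<^sup>2) + C * ((y - x) ^ 4 + l ^ 4)"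
proof -
  obtain K where K: "0 \<le> K" "\<And>x. 0 \<le> x \<Longrightarrow> \<bar>f x\<bar> \<le> K" "\<And>x. 0 \<le> x \<Longrightarrow> \<bar>p x\<bar> \<le> K"
    "\<And>x. 0 \<le> x \<Longrightarrow> \<bar>h x\<bar> \<le> K"
    using derivative_bounded by metis
  obtain C where C: "0 \<le> C" "\<And>x y. 0 \<le> x \<Longrightarrow> 0 \<le> y \<Longrightarrow>
    \<bar>f y - (f x + p x * (y - x) + h x * (y - x)\<^sup>2 / 2)\<bar> \<le> (\<epsilon> / 2 + C * (y - x)\<^sup>2) * (y - x)\<^sup>2"
    using taylor[of "\<epsilon> / 2"] assms by auto
  define K' where "K' = K * \<beta> ^ 3 + K * \<beta>\<^sup>2 + K * \<beta> + 1"
  have K': "0 < K'" using K(1) rate by (auto simp: K'_def intro!: add_nonneg_pos)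
  define C' where "C' = C + 8 * (K'\<^sup>2 / \<epsilon>)"
  have C': "C \<le> C'" using assms by (simp add: C'_def)
  show ?thesis
  proof (rule that[of C'])
    show "0 \<le> C'" using C C' by simp
    fix x y l :: real assume x: "0 \<le> x" and y: "0 \<le> y" and l: "0 \<le> l"
    let ?d = "y - x" and ?e = "exp (- \<beta> * l)"
    define s where "s = \<bar>?d\<bar> + l"
    have s: "0 \<le> s" "\<bar>?d\<bar> \<le> s" "l \<le> s" using l by (auto simp: s_def)
    define R1 where "R1 = f y - (f x + p x * ?d + h x * ?d\<^sup>2 / 2)"
    define R2 where "R2 = ?e - (1 - \<beta> * l + (\<beta> * l)\<^sup>2 / 2)"
    define R3 where "R3 = ?e - (1 - \<beta> * l)"
    define R4 where "R4 = ?e - 1"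
    have z: "0 \<le> \<beta> * l" using rate l by simp
    have R1: "\<bar>R1\<bar> \<le> (\<epsilon> / 2 + C * ?d\<^sup>2) * ?d\<^sup>2"
      unfolding R1_def by (rule C(2)[OF x y])
    have R2: "\<bar>R2\<bar> \<le> (\<beta> * l) ^ 3" and R3: "\<bar>R3\<bar> \<le> (\<beta> * l)\<^sup>2" and R4: "\<bar>R4\<bar> \<le> \<beta> * l"
      using exp_minus_expansions[OF z] by (simp_all add: R2_def R3_def R4_def)
    \<comment> \<open>Each Taylor term in \<open>?d\<close> is multiplied by the exponential
      expanded to the complementary order, so every remainder other than the one with
      \<open>R1\<close> has total degree 3.\<close>
    have id: "?e * f y - (f x + p x * ?d - \<beta> * f x * l + h x / 2 * ?d\<^sup>2
        - \<beta> * p x * (l * ?d) + \<beta>\<^sup>2 / 2 * f x * l\<^sup>2)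
      = ?e * R1 + f x * R2 + p x * ?d * R3 + h x / 2 * ?d\<^sup>2 * R4"
      unfolding R1_def R2_def R3_def R4_def by (simp add: power2_eq_square field_simps)
    have e1: "\<bar>?e * R1\<bar> \<le> (\<epsilon> / 2 + C * ?d\<^sup>2) * ?d\<^sup>2"
    proof -
      have "?e \<le> 1" using z by simp
      then have "?e * \<bar>R1\<bar> \<le> 1 * \<bar>R1\<bar>" by (intro mult_right_mono) auto
      then show ?thesis using R1 by (simp add: abs_mult)
    qed
    have e2: "\<bar>f x * R2\<bar> \<le> K * \<beta> ^ 3 * s ^ 3"
    proof -
      have "\<bar>R2\<bar> \<le> \<beta> ^ 3 * s ^ 3"
        unfolding power_mult_distrib[symmetric]
        using s l rate by (intro order_trans[OF R2] power_mono mult_left_mono) auto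
      then have "\<bar>f x\<bar> * \<bar>R2\<bar> \<le> K * (\<beta> ^ 3 * s ^ 3)"
        using K(2)[OF x] K(1) by (intro mult_mono) auto
      then show ?thesis by (simp add: abs_mult mult.assoc)
    qed
    have e3: "\<bar>p x * ?d * R3\<bar> \<le> K * \<beta>\<^sup>2 * s ^ 3"
    proof -
      have "\<bar>R3\<bar> \<le> \<beta>\<^sup>2 * s\<^sup>2"
        unfolding power_mult_distrib[symmetric]
        using s l rate by (intro order_trans[OF R3] power_mono mult_left_mono) auto
      then have "\<bar>p x\<bar> * \<bar>?d\<bar> * \<bar>R3\<bar> \<le> K * s * (\<beta>\<^sup>2 * s\<^sup>2)"
        using K(3)[OF x] K(1) s by (intro mult_mono) auto
      also have "\<dots> = K * \<beta>\<^sup>2 * s ^ 3"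
        by (simp add: power2_eq_square power3_eq_cube)
      finally show ?thesis by (simp only: abs_mult)
    qed
    have e4: "\<bar>h x / 2 * ?d\<^sup>2 * R4\<bar> \<le> K * \<beta> * s ^ 3"
    proof -
      have "\<bar>R4\<bar> \<le> \<beta> * s"
        using rate by (intro order_trans[OF R4] mult_left_mono s(3)) simp
      moreover have "?d\<^sup>2 \<le> s\<^sup>2" using s by (simp add: abs_le_square_iff[symmetric])
      ultimately have "\<bar>h x\<bar> / 2 * ?d\<^sup>2 * \<bar>R4\<bar> \<le> K * s\<^sup>2 * (\<beta> * s)"
        using K(4)[OF x] K(1) s by (intro mult_mono) auto
      also have "\<dots> = K * \<beta> * s ^ 3"
        by (simp add: power2_eq_square power3_eq_cube)
      finally show ?thesis by (simp add: abs_mult del: power2_diff)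
    qed
    have s2: "s\<^sup>2 \<le> 2 * (?d\<^sup>2 + l\<^sup>2)"
      using add_square_le_weighted[of 1 "\<bar>?d\<bar>" l] by (simp add: s_def)
    have s4: "s ^ 4 \<le> 8 * (?d ^ 4 + l ^ 4)"
      using add_power4_le[of "\<bar>?d\<bar>" l] by (simp add: s_def power_even_abs)
    \<comment> \<open>Completing the square puts a factor proportional to \<epsilon> on the
      quadratic part; the large factor falls on degree 4.\<close>
    have s3: "K' * s ^ 3 \<le> \<epsilon> / 4 * s\<^sup>2 + K'\<^sup>2 / \<epsilon> * s ^ 4"
    proof -
      have "0 \<le> (\<epsilon> / 2 - K' * s)\<^sup>2 / \<epsilon> * s\<^sup>2" using assms by simp
      also have "\<dots> = \<epsilon> / 4 * s\<^sup>2 + K'\<^sup>2 / \<epsilon> * s ^ 4 - K' * s ^ 3"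
        using assms by (simp add: power2_eq_square power3_eq_cube power4_eq_xxxx field_simps)
      finally show ?thesis by simp
    qed
    have "K * \<beta> ^ 3 * s ^ 3 + K * \<beta>\<^sup>2 * s ^ 3 + K * \<beta> * s ^ 3 \<le> K' * s ^ 3"
      using s(1) by (simp add: K'_def algebra_simps)
    also have "\<dots> \<le> \<epsilon> / 4 * (2 * (?d\<^sup>2 + l\<^sup>2)) + K'\<^sup>2 / \<epsilon> * (8 * (?d ^ 4 + l ^ 4))"
      using assms by (intro order_trans[OF s3] add_mono mult_left_mono s2 s4) auto
    finally have "\<bar>?e * R1 + f x * R2 + p x * ?d * R3 + h x / 2 * ?d\<^sup>2 * R4\<bar>
        \<le> (\<epsilon> / 2 + C * ?d\<^sup>2) * ?d\<^sup>2
          + (\<epsilon> / 4 * (2 * (?d\<^sup>2 + l\<^sup>2)) + K'\<^sup>2 / \<epsilon> * (8 * (?d ^ 4 + l ^ 4)))"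
      using e1 e2 e3 e4 by linarith
    also have "\<dots> = \<epsilon> * (?d\<^sup>2 + l\<^sup>2) - \<epsilon> / 2 * l\<^sup>2 + C * ?d ^ 4 + 8 * (K'\<^sup>2 / \<epsilon>) * (?d ^ 4 + l ^ 4)"
      by (simp add: power4_eq_xxxx power2_eq_square algebra_simps)
    also have "\<dots> \<le> \<epsilon> * (?d\<^sup>2 + l\<^sup>2) + C * (?d ^ 4 + l ^ 4) + 8 * (K'\<^sup>2 / \<epsilon>) * (?d ^ 4 + l ^ 4)"
    proof -
      have "C * ?d ^ 4 \<le> C * (?d ^ 4 + l ^ 4)"
        using C(1) by (intro mult_left_mono) auto
      moreover have "0 \<le> \<epsilon> / 2 * l\<^sup>2" using assms by simp
      ultimately show ?thesis by linarith
    qed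
    also have "\<dots> = \<epsilon> * (?d\<^sup>2 + l\<^sup>2) + C' * (?d ^ 4 + l ^ 4)"
      by (simp add: C'_def algebra_simps)
    finally show "\<bar>?e * f y - (f x + p x * ?d - \<beta> * f x * l + h x / 2 * ?d\<^sup>2
        - \<beta> * p x * (l * ?d) + \<beta>\<^sup>2 / 2 * f x * l\<^sup>2)\<bar> \<le> \<epsilon> * (?d\<^sup>2 + l\<^sup>2) + C' * (?d ^ 4 + l ^ 4)"
      unfolding id .
  qed
qed

lemma derivs:
  assumes "0 < x"
  shows "(f has_real_derivative p x) (at x)" and "(p has_real_derivative h x) (at x)"
    and "(deriv f has_real_derivative h x) (at x)"
proof -
  have 1: "(f has_real_derivative p x) (at x)" "(p has_real_derivative h x) (at x)" if "0 < x" for x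
    using deriv_f[of x] deriv_p[of x] that by (simp_all add: at_within_halfline)
  then show "(f has_real_derivative p x) (at x)" "(p has_real_derivative h x) (at x)"
    using assms by auto
  have p_eq: "p y = deriv f y" if "y \<in> {0<..}" for y
    using 1(1)[of y] that by (simp add: DERIV_imp_deriv)
  show "(deriv f has_real_derivative h x) (at x)"
    by (rule has_field_derivative_transform_within_open[OF 1(2)[OF assms], of "{0<..}"])
      (use assms p_eq in auto)
qed

lemma in_C02: "f \<in> C02_halfline" and deriv_limit: "(deriv f \<longlongrightarrow> \<beta> * f 0) (at_right 0)"
proof -
  have dd: "deriv (deriv f) x = h x" if "0 < x" for x
    using derivs(3)[OF that] by (rule DERIV_imp_deriv)
  have "continuous_on {0..} h"
    using h by (simp add: C0_halfline_def)
  then have "continuous_on {0<..} h"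
    by (rule continuous_on_subset) auto
  then have "continuous_on {0<..} (deriv (deriv f))"
    by (rule continuous_on_eq) (simp add: dd)
  moreover have "f differentiable at x" "deriv f differentiable at x" if "0 < x" for x
    using derivs(1,3)[OF that] by (auto simp: real_differentiable_def)
  ultimately show "f \<in> C02_halfline"
    using f h dd unfolding C02_halfline_def by auto
  have "(p \<longlongrightarrow> p 0) (at 0 within {0..})"
    using DERIV_continuous[OF deriv_p[of 0]] by (simp add: continuous_within)
  then have "(p \<longlongrightarrow> \<beta> * f 0) (at_right 0)"
    by (simp add: at_within_Ici_at_right boundary)
  moreover have "\<forall>\<^sub>F x in at_right 0. p x = deriv f x"
    using eventually_at_right_less[of 0]
    by eventually_elim (rule DERIV_imp_deriv[OF derivs(1), symmetric])
  ultimately show "(deriv f \<longlongrightarrow> \<beta> * f 0) (at_right 0)"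
    by (rule Lim_transform_eventually)
qed

end

text \<open>At 0 the first derivative is defined to be its limit;
  \<open>has_derivative_at_0_of_limit\<close> then applies first to f and afterwards to p, giving
  one-sided derivatives up to order two.\<close>

lemma C02_halfline_imp_robin_function:
  assumes f: "f \<in> C02_halfline" and lim: "(deriv f \<longlongrightarrow> \<beta> * f 0) (at_right 0)" and "0 < \<beta>"
  obtains p h where "robin_function \<beta> f p h"
proof -
  obtain h where h: "h \<in> C0_halfline" "\<And>x. 0 < x \<Longrightarrow> h x = deriv (deriv f) x"
    and f0: "f \<in> C0_halfline"
    and diff: "\<And>x. 0 < x \<Longrightarrow> f differentiable at x" "\<And>x. 0 < x \<Longrightarrow> deriv f differentiable at x"
    using f unfolding C02_halfline_def by auto
  define p where "p x = (if x = 0 then \<beta> * f 0 else deriv f x)" for x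
  have Df: "(f has_real_derivative p x) (at x)" if "0 < x" for x
    using diff(1)[OF that] that by (auto simp: real_differentiable_def p_def DERIV_imp_deriv)
  have Ddf: "(deriv f has_real_derivative h x) (at x)" if "0 < x" for x
    using diff(2)[OF that] that by (auto simp: real_differentiable_def h(2) DERIV_imp_deriv)
  have Dp: "(p has_real_derivative h x) (at x)" if "0 < x" for x
    by (rule has_field_derivative_transform_within_open[OF Ddf[OF that], of "{0<..}"])
      (use that in \<open>auto simp: p_def\<close>)
  have p_lim: "(p \<longlongrightarrow> \<beta> * f 0) (at_right 0)"
    by (rule Lim_transform_eventually[OF lim])
      (auto simp: eventually_at_filter p_def)
  have p_cont: "continuous_on {0..} p"
    unfolding continuous_on_def
  proof
    fix x :: real assume "x \<in> {0..}"
    then consider "x = 0" | "0 < x" by fastforce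
    then show "(p \<longlongrightarrow> p x) (at x within {0..})"
    proof cases
      case 1
      then show ?thesis using p_lim by (simp add: at_within_Ici_at_right p_def)
    next
      case 2
      then show ?thesis
        using DERIV_isCont[OF Dp[OF 2]] by (simp add: at_within_halfline isCont_def)
    qed
  qed
  have "(h \<longlongrightarrow> h 0) (at 0 within {0..})"
    using h(1) by (auto simp: C0_halfline_def continuous_on_def)
  then have h_lim: "(h \<longlongrightarrow> h 0) (at_right 0)"
    by (simp add: at_within_Ici_at_right)
  have f_cont: "continuous_on {0..} f" using f0 by (simp add: C0_halfline_def)
  have "robin_function \<beta> f p h"
  proof
    fix x :: real assume "0 \<le> x"
    then consider "x = 0" | "0 < x" by fastforce
    then have "(f has_real_derivative p x) (at x within {0..})
      \<and> (p has_real_derivative h x) (at x within {0..})"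
    proof cases
      case 1
      then show ?thesis
        using has_derivative_at_0_of_limit[OF f_cont Df p_lim]
          has_derivative_at_0_of_limit[OF p_cont Dp h_lim] by (simp add: p_def)
    next
      case 2
      then show ?thesis
        using Df Dp by (simp add: at_within_halfline)
    qed
    then show "(f has_real_derivative p x) (at x within {0..})"
      and "(p has_real_derivative h x) (at x within {0..})"
      by blast+
  qed (use assms f0 h in \<open>auto simp: p_def\<close>)
  then show ?thesis by (rule that)
qed

section \<open>The generator\<close>

lemma antiderivative_halfline:
  fixes g :: "real \<Rightarrow> real"
  assumes g: "continuous_on {0..} g" and x: "0 \<le> x"
  shows "((\<lambda>x. integral {0..x} g) has_real_derivative g x) (at x within {0..})"
proof -
  have "((\<lambda>x. integral {0..x} g) has_real_derivative g x) (at x within {0..x + 1})"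
    using x by (intro integral_has_real_derivative continuous_on_subset[OF g]) auto
  moreover have "at x within {0..x + 1} = at x within {0..}"
    using x by (intro at_within_nhd[of _ "{..<x + 1}"]) auto
  ultimately show ?thesis by simp
qed

text \<open>The bound is uniform in y. It therefore yields both the convergence of the improper
  integral and, with K the supremum of |q| beyond x, the decay of its tail.\<close>

lemma integral_exp_weighted_le:
  fixes q :: "real \<Rightarrow> real"
  assumes q: "continuous_on {0..} q" and "0 \<le> x" "x \<le> y"
    and le: "\<And>u. x \<le> u \<Longrightarrow> \<bar>q u\<bar> \<le> K" and "0 \<le> K"
  shows "\<bar>integral {0..y} (\<lambda>u. exp (- u) * q u) - integral {0..x} (\<lambda>u. exp (- u) * q u)\<bar> \<le> K * exp (- x)"
proof -
  let ?g = "\<lambda>u. exp (- u) * q u"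
  have g: "continuous_on {0..} ?g"
    by (intro continuous_intros q)
  have int: "?g integrable_on {a..b}" if "0 \<le> a" for a b
    using that by (intro integrable_continuous_real continuous_on_subset[OF g]) auto
  have FTC: "((\<lambda>u. K * exp (- u)) has_integral (- K * exp (- y)) - (- K * exp (- x))) {x..y}"
    using assms(3)
    by (intro fundamental_theorem_of_calculus)
      (auto simp flip: has_real_derivative_iff_has_vector_derivative intro!: derivative_eq_intros)
  have "integral {0..x} ?g + integral {x..y} ?g = integral {0..y} ?g"
    using assms by (intro Henstock_Kurzweil_Integration.integral_combine int) auto
  then have "\<bar>integral {0..y} ?g - integral {0..x} ?g\<bar> = norm (integral {x..y} ?g)"
    by simp
  also have "\<dots> \<le> integral {x..y} (\<lambda>u. K * exp (- u))"
  proof (rule Henstock_Kurzweil_Integration.integral_norm_bound_integral)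
    show "?g integrable_on {x..y}" using assms by (intro int)
    show "(\<lambda>u. K * exp (- u)) integrable_on {x..y}" using FTC by blast
    show "norm (?g u) \<le> K * exp (- u)" if "u \<in> {x..y}" for u
      using le[of u] that by (simp add: abs_mult mult.commute)
  qed
  also have "\<dots> = K * exp (- x) - K * exp (- y)"
    using integral_unique[OF FTC] by linarith
  also have "\<dots> \<le> K * exp (- x)"
    using \<open>0 \<le> K\<close> by simp
  finally show ?thesis .
qed

text \<open>
  Variation of constants for \<open>f - f'' = q\<close>: half the sum of
  \<open>a x = exp (- x) * \<integral>\<^sub>0\<^sup>x exp u * q u du\<close> and \<open>b x = exp x * \<integral>\<^sub>x\<^sup>\<infinity> exp (- u) * q u du\<close> is a particular
  solution in \<open>C\<^sub>0\<close>, and a multiple of \<open>exp (- x)\<close> adjusts the boundary condition.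
\<close>

lemma resolvent_solution:
  assumes q: "q \<in> C0_halfline" and "0 < \<beta>"
  obtains f p where "robin_function \<beta> f p (\<lambda>x. f x - q x)"
proof -
  have q_cont: "continuous_on {0..} q" and q_lim: "(q \<longlongrightarrow> 0) at_top"
    using q by (auto simp: C0_halfline_def)
  obtain K where K: "0 \<le> K" "\<And>x. 0 \<le> x \<Longrightarrow> \<bar>q x\<bar> \<le> K"
    using C0_halfline_bounded[OF q] by blast
  define A where "A x = integral {0..x} (\<lambda>u. exp u * q u)" for x
  define G where "G x = integral {0..x} (\<lambda>u. exp (- u) * q u)" for x
  have dA: "(A has_real_derivative exp x * q x) (at x within {0..})" if "0 \<le> x" for x
    unfolding A_def by (rule antiderivative_halfline[OF _ that]) (intro continuous_intros q_cont)
  have dG: "(G has_real_derivative exp (- x) * q x) (at x within {0..})" if "0 \<le> x" for x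
    unfolding G_def by (rule antiderivative_halfline[OF _ that]) (intro continuous_intros q_cont)
  have G_le: "\<bar>G y - G x\<bar> \<le> k * exp (- x)"
    if "0 \<le> x" "x \<le> y" "\<And>u. x \<le> u \<Longrightarrow> \<bar>q u\<bar> \<le> k" "0 \<le> k" for x y k
    unfolding G_def using that by (rule integral_exp_weighted_le[OF q_cont])
  have exp0: "((\<lambda>x :: real. exp (- x)) \<longlongrightarrow> 0) at_top"
    using exp_at_bot filterlim_uminus_at_bot_at_top by (rule filterlim_compose)
  \<comment> \<open>J will be the integral of \<open>exp (- u) * q u\<close> over the half-line,
    obtained along the integers; \<open>J_le\<close> then controls the tail from every real
    x.\<close>
  have "Cauchy (\<lambda>n. G (real n))"
  proof (rule metric_CauchyI)
    fix e :: real assume "0 < e"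
    have "((\<lambda>x. K * exp (- x)) \<longlongrightarrow> K * 0) at_top"
      by (intro tendsto_intros exp0)
    then have "\<forall>\<^sub>F x in at_top. K * exp (- x) < e / 2"
      using \<open>0 < e\<close> by (intro order_tendstoD(2)) auto
    then obtain X where X: "\<And>x. X \<le> x \<Longrightarrow> K * exp (- x) < e / 2"
      by (auto simp: eventually_at_top_linorder)
    obtain N where N: "X \<le> real N" using real_arch_simple by blast
    have "\<bar>G (real n) - G (real N)\<bar> < e / 2" if "N \<le> n" for n
      using G_le[of "real N" "real n" K] K that X[OF N] by fastforce
    then have "dist (G (real m)) (G (real n)) < e" if "N \<le> m" "N \<le> n" for m n
      using that unfolding dist_real_def by (smt (verit) field_sum_of_halves)
    then show "\<exists>N. \<forall>m\<ge>N. \<forall>n\<ge>N. dist (G (real m)) (G (real n)) < e" by blast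
  qed
  then obtain J where J: "(\<lambda>n. G (real n)) \<longlonglongrightarrow> J"
    using Cauchy_convergent unfolding convergent_def by blast
  have J_le: "\<bar>J - G x\<bar> \<le> k * exp (- x)"
    if "0 \<le> x" "\<And>u. x \<le> u \<Longrightarrow> \<bar>q u\<bar> \<le> k" "0 \<le> k" for x k
  proof (rule LIMSEQ_le_const2)
    show "(\<lambda>n. \<bar>G (real n) - G x\<bar>) \<longlonglongrightarrow> \<bar>J - G x\<bar>"
      by (intro tendsto_intros J)
    obtain N where N: "x \<le> real N" using real_arch_simple by blast
    show "\<exists>N. \<forall>n\<ge>N. \<bar>G (real n) - G x\<bar> \<le> k * exp (- x)"
      using that N by (intro exI[of _ N] allI impI G_le) auto
  qed
  define a where "a x = exp (- x) * A x" for x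
  define b where "b x = exp x * (J - G x)" for x
  have da: "(a has_real_derivative q x - a x) (at x within {0..})" if "0 \<le> x" for x
  proof -
    have "((\<lambda>x. exp (- x) * A x) has_real_derivative - exp (- x) * A x + (exp x * q x) * exp (- x))
        (at x within {0..})"
      by (intro DERIV_mult dA that) (auto intro!: derivative_eq_intros)
    moreover have "- exp (- x) * A x + (exp x * q x) * exp (- x) = q x - a x"
      by (simp add: a_def exp_minus)
    ultimately have "((\<lambda>x. exp (- x) * A x) has_real_derivative q x - a x) (at x within {0..})"
      by (simp only:)
    moreover have "a = (\<lambda>x. exp (- x) * A x)" by (simp add: a_def fun_eq_iff)
    ultimately show ?thesis by (simp only:)
  qed
  have db: "(b has_real_derivative b x - q x) (at x within {0..})" if "0 \<le> x" for x
  proof -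
    have "((\<lambda>x. exp x * (J - G x)) has_real_derivative exp x * (J - G x) + (0 - exp (- x) * q x) * exp x)
        (at x within {0..})"
      by (intro DERIV_mult DERIV_diff DERIV_const dG that) (auto intro!: derivative_eq_intros)
    moreover have "exp x * (J - G x) + (0 - exp (- x) * q x) * exp x = b x - q x"
      by (simp add: b_def exp_minus)
    ultimately have "((\<lambda>x. exp x * (J - G x)) has_real_derivative b x - q x) (at x within {0..})"
      by (simp only:)
    moreover have "b = (\<lambda>x. exp x * (J - G x))" by (simp add: b_def fun_eq_iff)
    ultimately show ?thesis by (simp only:)
  qed
  have a_lim: "(a \<longlongrightarrow> 0) at_top"
  proof -
    have pos: "\<forall>\<^sub>F x in at_top. 0 < (x :: real)" by (rule eventually_gt_at_top)
    \<comment> \<open>By L'Hospital's rule with a denominator tending to infinity; the quotient of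
      the derivatives is q itself.\<close>
    have "((\<lambda>x. A x / exp x) \<longlongrightarrow> 0) at_top"
    proof (rule lhospital_at_top_at_top[where f'="\<lambda>x. exp x * q x" and g'=exp])
      show "\<forall>\<^sub>F x in at_top. (A has_real_derivative exp x * q x) (at x)"
        using pos
      proof eventually_elim
        case (elim x)
        then show ?case using dA[of x] by (simp add: at_within_halfline)
      qed
    qed (use q_lim exp_at_top in auto)
    then show ?thesis
      by (simp add: a_def[abs_def] exp_minus divide_inverse mult.commute)
  qed
  have b_lim: "(b \<longlongrightarrow> 0) at_top"
  proof (rule tendstoI)
    fix e :: real assume "0 < e"
    have "\<forall>\<^sub>F x in at_top. \<bar>q x\<bar> < e / 2"
      using tendstoD[OF q_lim, of "e / 2"] \<open>0 < e\<close> by simp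
    then obtain X where X: "\<And>x. X \<le> x \<Longrightarrow> \<bar>q x\<bar> < e / 2"
      by (auto simp: eventually_at_top_linorder)
    show "\<forall>\<^sub>F x in at_top. dist (b x) 0 < e"
      using eventually_ge_at_top[of "max X 0"]
    proof eventually_elim
      fix x assume x: "max X 0 \<le> x"
      have "\<bar>J - G x\<bar> \<le> e / 2 * exp (- x)"
        using x \<open>0 < e\<close> less_imp_le[OF X] by (intro J_le) auto
      then have "exp x * \<bar>J - G x\<bar> \<le> exp x * (e / 2 * exp (- x))"
        by simp
      also have "\<dots> = e / 2" by (simp add: exp_minus)
      finally show "dist (b x) 0 < e"
        using \<open>0 < e\<close> by (simp add: b_def abs_mult)
    qed
  qed
  \<comment> \<open>Since \<open>a 0 = 0\<close> and \<open>b 0 = J\<close>, \<open>f 0\<close> will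
    be J / 2 + C and \<open>p 0\<close> will be J / 2 - C; this C solves
    \<open>p 0 = \<beta> * f 0\<close>.\<close>
  define C where "C = J / 2 * (1 - \<beta>) / (1 + \<beta>)"
  define f where "f x = (a x + b x) / 2 + C * exp (- x)" for x
  define p where "p x = (b x - a x) / 2 - C * exp (- x)" for x
  have df: "(f has_real_derivative p x) (at x within {0..})" if "0 \<le> x" for x
    unfolding f_def[abs_def] p_def
    using da[OF that] db[OF that] by (auto intro!: derivative_eq_intros simp: field_simps)
  have dp: "(p has_real_derivative f x - q x) (at x within {0..})" if "0 \<le> x" for x
    unfolding p_def[abs_def] f_def
    using da[OF that] db[OF that] by (auto intro!: derivative_eq_intros simp: field_simps)
  have "continuous_on {0..} f"
    using df by (auto simp: continuous_on_eq_continuous_within intro: DERIV_continuous)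
  moreover have "(f \<longlongrightarrow> (0 + 0) / 2 + C * 0) at_top"
    unfolding f_def[abs_def] by (intro tendsto_intros a_lim b_lim exp0) simp
  ultimately have f: "f \<in> C0_halfline"
    by (simp add: C0_halfline_def)
  have h: "(\<lambda>x. f x - q x) \<in> C0_halfline"
    using f q tendsto_diff[of f 0 at_top q 0]
    by (auto simp: C0_halfline_def intro: continuous_on_diff)
  have "a 0 = 0" "b 0 = J" by (simp_all add: a_def b_def A_def G_def)
  then have "p 0 = \<beta> * f 0"
    using \<open>0 < \<beta>\<close> by (simp add: p_def f_def C_def field_simps)
  then have "robin_function \<beta> f p (\<lambda>x. f x - q x)"
    using df dp f h \<open>0 < \<beta>\<close> by unfold_locales auto
  then show ?thesis by (rule that)
qed

section \<open>Identification of the domain\<close>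

context elastic_brownian_family
begin

text \<open>
  The increment of \<open>f\<close> is expanded to second order around \<open>(x, 0)\<close> in \<open>|B\<^sub>t|\<close> and \<open>L\<^sub>t\<close>. By
  \<open>local_time_moments\<close> the expected quadratic polynomial equals \<open>f x + t f'' x / 2\<close> up to multiples of
  the boundary defect that are \<open>o t\<close> uniformly in \<open>x\<close>.
\<close>

lemma semigroup_increment_bound:
  assumes "robin_function \<beta> f p h" and \<epsilon>: "0 < \<epsilon>"
  obtains C where "0 \<le> C" and "\<And>t x. 0 \<le> t \<Longrightarrow> 0 \<le> x \<Longrightarrow>
    \<bar>elastic_semigroup P B L \<beta> t f x - f x - t * (h x / 2)\<bar> \<le> (6 + 2 * \<beta>) * \<epsilon> * t + C * t\<^sup>2"
proof -
  interpret R: robin_function \<beta> f p h by fact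
  obtain C1 where C1: "0 \<le> C1" "\<And>x y l. 0 \<le> x \<Longrightarrow> 0 \<le> y \<Longrightarrow> 0 \<le> l \<Longrightarrow>
    \<bar>exp (- \<beta> * l) * f y - (f x + p x * (y - x) - \<beta> * f x * l + h x / 2 * (y - x)\<^sup>2
        - \<beta> * p x * (l * (y - x)) + \<beta>\<^sup>2 / 2 * f x * l\<^sup>2)\<bar>
      \<le> \<epsilon> * ((y - x)\<^sup>2 + l\<^sup>2) + C1 * ((y - x) ^ 4 + l ^ 4)"
    using R.expansion[OF \<epsilon>] by blast
  obtain C2 where C2: "0 \<le> C2" "\<And>x. 0 \<le> x \<Longrightarrow> \<bar>p x - \<beta> * f x\<bar> \<le> \<epsilon> + C2 * x\<^sup>2"
    "\<And>x. 0 \<le> x \<Longrightarrow> \<bar>(p x - \<beta> * f x) - x * (h x - \<beta> * p x)\<bar> \<le> x * (\<epsilon> + C2 * x\<^sup>2)"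
    using R.boundary_defect_bounds[OF \<epsilon>] by blast
  \<comment> \<open>51 = 3 + 48 from the fourth moments of \<open>D\<close> and \<open>L t\<close>,
    6 from the bound on x^3 l, and 30 \<beta> is \<beta> / 2 times the bound 60 on x^2 m. Likewise 6
    + 2 \<beta> collects 5 + 1 + 2 \<beta>.\<close>
  define C where "C = 51 * C1 + 6 * C2 + 30 * \<beta> * C2"
  show ?thesis
  proof (rule that[of C])
    show "0 \<le> C" using C1(1) C2(1) rate_pos by (simp add: C_def)
    fix t x :: real assume t: "0 \<le> t" and x: "0 \<le> x"
    interpret Q: prob_space "P x" by (rule prob)
    define D where "D \<omega> = \<bar>B t \<omega>\<bar> - x" for \<omega>
    define l where "l = integral\<^sup>L (P x) (L t)"
    define m where "m = integral\<^sup>L (P x) (\<lambda>\<omega>. (L t \<omega>)\<^sup>2)"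
    note mom = local_time_moments[OF x t, folded D_def l_def m_def]
    have [measurable]: "L t \<in> borel_measurable (P x)" "B t \<in> borel_measurable (P x)"
      using t by auto
    have D_m: "D \<in> borel_measurable (P x)" unfolding D_def by measurable
    have Lj: "integrable (P x) (\<lambda>\<omega>. L t \<omega> ^ j)" and Dj: "integrable (P x) (\<lambda>\<omega>. D \<omega> ^ j)"
      if "j \<le> 4" for j
      using that mom(1,3) D_m by (auto intro!: integrable_power_of_power4 prob)
    have int: "integrable (P x) (L t)" "integrable (P x) (\<lambda>\<omega>. (L t \<omega>)\<^sup>2)" "integrable (P x) D"
      "integrable (P x) (\<lambda>\<omega>. (D \<omega>)\<^sup>2)"
      using Lj[of 1] Lj[of 2] Dj[of 1] Dj[of 2] by simp_all
    let ?e = "\<lambda>\<omega>. exp (- \<beta> * L t \<omega>) * f \<bar>B t \<omega>\<bar>"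
    define T where "T \<omega> = f x + p x * D \<omega> - \<beta> * f x * L t \<omega> + h x / 2 * (D \<omega>)\<^sup>2
        - \<beta> * p x * (L t \<omega> * D \<omega>) + \<beta>\<^sup>2 / 2 * f x * (L t \<omega>)\<^sup>2" for \<omega>
    let ?R = "\<lambda>\<omega>. \<epsilon> * ((D \<omega>)\<^sup>2 + (L t \<omega>)\<^sup>2) + C1 * (D \<omega> ^ 4 + L t \<omega> ^ 4)"
    have e_int: "integrable (P x) ?e" by (rule elastic_semigroup_eq(2)[OF R.f t])
    have T_int: "integrable (P x) T" unfolding T_def using int mom(5) by simp
    have R_int: "integrable (P x) ?R" using int mom(1,3) by simp
    have "AE \<omega> in P x. \<bar>?e \<omega> - T \<omega>\<bar> \<le> ?R \<omega>"
      using AE_L_nonneg[OF t]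
    proof eventually_elim
      case (elim \<omega>)
      show ?case
        using C1(2)[OF x abs_ge_zero[of "B t \<omega>"] elim] by (simp add: T_def D_def)
    qed
    then have "\<bar>integral\<^sup>L (P x) (\<lambda>\<omega>. ?e \<omega> - T \<omega>)\<bar> \<le> integral\<^sup>L (P x) ?R"
      using e_int T_int R_int
      by (intro order_trans[OF integral_abs_bound] integral_mono_AE) auto
    also have "integral\<^sup>L (P x) ?R = \<epsilon> * (t - 2 * x * l + m)
        + C1 * (integral\<^sup>L (P x) (\<lambda>\<omega>. D \<omega> ^ 4) + integral\<^sup>L (P x) (\<lambda>\<omega>. L t \<omega> ^ 4))"
      using int mom(1,3,7) by (simp add: m_def)
    also have "\<dots> \<le> \<epsilon> * (5 * t) + C1 * (3 * t\<^sup>2 + 48 * t\<^sup>2)"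
    proof (intro add_mono mult_left_mono mom)
      show "t - 2 * x * l + m \<le> 5 * t"
        using mom(13) mult_nonneg_nonneg[OF x mom(9)] by simp
    qed (use \<epsilon> C1 in auto)
    finally have 1: "\<bar>integral\<^sup>L (P x) (\<lambda>\<omega>. ?e \<omega> - T \<omega>)\<bar> \<le> 5 * \<epsilon> * t + 51 * C1 * t\<^sup>2"
      by simp
    let ?c = "p x - \<beta> * f x" and ?k = "h x - \<beta> * p x"
    have ET: "integral\<^sup>L (P x) T = f x + p x * l - \<beta> * f x * l + h x / 2 * (t - 2 * x * l)
        - \<beta> * p x * (m / 2 - x * l) + \<beta>\<^sup>2 / 2 * f x * m"
      unfolding T_def using int mom(5) mom(6-8) by (simp add: m_def l_def Q.prob_space)
    \<comment> \<open>The terms with x l coming from E D^2 and E (L_t D) join those with l;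
      \<open>?k\<close> is the derivative of \<open>?c\<close>.\<close>
    have T_eq: "integral\<^sup>L (P x) T = f x + t * (h x / 2) + l * (?c - x * ?k) - \<beta> / 2 * m * ?c"
      unfolding ET by (simp add: power2_eq_square field_simps)
    have 2: "\<bar>l * (?c - x * ?k)\<bar> \<le> \<epsilon> * t + 6 * C2 * t\<^sup>2"
    proof -
      have "\<bar>l * (?c - x * ?k)\<bar> \<le> l * (x * (\<epsilon> + C2 * x\<^sup>2))"
        using mom(9) C2(3)[OF x] by (simp add: abs_mult mult_left_mono)
      also have "\<dots> = \<epsilon> * (x * l) + C2 * (x ^ 3 * l)"
        by (simp add: power2_eq_square power3_eq_cube algebra_simps)
      also have "\<dots> \<le> \<epsilon> * (t / 2) + C2 * (6 * t\<^sup>2)"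
        using \<epsilon> C2(1) by (intro add_mono mult_left_mono mom) auto
      also have "\<dots> \<le> \<epsilon> * t + 6 * C2 * t\<^sup>2"
        using \<epsilon> t by simp
      finally show ?thesis .
    qed
    have 3: "\<bar>\<beta> / 2 * m * ?c\<bar> \<le> 2 * \<beta> * \<epsilon> * t + 30 * \<beta> * C2 * t\<^sup>2"
    proof -
      have "\<bar>\<beta> / 2 * m * ?c\<bar> \<le> \<beta> / 2 * m * (\<epsilon> + C2 * x\<^sup>2)"
        using mom(12) rate_pos C2(2)[OF x] by (simp add: abs_mult mult_left_mono)
      also have "\<dots> = \<beta> / 2 * \<epsilon> * m + \<beta> / 2 * C2 * (x\<^sup>2 * m)"
        by (simp add: algebra_simps)
      also have "\<dots> \<le> \<beta> / 2 * \<epsilon> * (4 * t) + \<beta> / 2 * C2 * (60 * t\<^sup>2)"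
        using \<epsilon> C2(1) rate_pos by (intro add_mono mult_left_mono mom) auto
      finally show ?thesis by (simp add: algebra_simps)
    qed
    have "elastic_semigroup P B L \<beta> t f x - f x - t * (h x / 2)
        = integral\<^sup>L (P x) (\<lambda>\<omega>. ?e \<omega> - T \<omega>) + l * (?c - x * ?k) - \<beta> / 2 * m * ?c"
      using elastic_semigroup_eq(1)[OF R.f t, of x] e_int T_int T_eq by simp
    then have "\<bar>elastic_semigroup P B L \<beta> t f x - f x - t * (h x / 2)\<bar>
      \<le> (5 * \<epsilon> * t + 51 * C1 * t\<^sup>2) + (\<epsilon> * t + 6 * C2 * t\<^sup>2) + (2 * \<beta> * \<epsilon> * t + 30 * \<beta> * C2 * t\<^sup>2)"
      using 1 2 3 by linarith
    also have "\<dots> = (6 + 2 * \<beta>) * \<epsilon> * t + C * t\<^sup>2"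
      by (simp add: C_def algebra_simps)
    finally show "\<bar>elastic_semigroup P B L \<beta> t f x - f x - t * (h x / 2)\<bar>
        \<le> (6 + 2 * \<beta>) * \<epsilon> * t + C * t\<^sup>2" .
  qed
qed

text \<open>After division by t the increment bound is (6 + 2 \<beta>) \<epsilon> + C t, in which x
  does not occur; hence the convergence is uniform.\<close>

lemma robin_function_in_generator:
  assumes R: "robin_function \<beta> f p h"
  shows "(f, \<lambda>x. h x / 2) \<in> C0_generator (elastic_semigroup P B L \<beta>)"
proof -
  interpret R: robin_function \<beta> f p h by fact
  have "(\<lambda>x. h x / 2) \<in> C0_halfline"
    using R.h tendsto_divide[of h 0 at_top "\<lambda>_. 2" 2]
    by (auto simp: C0_halfline_def intro!: continuous_intros)
  moreover have "uniform_limit {0..} (\<lambda>t x. (elastic_semigroup P B L \<beta> t f x - f x) / t)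
      (\<lambda>x. h x / 2) (at_right 0)"
  proof (rule uniform_limitI)
    fix e :: real assume "0 < e"
    define \<epsilon> where "\<epsilon> = e / (2 * (6 + 2 * \<beta>))"
    have \<epsilon>: "0 < \<epsilon>" "(6 + 2 * \<beta>) * \<epsilon> = e / 2"
      using \<open>0 < e\<close> rate_pos by (auto simp: \<epsilon>_def field_simps add_pos_pos)
    obtain C where C: "0 \<le> C" "\<And>t x. 0 \<le> t \<Longrightarrow> 0 \<le> x \<Longrightarrow>
      \<bar>elastic_semigroup P B L \<beta> t f x - f x - t * (h x / 2)\<bar> \<le> (6 + 2 * \<beta>) * \<epsilon> * t + C * t\<^sup>2"
      using semigroup_increment_bound[OF R \<epsilon>(1)] by blast
    have "((\<lambda>t. C * t) \<longlongrightarrow> C * 0) (at_right 0)"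
      by (intro tendsto_intros)
    then have "\<forall>\<^sub>F t in at_right 0. C * t < e / 2"
      using \<open>0 < e\<close> by (intro order_tendstoD(2)) auto
    then show "\<forall>\<^sub>F t in at_right 0. \<forall>x\<in>{0..}.
        dist ((elastic_semigroup P B L \<beta> t f x - f x) / t) (h x / 2) < e"
      using eventually_at_right_less[of 0]
    proof eventually_elim
      case (elim t)
      show ?case
      proof
        fix x :: real assume "x \<in> {0..}"
        then have x: "0 \<le> x" by simp
        let ?u = "elastic_semigroup P B L \<beta> t f x - f x"
        have "?u / t - h x / 2 = (?u - t * (h x / 2)) / t"
          using elim(2) by (simp add: field_simps)
        then have "dist (?u / t) (h x / 2) = \<bar>?u - t * (h x / 2)\<bar> / t"
          using elim(2) by (simp add: dist_real_def)
        also have "\<dots> \<le> (e / 2 * t + C * t\<^sup>2) / t"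
          using C(2)[of t x] x elim(2) unfolding \<epsilon>(2) by (intro divide_right_mono) auto
        also have "\<dots> = e / 2 + C * t"
          using elim(2) by (simp add: power2_eq_square field_simps)
        also have "\<dots> < e" using elim(1) by simp
        finally show "dist (?u / t) (h x / 2) < e" .
      qed
    qed
  qed
  ultimately show ?thesis
    using R.f by (simp add: C0_generator_def)
qed

text \<open>Positive maximum principle: at a maximum of \<open>f - f'\<close> the generator is nonpositive.\<close>

lemma generator_resolvent_le:
  assumes g: "(f, g) \<in> C0_generator (elastic_semigroup P B L \<beta>)"
    and g': "(f', g') \<in> C0_generator (elastic_semigroup P B L \<beta>)"
    and eq: "\<And>x. 0 \<le> x \<Longrightarrow> f x / 2 - g x = f' x / 2 - g' x" and "0 \<le> x"
  shows "f x \<le> f' x"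
proof (rule ccontr)
  let ?U = "elastic_semigroup P B L \<beta>"
  assume "\<not> f x \<le> f' x"
  define d where "d y = f y - f' y" for y
  have dx: "0 < d x" using \<open>\<not> f x \<le> f' x\<close> by (simp add: d_def)
  have f: "f \<in> C0_halfline" and f': "f' \<in> C0_halfline"
    using g g' by (auto simp: C0_generator_def)
  then have d: "d \<in> C0_halfline"
    using tendsto_diff[of f 0 at_top f' 0]
    by (auto simp: C0_halfline_def d_def[abs_def] intro: continuous_on_diff)
  then have cont: "continuous_on {0..} d" and lim: "(d \<longlongrightarrow> 0) at_top"
    by (auto simp: C0_halfline_def)
  \<comment> \<open>As d vanishes at infinity and is positive at x, its supremum over the half-line
    is attained on a compact interval that contains x.\<close>
  have "\<forall>\<^sub>F y in at_top. d y < d x"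
    using lim dx by (rule order_tendstoD)
  then obtain X where X: "\<And>y. X \<le> y \<Longrightarrow> d y < d x"
    by (auto simp: eventually_at_top_linorder)
  have "x \<in> {0..X}" using X[of x] \<open>0 \<le> x\<close> by fastforce
  have "continuous_on {0..X} d"
    by (rule continuous_on_subset[OF cont]) auto
  then have "\<exists>z\<in>{0..X}. \<forall>y\<in>{0..X}. d y \<le> d z"
    using \<open>x \<in> {0..X}\<close> by (intro continuous_attains_sup) auto
  then obtain z where z: "z \<in> {0..X}" "\<And>y. y \<in> {0..X} \<Longrightarrow> d y \<le> d z"
    by blast
  have max: "d y \<le> d z" if "0 \<le> y" for y
    using z(2)[of y] z(2)[OF \<open>x \<in> {0..X}\<close>] X[of y] that by (cases "y \<le> X") auto
  have "0 < d z" using dx max[OF \<open>0 \<le> x\<close>] by simp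
  have z0: "0 \<le> z" using z by simp
  have "((\<lambda>t. (?U t f z - f z) / t) \<longlongrightarrow> g z) (at_right 0)"
    "((\<lambda>t. (?U t f' z - f' z) / t) \<longlongrightarrow> g' z) (at_right 0)"
    using g g' z0 by (auto simp: C0_generator_def intro: tendsto_uniform_limitI)
  then have "((\<lambda>t. (?U t f z - f z) / t - (?U t f' z - f' z) / t) \<longlongrightarrow> g z - g' z) (at_right 0)"
    by (rule tendsto_diff)
  \<comment> \<open>Averaging and killing cannot raise a positive maximum: U_t d is at most d at z,
    and U_t is linear.\<close>
  moreover have "\<forall>\<^sub>F t in at_right 0. (?U t f z - f z) / t - (?U t f' z - f' z) / t \<le> 0"
    using eventually_at_right_less[of 0]
  proof eventually_elim
    case (elim t)
    then have t: "0 \<le> t" by simp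
    have "?U t d z \<le> d z"
      using \<open>0 < d z\<close> max by (intro elastic_semigroup_le[OF d t]) auto
    moreover have "?U t d z = ?U t f z - ?U t f' z"
      using elastic_semigroup_eq(2)[OF f t] elastic_semigroup_eq(2)[OF f' t]
      unfolding elastic_semigroup_eq(1)[OF d t] elastic_semigroup_eq(1)[OF f t]
        elastic_semigroup_eq(1)[OF f' t]
      by (subst Bochner_Integration.integral_diff[symmetric]) (simp_all add: d_def right_diff_distrib)
    ultimately have "(?U t f z - f z) - (?U t f' z - f' z) \<le> 0"
      by (simp add: d_def)
    then show ?case
      using elim by (simp add: diff_divide_distrib[symmetric] divide_nonpos_pos)
  qed
  ultimately have "g z - g' z \<le> 0"
    by (rule tendsto_upperbound) simp
  moreover have "g z - g' z = d z / 2"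
    using eq[OF z0] by (simp add: d_def field_simps)
  ultimately show False using \<open>0 < d z\<close> by simp
qed

end

text \<open>Injectivity identifies a domain element with the explicit solution on the closed
  half-line only, so the properties have to be carried over to the given representative.\<close>

lemma robin_function_cong:
  assumes "robin_function \<beta> f p h" and eq: "\<And>x. 0 \<le> x \<Longrightarrow> f x = f' x"
  shows "robin_function \<beta> f' p h"
proof -
  interpret robin_function \<beta> f p h by fact
  have "continuous_on {0..} f'"
    using f eq by (auto simp: C0_halfline_def intro: continuous_on_eq)
  moreover have "(f' \<longlongrightarrow> 0) at_top"
  proof (rule Lim_transform_eventually)
    show "(f \<longlongrightarrow> 0) at_top" using f by (simp add: C0_halfline_def)
    show "\<forall>\<^sub>F x in at_top. f x = f' x"
      using eventually_ge_at_top[of 0] by eventually_elim (rule eq)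
  qed
  moreover have "(f' has_real_derivative p x) (at x within {0..})" if "0 \<le> x" for x
    using deriv_f[OF that] by (rule has_field_derivative_transform_within[where d=1]) (use that eq in auto)
  ultimately show ?thesis
    using rate h deriv_p boundary eq[of 0] by unfold_locales (auto simp: C0_halfline_def)
qed

theorem theorem2p1:
  fixes M :: "'a measure" and P :: "real \<Rightarrow> 'a measure" and F :: "real \<Rightarrow> 'a measure"
    and B L :: "real \<Rightarrow> 'a \<Rightarrow> real" and \<theta> :: "real \<Rightarrow> 'a \<Rightarrow> 'a" and \<beta> :: real
  assumes "brownian_family M P F B \<theta>"
    and "local_time_at_0 M P F B L"
    and "\<beta> > 0"
  shows "Domain (C0_generator (elastic_semigroup P B L \<beta>)) =
    {f \<in> C02_halfline. (deriv f \<longlongrightarrow> \<beta> * f 0) (at_right 0)}"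
proof -
  interpret brownian_family M P F B \<theta> by fact
  interpret elastic_brownian_family M P F B \<theta> L \<beta> by unfold_locales fact+
  show ?thesis
  proof (intro equalityI subsetI)
    fix f assume "f \<in> Domain (C0_generator (elastic_semigroup P B L \<beta>))"
    then obtain g where g: "(f, g) \<in> C0_generator (elastic_semigroup P B L \<beta>)" by blast
    \<comment> \<open>q is twice the image of f under 1/2 minus the generator. As the generator is
      half the second derivative on Robin functions, a Robin solution of u - u'' = q has the same
      image.\<close>
    define q where "q x = f x - 2 * g x" for x
    have "q \<in> C0_halfline"
      using g tendsto_diff[of f 0 at_top "\<lambda>x. 2 * g x" 0] tendsto_mult_right_zero[of g at_top 2]
      by (auto simp: C0_generator_def C0_halfline_def q_def[abs_def] intro!: continuous_intros)
    \<comment> \<open>Here \<open>f'\<close> is the candidate for f, not its derivative;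
      \<open>f' x - q x\<close> is the second derivative of the candidate.\<close>
    then obtain f' p where R: "robin_function \<beta> f' p (\<lambda>x. f' x - q x)"
      using resolvent_solution[OF _ assms(3)] by blast
    note g' = robin_function_in_generator[OF R]
    have eq: "f x / 2 - g x = f' x / 2 - (f' x - q x) / 2" for x
      by (simp add: q_def field_simps)
    have "f' x = f x" if "0 \<le> x" for x
      using generator_resolvent_le[OF g g' eq that] generator_resolvent_le[OF g' g eq[symmetric] that]
      by simp
    then interpret robin_function \<beta> f p "\<lambda>x. f' x - q x"
      by (rule robin_function_cong[OF R])
    show "f \<in> {f \<in> C02_halfline. (deriv f \<longlongrightarrow> \<beta> * f 0) (at_right 0)}"
      using in_C02 deriv_limit by simp
  next
    fix f assume "f \<in> {f \<in> C02_halfline. (deriv f \<longlongrightarrow> \<beta> * f 0) (at_right 0)}"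
    then obtain p h where "robin_function \<beta> f p h"
      using C02_halfline_imp_robin_function[OF _ _ assms(3)] by blast
    then show "f \<in> Domain (C0_generator (elastic_semigroup P B L \<beta>))"
      using robin_function_in_generator by blast
  qed
qed

end
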